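(* If $s>0$ and $N\ge1$ is an integer, then the minimal periodic log-Riesz $s$-energy of the unit interval is given, for $s\neq1$, by $$\mathcal E_{\text{log-Riesz},s}^{\mathrm p}([0,1),N)=4\left[N^{1+s}\log(N)\zeta(s)+\zeta'(s)N(N^s-1)+\sqrt\pi\,N(N-1)\frac{\Gamma'(\frac s2)\frac{s-1}2+\Gamma(\frac s2)}{\Gamma(\frac s2)^2(s-1)^2}\right],$$ and, for $s=1$, by $$\mathcal E_{\text{log-Riesz},1}^{\mathrm p}([0,1),N)=2(N\log(N))^2+4\gamma N^2\log(N)-N(N-1)\left(4\gamma_1+\tfrac12\big(\psi(\tfrac12)^2-\psi'(\tfrac12)\big)\right),$$ where $\psi=\Gamma'/\Gamma$, $\gamma$ is the Euler–Mascheroni constant, and $$\gamma_1=\lim_{m\to\infty}\left(-\frac{\log(m)^2}2+\sum_{k=1}^m\frac{\log(k)}k\right)$$ is the negative of the coefficient of $(s-1)$ in the Laurent expansion of $\zeta(s)$ around $1$.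
   Context: Here $d=1$ and the lattice is $\mathbb Z$. For $s>0$ let $d\tilde\mu_s(t)=\Gamma(s/2)^{-1}t^{s/2-1}(\log t-\psi(s/2))\,dt$ on $(0,\infty)$, the measure representing the log-Riesz potential: $|q|^{-s}\log(|q|^{-2})=\int_0^\infty e^{-q^2t}\,d\tilde\mu_s(t)$ for $q\ne0$. Let $$K_{\text{log-Riesz},s}^{\mathrm p}(x,y)=\sum_{v\in\mathbb Z}\int_1^\infty e^{-|x-y+v|^2t}\,d\tilde\mu_s(t)+\sum_{w\in\mathbb Z\setminus\{0\}}e^{2\pi i w(x-y)}\int_0^1\frac{\pi^{1/2}}{t^{1/2}}e^{-\pi^2w^2/t}\,d\tilde\mu_s(t).$$ Then $\mathcal E_{\text{log-Riesz},s}^{\mathrm p}([0,1),N)=\inf\{\sum_{j\ne k}K_{\text{log-Riesz},s}^{\mathrm p}(x_j,x_k):(x_j)_{j=1}^N\in[0,1)^N\}$. $\zeta$ is the (analytically continued) Riemann zeta function. *)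

theory Defs
  imports "HOL-Complex_Analysis.Complex_Analysis"
begin

(* Riemann's zeta function: the holomorphic function on the complex plane without 1 that continues
   the Dirichlet series. By the identity theorem the choice is unique away from 1; the value at the
   pole 1 is unspecified. The summand is (n+1) to the power -s, since the index starts at 0. *)
definition zeta :: "complex \<Rightarrow> complex" where
  "zeta = (SOME f. f holomorphic_on (- {1}) \<and>
             (\<forall>s. Re s > 1 \<longrightarrow> f s = (\<Sum>n. of_nat (Suc n) powr (- s))))"

(* Density of the signed measure \<mu>_s with respect to Lebesgue measure on (0, infinity). *)
definition log_riesz_density :: "real \<Rightarrow> real \<Rightarrow> real" where
  "log_riesz_density s t = t powr (s / 2 - 1) * (ln t - Digamma (s / 2)) / Gamma (s / 2)"

(* Integral of f over A against \<mu>_s, with values in the extended reals (integral of the positive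
   part minus integral of the negative part). The Bochner integral is unsuitable here: it is 0 for
   the divergent integrals that occur at coincident points. *)
definition log_riesz_integral :: "real \<Rightarrow> real set \<Rightarrow> (real \<Rightarrow> real) \<Rightarrow> ereal" where
  "log_riesz_integral s A f =
     enn2ereal (\<integral>\<^sup>+t\<in>A. ennreal (f t * log_riesz_density s t) \<partial>lborel)
     - enn2ereal (\<integral>\<^sup>+t\<in>A. ennreal (- (f t * log_riesz_density s t)) \<partial>lborel)"

(* Periodic log-Riesz kernel. It is +infinity when x - y is an integer: then one summand of the
   first sum is +infinity and the others are finite. The second sum converges absolutely and is
   real (the terms for w and -w are conjugate), so Re only adjusts its type. *)
definition log_riesz_kernel :: "real \<Rightarrow> real \<Rightarrow> real \<Rightarrow> ereal" where
  "log_riesz_kernel s x y =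
     (\<Sum>\<^sub>\<infinity>v\<in>(UNIV :: int set).
        log_riesz_integral s {1<..} (\<lambda>t. exp (- (\<bar>x - y + of_int v\<bar>^2) * t)))
     + ereal (Re (\<Sum>\<^sub>\<infinity>w\<in>UNIV - {0 :: int}.
        exp (2 * of_real pi * \<i> * of_int w * of_real (x - y)) *
        of_real (LINT t:{0<..<1}|lborel.
          sqrt pi / sqrt t * exp (- (pi^2 * (of_int w)^2 / t)) * log_riesz_density s t)))"

definition log_riesz_energy :: "real \<Rightarrow> nat \<Rightarrow> ereal" where
  "log_riesz_energy s N =
     (INF x\<in>{..<N} \<rightarrow>\<^sub>E {0..<1::real}.
        \<Sum>j<N. \<Sum>k\<in>{..<N} - {j}. log_riesz_kernel s (x j) (x k))"

definition gamma1_seq :: "nat \<Rightarrow> real" where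
  "gamma1_seq m = - ((ln (real m))^2 / 2) + (\<Sum>k=1..m. ln (real k) / real k)"

definition gamma1 :: real where
  "gamma1 = lim gamma1_seq"

end

theory Submission
  imports Defs "HOL-Probability.Probability"
begin

text \<open>
  Put \<open>\<theta>(x, t) = (\<Sum>v. exp (- (x + v)\<^sup>2 t))\<close>. By Poisson summation the kernel at distance \<open>x\<close>, not an integer, is the
  integral of \<open>\<theta>(x, t) - [t < 1] sqrt (\<pi> / t)\<close> against the measure, which is twice the derivative in \<open>s\<close> of
  the Mellin transform at \<open>s / 2\<close> divided by \<open>\<Gamma>(s / 2)\<close>.

  Differences of kernel values are limits of differences of
  \<open>(\<Sum>n<M. \<phi>(n + x) + \<phi>(n + 1 - x))\<close> with \<open>\<phi>(u) = - 2 u powr (- s) ln u\<close>. The function \<open>\<phi>\<close> is not convex, but the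
  sums \<open>(\<Sum>n<M. \<phi>(n + x))\<close> are convex on \<open>(0, 1)\<close>, so the kernel is convex there, and Jensen's inequality for the
  \<open>r\<close>-th neighbour gaps, which add up to \<open>r\<close>, shows that equally spaced points are optimal.

  For those, \<open>(\<Sum>r<N. \<theta>(r / N, t)) = \<theta>(0, t / N\<^sup>2)\<close> expresses the Mellin transform of the sum of the kernels
  through that of \<open>\<theta>(0, t)\<close>, that is, through \<open>\<zeta>(s)\<close>. At \<open>s = 1\<close> one multiplies by \<open>s - 1\<close> and
  differentiates twice.
\<close>

text \<open>The obstacle to optimality is that the measure is signed: the second derivative of
  \<phi> is negative for large arguments, so the usual argument for convex potentials fails term by
  term. The concave tail has to be outweighed by the terms near 0. This works because the relevant
  weight \<open>v powr (- a) * (\<kappa> - ln v)\<close> has an antiderivative proportional to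
  \<open>v powr (1 - a) * ln v\<close>, negative before 1 and positive after it, and the sum over n
  + x can be compared with the integral.

  For s at most 1 the lattice sum of the potential diverges; only differences of kernel values are
  limits of partial sums, since the counterterm \<open>sqrt (pi / t)\<close> cancels in them.
  Differences suffice for convexity but not for the value of the energy. The value comes from
  truncated theta functions that decay rapidly at both ends. Their Mellin transforms are entire, so
  one computation is valid on both sides of s = 1. Poisson summation is needed for the decay at 0 as
  well as for identifying the dual half of the kernel. At s = 1 the pole of zeta cancels against the
  pole of the counterterm, which is why the formula there involves second order data.\<close>

subsection \<open>Poisson summation for the Gaussian\<close>

text \<open>This is the characteristic function of the standard normal distribution after the
  substitution x = c y, where \<open>c = sqrt (2 * t)\<close> turns x^2 / 2 into y^2 t.\<close>

lemma gaussian_fourier_integral: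
  fixes t u :: real
  assumes t: "t > 0"
  shows "integrable lborel (\<lambda>y. exp (- (y^2) * t) * cos (u * y))"
    and "(LINT y|lborel. exp (- (y^2) * t) * cos (u * y)) = sqrt (pi / t) * exp (- (u^2) / (4 * t))"
proof -
  define c where "c = sqrt (2 * t)"
  have c: "c > 0" "c^2 = 2 * t" using t by (auto simp: c_def)
  have int: "integrable lborel std_normal_density"
    by simp
  have int2: "integrable lborel (\<lambda>y. std_normal_density y * cos (u / c * y))"
    by (rule Bochner_Integration.integrable_bound[OF int])
       (auto simp: abs_mult intro!: mult_left_le)
  have "complex_of_real (exp (- ((u / c)^2) / 2)) = char std_normal_distribution (u / c)"
    by (simp add: char_std_normal_distribution)
  also have "\<dots> = (CLINT x|lborel. std_normal_density x *\<^sub>R iexp (u / c * x))"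
    unfolding char_def by (subst integral_density) auto
  finally have "exp (- ((u / c)^2) / 2) = Re (CLINT x|lborel. std_normal_density x *\<^sub>R iexp (u / c * x))"
    by (metis Re_complex_of_real)
  also have "\<dots> = (LINT x|lborel. Re (std_normal_density x *\<^sub>R iexp (u / c * x)))"
  proof (rule integral_Re[symmetric])
    show "complex_integrable lborel (\<lambda>x. std_normal_density x *\<^sub>R iexp (u / c * x))"
      by (rule Bochner_Integration.integrable_bound[OF int]) auto
  qed
  also have "\<dots> = (LINT x|lborel. std_normal_density x * cos (u / c * x))"
    by (simp add: Re_exp)
  finally have 1: "(LINT x|lborel. std_normal_density x * cos (u / c * x)) = exp (- ((u / c)^2) / 2)" ..
  have eq: "std_normal_density (0 + c * y) * cos (u / c * (0 + c * y))
      = 1 / sqrt (2 * pi) * (exp (- (y^2) * t) * cos (u * y))" for y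
    using c by (simp add: std_normal_density_def power_mult_distrib mult.commute)
  have "integrable lborel (\<lambda>y. std_normal_density (0 + c * y) * cos (u / c * (0 + c * y)))"
    using lborel_integrable_real_affine[OF int2, of c 0] c by simp
  then have "integrable lborel (\<lambda>y. sqrt (2 * pi) * (1 / sqrt (2 * pi) * (exp (- (y^2) * t) * cos (u * y))))"
    unfolding eq by (rule integrable_mult_right)
  then show "integrable lborel (\<lambda>y. exp (- (y^2) * t) * cos (u * y))"
    by simp
  have "exp (- ((u / c)^2) / 2) = c * (LINT y|lborel. std_normal_density (0 + c * y) * cos (u / c * (0 + c * y)))"
    using lborel_integral_real_affine[of c "\<lambda>x. std_normal_density x * cos (u / c * x)" 0] c 1 by simp
  also have "\<dots> = c / sqrt (2 * pi) * (LINT y|lborel. exp (- (y^2) * t) * cos (u * y))"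
    unfolding eq by simp
  finally have "(LINT y|lborel. exp (- (y^2) * t) * cos (u * y)) = sqrt (2 * pi) / c * exp (- ((u / c)^2) / 2)"
    using c by (simp add: field_simps)
  also have "sqrt (2 * pi) / c = sqrt (pi / t)"
    unfolding c_def using t by (simp add: real_sqrt_divide real_sqrt_mult)
  also have "- ((u / c)^2) / 2 = - (u^2) / (4 * t)"
    using c by (simp add: power_divide)
  finally show "(LINT y|lborel. exp (- (y^2) * t) * cos (u * y)) = sqrt (pi / t) * exp (- (u^2) / (4 * t))" .
qed

text \<open>The trigonometric polynomials in \<open>cos (2 pi x)\<close> are dense in the even continuous functions
  on the circle, by Weierstrass.\<close>
lemma even_periodic_zero_of_cos_coeffs:
  fixes D :: "real \<Rightarrow> real"
  assumes cont: "continuous_on {0..1} D"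
    and sym: "\<And>x. x \<in> {0..1} \<Longrightarrow> D (1 - x) = D x"
    and coeff: "\<And>k::nat. integral {0..1} (\<lambda>x. D x * cos (2 * pi * real k * x)) = 0"
    and x: "x \<in> {0..1}"
  shows "D x = 0"
proof -
  have cI: "continuous_on {0..1} (\<lambda>x. D x * h x)" if "continuous_on {0..1} h" for h
    using cont that by (intro continuous_intros)
  have pow: "integral {0..1} (\<lambda>x. D x * (cos (2 * pi * real k * x) * cos (2 * pi * x) ^ j)) = 0" for k j
  proof (induction j arbitrary: k)
    case 0
    then show ?case using coeff by simp
  next
    case (Suc j)
    \<comment> \<open>k' is the absolute value of k - 1: the product formula yields the frequencies
      k + 1 and k - 1, and the cosine is even.\<close>
    define k' where "k' = (if k = 0 then 1 else k - 1)"
    have eq: "cos (2 * pi * real k * x) * cos (2 * pi * x)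
        = (cos (2 * pi * real (Suc k) * x) + cos (2 * pi * real k' * x)) / 2" for x
    proof (cases "k = 0")
      case False
      have "cos (2 * pi * real (Suc k) * x) = cos (2 * pi * real k * x + 2 * pi * x)"
        by (simp add: algebra_simps)
      moreover have "cos (2 * pi * real k' * x) = cos (2 * pi * real k * x - 2 * pi * x)"
        using False by (simp add: k'_def of_nat_diff algebra_simps)
      ultimately show ?thesis by (simp add: cos_add cos_diff)
    qed (simp add: k'_def)
    have "integral {0..1} (\<lambda>x. D x * (cos (2 * pi * real k * x) * cos (2 * pi * x) ^ Suc j))
      = integral {0..1} (\<lambda>x. 1/2 * (D x * (cos (2 * pi * real (Suc k) * x) * cos (2 * pi * x) ^ j))
          + 1/2 * (D x * (cos (2 * pi * real k' * x) * cos (2 * pi * x) ^ j)))"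
    proof (rule Henstock_Kurzweil_Integration.integral_cong)
      fix x :: real
      have "D x * (cos (2 * pi * real k * x) * cos (2 * pi * x) ^ Suc j)
          = D x * cos (2 * pi * x) ^ j * (cos (2 * pi * real k * x) * cos (2 * pi * x))"
        by (simp only: power_Suc mult_ac)
      then show "D x * (cos (2 * pi * real k * x) * cos (2 * pi * x) ^ Suc j)
        = 1/2 * (D x * (cos (2 * pi * real (Suc k) * x) * cos (2 * pi * x) ^ j))
          + 1/2 * (D x * (cos (2 * pi * real k' * x) * cos (2 * pi * x) ^ j))"
        unfolding eq by (simp add: field_simps)
    qed
    also have "\<dots> = 0"
    proof (subst Henstock_Kurzweil_Integration.integral_add)
      show "(\<lambda>x. 1/2 * (D x * (cos (2 * pi * real (Suc k) * x) * cos (2 * pi * x) ^ j))) integrable_on {0..1}"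
        "(\<lambda>x. 1/2 * (D x * (cos (2 * pi * real k' * x) * cos (2 * pi * x) ^ j))) integrable_on {0..1}"
        by (intro integrable_continuous_real continuous_intros cI)+
    next
      have "integral {0..1} (\<lambda>x. 1/2 * (D x * (cos (2 * pi * real m * x) * cos (2 * pi * x) ^ j))) = 0" for m
        by (subst Henstock_Kurzweil_Integration.integral_mult_right) (simp only: Suc.IH mult_zero_right)
      from this[of "Suc k"] this[of k'] show "integral {0..1} (\<lambda>x. 1/2 * (D x * (cos (2 * pi * real (Suc k) * x) * cos (2 * pi * x) ^ j)))
        + integral {0..1} (\<lambda>x. 1/2 * (D x * (cos (2 * pi * real k' * x) * cos (2 * pi * x) ^ j))) = 0"
        by linarith
    qed
    finally show ?case .
  qed
  have poly: "integral {0..1} (\<lambda>x. D x * p (cos (2 * pi * x))) = 0" if p: "real_polynomial_function p" for p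
  proof -
    obtain a n where a: "p = (\<lambda>x. \<Sum>i\<le>n. a i * x ^ i)"
      using p real_polynomial_function_iff_sum by blast
    have "integral {0..1} (\<lambda>x. D x * p (cos (2 * pi * x)))
        = integral {0..1} (\<lambda>x. \<Sum>i\<le>n. a i * (D x * (cos (2 * pi * real 0 * x) * cos (2 * pi * x) ^ i)))"
      by (simp add: a sum_distrib_left mult_ac)
    also have "\<dots> = (\<Sum>i\<le>n. integral {0..1} (\<lambda>x. a i * (D x * (cos (2 * pi * real 0 * x) * cos (2 * pi * x) ^ i))))"
      by (rule integral_sum) (auto intro!: integrable_continuous_real continuous_intros cI)
    also have "\<dots> = 0"
      by (simp only: Henstock_Kurzweil_Integration.integral_mult_right pow) simp
    finally show ?thesis .
  qed
  \<comment> \<open>Being symmetric under x to 1 - x, D depends on x only through cos (2 pi x);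
    arccos picks the representative in [0, 1/2].\<close>
  define h where "h c = D (arccos c / (2 * pi))" for c
  have hc: "continuous_on {-1..1} h"
    unfolding h_def
  proof (rule continuous_on_compose2[OF cont])
    show "continuous_on {-1..1} (\<lambda>c. arccos c / (2 * pi))"
      by (intro continuous_intros) auto
    show "(\<lambda>c. arccos c / (2 * pi)) ` {- 1..1} \<subseteq> {0..1}"
    proof safe
      fix c :: real assume "c \<in> {-1..1}"
      then have "0 \<le> arccos c" "arccos c \<le> pi"
        using arccos_lbound arccos_ubound by auto
      moreover have "pi \<le> 2 * pi" by simp
      ultimately have "0 \<le> arccos c" "arccos c \<le> 2 * pi" by linarith+
      then show "arccos c / (2 * pi) \<in> {0..1}" by (simp add: field_simps)
    qed
  qed
  have hD: "h (cos (2 * pi * x)) = D x" if "x \<in> {0..1}" for x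
  proof (cases "x \<le> 1/2")
    case True
    then have "2 * pi * x \<le> pi" using pi_gt_zero by (simp add: field_simps)
    then have "arccos (cos (2 * pi * x)) = 2 * pi * x"
      using that by (intro arccos_cos) auto
    then show ?thesis by (simp add: h_def)
  next
    case False
    then have "2 * pi * (1 - x) \<le> pi" using pi_gt_zero by (simp add: field_simps)
    then have "arccos (cos (2 * pi * (1 - x))) = 2 * pi * (1 - x)"
      using that by (intro arccos_cos) auto
    moreover have "cos (2 * pi * (1 - x)) = cos (2 * pi * x)"
      by (simp add: right_diff_distrib cos_diff)
    ultimately show ?thesis using sym[OF that] by (simp add: h_def)
  qed
  obtain B where B: "\<And>x. x \<in> {0..1} \<Longrightarrow> \<bar>D x\<bar> \<le> B" and "B > 0"
  proof -
    have "bounded (D ` {0..1})"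
      by (intro compact_imp_bounded compact_continuous_image cont) auto
    then show ?thesis unfolding bounded_pos using that by (metis image_eqI real_norm_def)
  qed
  \<comment> \<open>D is orthogonal to every polynomial p in cos (2 pi x), so the integral of D^2
    equals that of D (D - p), and p may be chosen uniformly close to D.\<close>
  have small: "integral {0..1} (\<lambda>x. D x * D x) \<le> B * e" if e: "e > 0" for e
  proof -
    obtain p where p: "real_polynomial_function p" "\<And>c. c \<in> {-1..1} \<Longrightarrow> \<bar>h c - p c\<bar> < e"
      using Stone_Weierstrass_real_polynomial_function[OF _ hc e] by auto
    have pc: "continuous_on {0..1} (\<lambda>x. p (cos (2 * pi * x)))"
    proof (rule continuous_on_compose2[of UNIV p])
      show "continuous_on UNIV p"
        using p(1) real_polynomial_function_eq continuous_on_polymonial_function by blast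
    qed (auto intro!: continuous_intros)
    have "integral {0..1} (\<lambda>x. D x * D x)
       = integral {0..1} (\<lambda>x. D x * D x) - integral {0..1} (\<lambda>x. D x * p (cos (2 * pi * x)))"
      using poly[OF p(1)] by simp
    also have "\<dots> = integral {0..1} (\<lambda>x. D x * D x - D x * p (cos (2 * pi * x)))"
      by (rule Henstock_Kurzweil_Integration.integral_diff[symmetric])
         (intro integrable_continuous_real cI cont pc)+
    also have "\<dots> \<le> integral {0..1} (\<lambda>x::real. B * e)"
    proof (rule Henstock_Kurzweil_Integration.integral_le)
      show "(\<lambda>x. D x * D x - D x * p (cos (2 * pi * x))) integrable_on {0..1}"
        by (intro integrable_continuous_real continuous_intros cI cont pc)
      fix x :: real assume x: "x \<in> {0..1}"
      have "D x * D x - D x * p (cos (2 * pi * x)) = D x * (h (cos (2 * pi * x)) - p (cos (2 * pi * x)))"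
        using hD[OF x] by (simp add: algebra_simps)
      also have "\<dots> \<le> \<bar>D x\<bar> * \<bar>h (cos (2 * pi * x)) - p (cos (2 * pi * x))\<bar>"
        by (metis abs_ge_self abs_mult)
      also have "\<dots> \<le> B * e"
        using B[OF x] p(2)[of "cos (2 * pi * x)"] \<open>B > 0\<close>
        by (intro mult_mono) (auto intro: less_imp_le)
      finally show "D x * D x - D x * p (cos (2 * pi * x)) \<le> B * e" .
    qed auto
    finally show ?thesis by simp
  qed
  have "integral {0..1} (\<lambda>x. D x * D x) \<le> 0"
  proof (rule field_le_epsilon)
    fix e :: real assume "e > 0"
    then show "integral {0..1} (\<lambda>x. D x * D x) \<le> 0 + e"
      using small[of "e / B"] \<open>B > 0\<close> by simp
  qed
  moreover have DD: "continuous_on {0..1} (\<lambda>x. D x * D x)"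
    by (intro cI cont)
  moreover have "integral {0..1} (\<lambda>x. D x * D x) \<ge> 0"
    by (rule Henstock_Kurzweil_Integration.integral_nonneg) (auto intro: integrable_continuous_real DD)
  ultimately have "integral {0..1} (\<lambda>x. D x * D x) = 0" by simp
  then have "((\<lambda>x. D x * D x) has_integral 0) {0..1}"
    using DD integrable_continuous_real integrable_integral by metis
  then have "D x * D x = 0"
    using has_integral_0_cbox_imp_0[of 0 1 "\<lambda>x. D x * D x" x] DD x by simp
  then show ?thesis by simp
qed

text \<open>For even \<phi> these are the terms v = n and v = - 1 - n of the sum of \<phi> (x + v)
  over the integers. Written this way, all arguments are nonnegative for x in [0, 1], so the same
  notion serves a \<phi> that is meaningful on the positive reals only.\<close>

definition paired_term :: "(real \<Rightarrow> real) \<Rightarrow> real \<Rightarrow> nat \<Rightarrow> real" where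
  "paired_term \<phi> x n = \<phi> (real n + x) + \<phi> (real n + 1 - x)"

lemma paired_term_reflect: "paired_term \<phi> (1 - x) n = paired_term \<phi> x n"
  by (simp add: paired_term_def algebra_simps)

definition gaussian :: "real \<Rightarrow> real \<Rightarrow> real" where
  "gaussian t u = exp (- (u^2 * t))"

lemma gaussian_nonneg [simp]: "gaussian t u \<ge> 0"
  by (simp add: gaussian_def)

lemma gaussian_even [simp]: "gaussian t (- u) = gaussian t u"
  by (simp add: gaussian_def)

lemma continuous_on_gaussian [continuous_intros]:
  "continuous_on A f \<Longrightarrow> continuous_on A (\<lambda>x. gaussian t (f x))"
  unfolding gaussian_def by (intro continuous_intros)

lemma gaussian_le:
  assumes "t \<ge> 0" "real n \<le> \<bar>u\<bar>"
  shows "gaussian t u \<le> exp (- t) ^ n"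
proof -
  have "real n * t \<le> u^2 * t"
  proof (rule mult_right_mono)
    have "real n \<le> real n * real n" by (cases n) auto
    also have "\<dots> \<le> \<bar>u\<bar> * \<bar>u\<bar>" using assms by (intro mult_mono) auto
    finally show "real n \<le> u^2" by (simp add: power2_eq_square)
  qed (use assms in auto)
  then show ?thesis unfolding gaussian_def by (simp add: exp_of_nat_mult[symmetric])
qed

lemma summable_exp_power: "t > 0 \<Longrightarrow> summable (\<lambda>n. exp (- t :: real) ^ n)"
  by (rule summable_geometric) simp

lemma paired_gaussian_bounds:
  assumes "t \<ge> 0" "x \<in> {0..1}"
  shows "paired_term (gaussian t) x n \<le> 2 * exp (- t) ^ n" "paired_term (gaussian t) x n \<ge> 0"
proof -
  have "gaussian t (real n + x) \<le> exp (- t) ^ n" "gaussian t (real n + 1 - x) \<le> exp (- t) ^ n"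
    using assms by (auto intro!: gaussian_le)
  then show "paired_term (gaussian t) x n \<le> 2 * exp (- t) ^ n"
    by (simp add: paired_term_def)
qed (simp add: paired_term_def)

lemma summable_paired_gaussian:
  assumes "t > 0" "x \<in> {0..1}"
  shows "summable (paired_term (gaussian t) x)"
proof (rule summable_comparison_test'[where N = 0])
  show "summable (\<lambda>n. 2 * exp (- t) ^ n)" using summable_exp_power[OF assms(1)] by (rule summable_mult)
  show "norm (paired_term (gaussian t) x n) \<le> 2 * exp (- t) ^ n" for n
    using paired_gaussian_bounds[of t x n] assms by simp
qed

text \<open>Unfolding: the n-th term covers the intervals [n, n + 1] and [- n - 1, - n], and these
  tile [- M, M].\<close>

lemma integral_paired_term:
  assumes h: "continuous_on UNIV h" and even: "\<And>u. h (- u) = h u"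
  shows "(\<Sum>n<M. integral {0..1} (\<lambda>x. paired_term h x n)) = integral {- real M..real M} (\<lambda>u. h u)"
proof -
  have io: "h integrable_on {a..b}" for a b
    by (rule integrable_continuous_real) (rule continuous_on_subset[OF h], simp)
  have 1: "integral {0..1} (\<lambda>x. h (real n + x)) = integral {real n..real n + 1} h" for n
    using integral_shift_Icc_real[of 0 1 h "real n"] by (simp add: o_def add.commute)
  have 2: "integral {0..1} (\<lambda>x. h (real n + 1 - x)) = integral {- (real n + 1)..- real n} h" for n
  proof -
    have "integral {0..1} (\<lambda>x. h (real n + 1 - x)) = integral {0..1} (\<lambda>x. h (- (real n + 1) + x))"
      by (metis even minus_add_distrib minus_minus diff_conv_add_uminus)
    also have "\<dots> = integral {- (real n + 1)..- real n} h"
      using integral_shift_Icc_real[of 0 1 h "- (real n + 1)"] by (simp add: o_def add.commute)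
    finally show ?thesis .
  qed
  show ?thesis
  proof (induction M)
    case (Suc M)
    have "integral {0..1} (\<lambda>x. paired_term h x M)
        = integral {0..1} (\<lambda>x. h (real M + x)) + integral {0..1} (\<lambda>x. h (real M + 1 - x))"
      unfolding paired_term_def
      by (intro Henstock_Kurzweil_Integration.integral_add integrable_continuous_real
          continuous_on_compose2[OF h] continuous_intros) auto
    also have "\<dots> = integral {real M..real M + 1} h + integral {- (real M + 1)..- real M} h"
      by (simp only: 1 2)
    finally have "(\<Sum>n<Suc M. integral {0..1} (\<lambda>x. paired_term h x n))
       = integral {- (real M + 1)..- real M} h + integral {- real M..real M} h + integral {real M..real M + 1} h"
      using Suc by simp
    also have "integral {- (real M + 1)..- real M} h + integral {- real M..real M} h = integral {- (real M + 1)..real M} h"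
      by (rule Henstock_Kurzweil_Integration.integral_combine) (auto intro: io)
    also have "\<dots> + integral {real M..real M + 1} h = integral {- (real M + 1)..real M + 1} h"
      by (rule Henstock_Kurzweil_Integration.integral_combine) (auto intro: io)
    finally show ?case by (simp add: add.commute)
  qed simp
qed

lemma integral_symmetric_LIMSEQ:
  fixes h :: "real \<Rightarrow> real"
  assumes h: "continuous_on UNIV h" and int: "integrable lborel h"
  shows "(\<lambda>M. integral {- real M..real M} h) \<longlonglongrightarrow> (LINT u|lborel. h u)"
proof -
  have eq: "integral {- real M..real M} h = (LINT u|lborel. indicator {- real M..real M} u * h u)" for M
  proof -
    have "set_integrable lborel {- real M..real M} h"
      by (rule borel_integrable_atLeastAtMost') (rule continuous_on_subset[OF h], simp)
    from set_borel_integral_eq_integral(2)[OF this] show ?thesis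
      by (simp add: set_lebesgue_integral_def)
  qed
  show ?thesis unfolding eq
  proof (rule integral_dominated_convergence[where w = "\<lambda>u. \<bar>h u\<bar>"])
    show "AE u in lborel. (\<lambda>M. indicator {- real M..real M} u * h u) \<longlonglongrightarrow> h u"
    proof (rule AE_I2)
      fix u :: real
      have "eventually (\<lambda>M. indicator {- real M..real M} u * h u = h u) sequentially"
        using eventually_ge_at_top[of "nat \<lceil>\<bar>u\<bar>\<rceil>"]
      proof eventually_elim
        case (elim M)
        then have "\<bar>u\<bar> \<le> real M" by linarith
        then show ?case by (auto simp: indicator_def)
      qed
      then show "(\<lambda>M. indicator {- real M..real M} u * h u) \<longlonglongrightarrow> h u"
        by (rule tendsto_eventually)
    qed
    show "integrable lborel (\<lambda>u. \<bar>h u\<bar>)" using int by simp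
    show "AE u in lborel. norm (indicator {- real M..real M} u * h u) \<le> \<bar>h u\<bar>" for M
      by (auto simp: indicator_def)
  qed (use borel_measurable_integrable[OF int] in measurable)
qed

lemma integral_cos_cos:
  fixes m k :: nat
  shows "integral {0..1} (\<lambda>x. cos (2 * pi * real m * x) * cos (2 * pi * real k * x))
    = (if m = k then if k = 0 then 1 else 1 / 2 else 0)"
proof -
  have c: "integral {0..1} (\<lambda>x. cos (2 * pi * of_int j * x)) = (if j = 0 then 1 else 0)" for j :: int
  proof (cases "j = 0")
    case False
    have "((\<lambda>x. cos (2 * pi * of_int j * x)) has_integral
       (sin (2 * pi * of_int j * 1) / (2 * pi * of_int j) - sin (2 * pi * of_int j * 0) / (2 * pi * of_int j))) {0..1}"
      using False by (intro fundamental_theorem_of_calculus)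
        (auto intro!: derivative_eq_intros simp: has_real_derivative_iff_has_vector_derivative[symmetric])
    moreover have "sin (2 * pi * of_int j * 1) = 0"
      by (metis mult.commute mult.right_neutral sin_int_2pin)
    ultimately show ?thesis using False by (simp add: integral_unique)
  qed simp
  have eq: "cos (2 * pi * real m * x) * cos (2 * pi * real k * x)
     = 1/2 * cos (2 * pi * of_int (int m - int k) * x) + 1/2 * cos (2 * pi * of_int (int m + int k) * x)" for x
    using cos_times_cos[of "2 * pi * real m * x" "2 * pi * real k * x"] by (simp add: algebra_simps)
  have "integral {0..1} (\<lambda>x. cos (2 * pi * real m * x) * cos (2 * pi * real k * x))
      = integral {0..1} (\<lambda>x. 1/2 * cos (2 * pi * of_int (int m - int k) * x))
      + integral {0..1} (\<lambda>x. 1/2 * cos (2 * pi * of_int (int m + int k) * x))"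
    unfolding eq by (intro Henstock_Kurzweil_Integration.integral_add integrable_continuous_real continuous_intros)
  also have "\<dots> = 1/2 * (if int m - int k = 0 then 1 else 0) + 1/2 * (if int m + int k = 0 then 1 else 0)"
    by (simp only: Henstock_Kurzweil_Integration.integral_mult_right c)
  also have "\<dots> = (if m = k then if k = 0 then 1 else 1 / 2 else 0)" by auto
  finally show ?thesis .
qed

text \<open>The index n stands for the frequencies n + 1 and - (n + 1), whose exponentials combine
  to twice this cosine; the zero frequency is kept apart.\<close>

definition dual_term :: "real \<Rightarrow> real \<Rightarrow> nat \<Rightarrow> real" where
  "dual_term t x n = exp (- (pi^2 * (real (Suc n))^2 / t)) * cos (2 * pi * real (Suc n) * x)"

lemma dual_term_bound:
  assumes "t > 0"
  shows "\<bar>dual_term t x n\<bar> \<le> exp (- (pi^2 / t)) ^ Suc n"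
proof -
  have "\<bar>dual_term t x n\<bar> \<le> gaussian (pi^2 / t) (real (Suc n)) * 1"
    unfolding dual_term_def abs_mult gaussian_def
    by (intro mult_mono) (auto simp: mult.commute)
  also have "\<dots> \<le> exp (- (pi^2 / t)) ^ Suc n"
    using gaussian_le[of "pi^2 / t" "Suc n" "real (Suc n)"] assms by simp
  finally show ?thesis .
qed

lemma summable_dual_term:
  assumes "t > 0"
  shows "summable (\<lambda>n. \<bar>dual_term t x n\<bar>)" "summable (dual_term t x)"
proof -
  show "summable (\<lambda>n. \<bar>dual_term t x n\<bar>)"
  proof (rule summable_comparison_test'[where N = 0])
    show "summable (\<lambda>n. exp (- (pi^2 / t)) ^ Suc n)"
      using summable_exp_power[of "pi^2 / t"] assms by (subst summable_Suc_iff) simp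
    show "norm \<bar>dual_term t x n\<bar> \<le> exp (- (pi^2 / t)) ^ Suc n" for n
      using dual_term_bound[OF assms] by simp
  qed
  then show "summable (dual_term t x)" by (rule summable_rabs_cancel)
qed

text \<open>D is the difference of the two sides, arranged as one uniformly convergent series so
  that it is continuous and can be integrated termwise. Its cosine coefficients vanish because those
  of the left side unfold to Gaussian Fourier integrals over the line. Hence D vanishes by
  \<open>even_periodic_zero_of_cos_coeffs\<close>.\<close>

theorem poisson_summation_gaussian:
  fixes t x :: real
  assumes t: "t > 0" and x: "x \<in> {0..1}"
  shows "(\<Sum>n. paired_term (gaussian t) x n) = sqrt (pi / t) * (1 + 2 * (\<Sum>n. dual_term t x n))"
proof -
  define q where "q = sqrt (pi / t)"
  have q: "q > 0" using t by (simp add: q_def)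
  define d where "d n x = paired_term (gaussian t) x n - q * (2 * dual_term t x n)" for n x
  define D where "D x = (\<Sum>n. d n x) - q" for x
  define M where "M n = 2 * exp (- t) ^ n + q * (2 * exp (- (pi^2 / t)) ^ Suc n)" for n
  have M: "summable M"
    unfolding M_def using t summable_exp_power[of "pi^2 / t"]
    by (intro summable_add summable_mult summable_exp_power) (auto simp: summable_Suc_iff simp del: power_Suc)
  have dM: "\<bar>d n y\<bar> \<le> M n" if "y \<in> {0..1}" for n y
  proof -
    have "\<bar>d n y\<bar> \<le> \<bar>paired_term (gaussian t) y n\<bar> + \<bar>q * (2 * dual_term t y n)\<bar>"
      unfolding d_def by (rule abs_triangle_ineq4)
    also have "\<bar>q * (2 * dual_term t y n)\<bar> = q * (2 * \<bar>dual_term t y n\<bar>)"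
      using q by (simp add: abs_mult)
    also have "\<bar>paired_term (gaussian t) y n\<bar> + q * (2 * \<bar>dual_term t y n\<bar>) \<le> M n"
      unfolding M_def using paired_gaussian_bounds[of t y n] t that dual_term_bound[OF t, of y n] q
      by (intro add_mono mult_left_mono) auto
    finally show ?thesis .
  qed
  have sd: "summable (\<lambda>n. d n y)" if "y \<in> {0..1}" for y
    using dM[OF that] by (intro summable_comparison_test'[OF M, where N = 0]) auto
  have cd: "continuous_on A (d n)" for A n
    unfolding d_def paired_term_def dual_term_def by (intro continuous_intros)
  \<comment> \<open>The bounded multiplier c allows two uses: c = 1 for the continuity of D, and a
    cosine for its coefficients.\<close>
  have ul: "uniform_limit {0..1} (\<lambda>m y. \<Sum>n<m. d n y * c y) (\<lambda>y. \<Sum>n. d n y * c y) sequentially"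
    if c: "\<And>y. \<bar>c y\<bar> \<le> 1" for c
  proof (rule Weierstrass_m_test[OF _ M])
    fix n and y :: real assume y: "y \<in> {0..1}"
    have "norm (d n y * c y) \<le> \<bar>d n y\<bar> * 1"
      unfolding real_norm_def abs_mult using c by (intro mult_left_mono) auto
    then show "norm (d n y * c y) \<le> M n" using dM[OF y, of n] by simp
  qed
  have contD: "continuous_on {0..1} D"
  proof -
    have "continuous_on {0..1} (\<lambda>y. \<Sum>n. d n y * 1)"
      using ul[of "\<lambda>_. 1"]
      by (rule uniform_limit_theorem[rotated]) (auto intro!: always_eventually continuous_intros cd)
    then show ?thesis unfolding D_def by (intro continuous_intros) simp
  qed
  have coeff: "integral {0..1} (\<lambda>x. D x * cos (2 * pi * real k * x)) = 0" for k
  proof -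
    define c where "c = (\<lambda>x. cos (2 * pi * real k * x))"
    have cc: "continuous_on A c" for A unfolding c_def by (intro continuous_intros)
    define E where "E = q * exp (- (pi^2 * (real k)^2 / t))"
    define h where "h = (\<lambda>u. gaussian t u * cos (2 * pi * real k * u))"
    \<comment> \<open>The contribution of the n-th dual term to the k-th coefficient, with the case
      distinction of \<open>integral_cos_cos\<close>; only n + 1 = k contributes, with the value
      E.\<close>
    define e where "e n = q * (2 * exp (- (pi^2 * (real (Suc n))^2 / t))) * (if Suc n = k then if k = 0 then 1 else 1 / 2 else 0)" for n
    obtain I J where I: "\<And>m. ((\<lambda>y. \<Sum>n<m. d n y * c y) has_integral I m) {0..1}"
      and J: "((\<lambda>y. \<Sum>n. d n y * c y) has_integral J) {0..1}" and IJ: "I \<longlonglongrightarrow> J"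
    proof (rule uniform_limit_integral_cbox)
      show "uniform_limit (cbox 0 1) (\<lambda>m y. \<Sum>n<m. d n y * c y) (\<lambda>y. \<Sum>n. d n y * c y) sequentially"
        using ul[of c] by (simp add: c_def)
      show "continuous_on (cbox 0 1) (\<lambda>y. \<Sum>n<m. d n y * c y)" for m
        by (intro continuous_intros cd cc)
    qed auto
    \<comment> \<open>The cosine has period 1 and is even, so it can be moved inside the lattice
      sum. This is what makes the coefficient unfold to an integral over the line.\<close>
    have hper: "paired_term (gaussian t) y n * c y = paired_term h y n" for n y
    proof -
      have "cos (2 * pi * real k * (real n + y)) = c y"
      proof -
        have "2 * pi * real k * (real n + y) = 2 * pi * real k * y + of_int (int (k * n)) * (2 * pi)"
          by (simp add: algebra_simps)
        then show ?thesis unfolding c_def using cos.plus_of_int[of "2 * pi * real k * y" "int (k * n)"] by simp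
      qed
      moreover have "cos (2 * pi * real k * (real n + 1 - y)) = c y"
      proof -
        have "2 * pi * real k * (real n + 1 - y) = - (2 * pi * real k * y) + of_int (int (k * Suc n)) * (2 * pi)"
          by (simp add: algebra_simps)
        then show ?thesis unfolding c_def using cos.plus_of_int[of "- (2 * pi * real k * y)" "int (k * Suc n)"] by simp
      qed
      ultimately show ?thesis by (simp add: paired_term_def h_def algebra_simps)
    qed
    have hc: "continuous_on UNIV h"
      unfolding h_def by (intro continuous_intros)
    have heven: "h (- u) = h u" for u
      by (simp add: h_def)
    have Im: "I m = integral {- real m..real m} h - (\<Sum>n<m. e n)" for m
    proof -
      have dn: "integral {0..1} (\<lambda>y. d n y * c y)
          = integral {0..1} (\<lambda>y. paired_term h y n) - e n" for n
      proof -
        have "integral {0..1} (\<lambda>y. d n y * c y)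
          = integral {0..1} (\<lambda>y. paired_term h y n
              - q * (2 * exp (- (pi^2 * (real (Suc n))^2 / t))) * (cos (2 * pi * real (Suc n) * y) * cos (2 * pi * real k * y)))"
          unfolding d_def hper[symmetric] c_def dual_term_def
          by (rule Henstock_Kurzweil_Integration.integral_cong) (simp add: algebra_simps)
        also have "\<dots> = integral {0..1} (\<lambda>y. paired_term h y n)
           - integral {0..1} (\<lambda>y. q * (2 * exp (- (pi^2 * (real (Suc n))^2 / t))) * (cos (2 * pi * real (Suc n) * y) * cos (2 * pi * real k * y)))"
          unfolding paired_term_def h_def
          by (intro Henstock_Kurzweil_Integration.integral_diff integrable_continuous_real continuous_intros)
        finally show ?thesis
          by (simp only: Henstock_Kurzweil_Integration.integral_mult_right integral_cos_cos e_def)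
      qed
      have "I m = integral {0..1} (\<lambda>y. \<Sum>n<m. d n y * c y)"
        using I[of m] by (simp add: integral_unique)
      also have "\<dots> = (\<Sum>n<m. integral {0..1} (\<lambda>y. d n y * c y))"
        by (rule integral_sum) (auto intro!: integrable_continuous_real continuous_intros cd cc)
      finally show ?thesis
        by (simp add: dn sum_subtractf integral_paired_term[OF hc heven])
    qed
    have ev: "eventually (\<lambda>m. (\<Sum>n<m. e n) = (if k = 0 then 0 else E)) sequentially"
      using eventually_ge_at_top[of k]
    proof eventually_elim
      case (elim m)
      show ?case
      proof (cases k)
        case (Suc k')
        then have "(\<Sum>n<m. e n) = (\<Sum>n<m. if n = k' then E else 0)"
          by (intro sum.cong) (auto simp: E_def e_def)
        also have "\<dots> = E" using elim Suc by simp
        finally show ?thesis using Suc by simp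
      qed (simp add: e_def)
    qed
    \<comment> \<open>For k > 0 the Fourier integral E cancels against the dual term of frequency k.
      For k = 0 it remains and equals q, which is matched by the constant q subtracted in D.\<close>
    have "I \<longlonglongrightarrow> (LINT u|lborel. h u) - (if k = 0 then 0 else E)"
      unfolding Im
      using gaussian_fourier_integral(1)[OF t, of "2 * pi * real k"]
      by (intro tendsto_diff integral_symmetric_LIMSEQ hc tendsto_eventually ev) (simp add: h_def gaussian_def)
    also have "(LINT u|lborel. h u) = E"
      using gaussian_fourier_integral(2)[OF t, of "2 * pi * real k"]
      by (simp add: h_def gaussian_def E_def q_def power_mult_distrib)
    finally have "J = (if k = 0 then q else 0)"
      using LIMSEQ_unique[OF IJ] by (auto simp: E_def)
    have "integral {0..1} (\<lambda>x. D x * c x) = integral {0..1} (\<lambda>x. (\<Sum>n. d n x * c x) - q * c x)"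
    proof (rule Henstock_Kurzweil_Integration.integral_cong)
      fix x :: real assume "x \<in> {0..1}"
      from suminf_mult2[OF sd[OF this], of "c x"]
      show "D x * c x = (\<Sum>n. d n x * c x) - q * c x" by (simp add: D_def left_diff_distrib)
    qed
    also have "\<dots> = integral {0..1} (\<lambda>x. \<Sum>n. d n x * c x) - integral {0..1} (\<lambda>x. q * c x)"
      using J by (intro Henstock_Kurzweil_Integration.integral_diff)
        (auto intro: has_integral_integrable intro!: integrable_continuous_real[of 0 1 "\<lambda>x. q * c x"] continuous_intros cc)
    also have "integral {0..1} (\<lambda>x. q * c x) = q * integral {0..1} (\<lambda>x. cos (2 * pi * real 0 * x) * cos (2 * pi * real k * x))"
      by (simp add: c_def)
    also have "\<dots> = (if k = 0 then q else 0)"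
      by (simp only: integral_cos_cos) auto
    also have "integral {0..1} (\<lambda>x. \<Sum>n. d n x * c x) = J"
      using J by (rule integral_unique)
    finally show ?thesis unfolding c_def \<open>J = _\<close> by simp
  qed
  have sym: "D (1 - y) = D y" for y
  proof -
    have "dual_term t (1 - y) n = dual_term t y n" for n
    proof -
      have "2 * pi * real (Suc n) * (1 - y) = - (2 * pi * real (Suc n) * y) + of_int (int (Suc n)) * (2 * pi)"
        by (simp add: algebra_simps)
      then show ?thesis
        unfolding dual_term_def using cos.plus_of_int[of "- (2 * pi * real (Suc n) * y)" "int (Suc n)"] by simp
    qed
    then show ?thesis by (simp add: D_def d_def paired_term_reflect)
  qed
  have "D x = 0"
    by (rule even_periodic_zero_of_cos_coeffs[OF contD sym coeff x])
  moreover have "(\<Sum>n. d n x) = (\<Sum>n. paired_term (gaussian t) x n) - q * (2 * (\<Sum>n. dual_term t x n))"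
    unfolding d_def
    using summable_paired_gaussian[OF t x] summable_dual_term(2)[OF t, of x]
    by (simp add: suminf_diff[symmetric] suminf_mult[symmetric] summable_mult)
  ultimately show ?thesis by (simp add: D_def q_def algebra_simps)
qed

subsection \<open>Mellin transforms and the logarithmic density\<close>

text \<open>The power is written as an exponential of \<open>(z - 1) * ln t\<close>, so that it is
  visibly entire in z. Absolute convergence depends on z only through its real part, hence the real
  parameter of \<open>mellin_converges\<close>.\<close>

definition mellin :: "(real \<Rightarrow> real) \<Rightarrow> complex \<Rightarrow> complex" where
  "mellin f z = (LINT t:{0<..}|lborel. of_real (f t) * exp ((z - 1) * of_real (ln t)))"

definition mellin_converges :: "(real \<Rightarrow> real) \<Rightarrow> real \<Rightarrow> bool" where
  "mellin_converges f a \<longleftrightarrow> f \<in> borel_measurable borel \<and> set_integrable lborel {0<..} (\<lambda>t. f t * t powr (a - 1))"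

lemma exp_of_real_ln:
  assumes "t > 0"
  shows "norm (exp ((z - 1) * of_real (ln t))) = t powr (Re z - 1)"
    "exp ((of_real a - 1) * of_real (ln t)) = complex_of_real (t powr (a - 1))"
    "exp ((a - 1) * ln t) = t powr (a - 1)"
proof -
  show "norm (exp ((z - 1) * of_real (ln t))) = t powr (Re z - 1)"
    using assms by (simp add: norm_exp_eq_Re powr_def)
  show "exp ((of_real a - 1) * of_real (ln t)) = complex_of_real (t powr (a - 1))"
    using assms by (simp add: powr_def exp_of_real[symmetric])
  show "exp ((a - 1) * ln t) = t powr (a - 1)"
    using assms by (simp add: powr_def)
qed

lemma mellin_convergesD:
  assumes "mellin_converges f (Re z)"
  shows "set_integrable lborel {0<..} (\<lambda>t. of_real (f t) * exp ((z - 1) * of_real (ln t)))"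
proof -
  have [measurable]: "f \<in> borel_measurable borel" and i: "set_integrable lborel {0<..} (\<lambda>t. f t * t powr (Re z - 1))"
    using assms by (auto simp: mellin_converges_def)
  show ?thesis
    by (rule set_integrable_bound[OF i])
       (auto simp: set_borel_measurable_def norm_mult exp_of_real_ln abs_mult intro!: AE_I2)
qed

lemma norm_exp_minus_affine_le: "norm (exp w - 1 - w) \<le> (norm w)^2 * exp (norm w)" for w :: complex
proof -
  have "norm (exp w - (\<Sum>i\<le>1. w ^ i / fact i)) \<le> exp \<bar>Re w\<bar> * (norm w) ^ Suc 1 / fact 1"
    by (rule Taylor_exp)
  also have "\<dots> \<le> exp (norm w) * (norm w)^2"
    by (simp add: power2_eq_square mult_right_mono abs_Re_le_cmod)
  finally show ?thesis by (simp add: algebra_simps)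
qed

text \<open>Inside a strip of convergence there is room for an extra factor that is a small power of
  t or 1 / t: large t is absorbed by the right edge b, small t by the left edge a.\<close>

lemma powr_exp_abs_ln_le:
  fixes t \<sigma> \<delta> a b :: real
  assumes "t > 0" "a + \<delta> \<le> \<sigma>" "\<sigma> + \<delta> \<le> b"
  shows "t powr (\<sigma> - 1) * exp (\<delta> * \<bar>ln t\<bar>) \<le> t powr (a - 1) + t powr (b - 1)"
proof (cases "t \<ge> 1")
  case True
  have "t powr (\<sigma> - 1) * exp (\<delta> * \<bar>ln t\<bar>) = t powr (\<sigma> + \<delta> - 1)"
    using True assms by (simp add: powr_def exp_add[symmetric] algebra_simps)
  also have "\<dots> \<le> t powr (b - 1)" using True assms by (intro powr_mono) auto
  finally show ?thesis using powr_ge_zero[of t "a - 1"] by linarith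
next
  case False
  then have "t powr (\<sigma> - 1) * exp (\<delta> * \<bar>ln t\<bar>) = t powr (\<sigma> - \<delta> - 1)"
    using assms by (simp add: powr_def exp_add[symmetric] algebra_simps abs_if)
  also have "\<dots> \<le> t powr (a - 1)" using False assms by (intro powr_mono') auto
  finally show ?thesis using powr_ge_zero[of t "b - 1"] by linarith
qed

text \<open>Differentiation under the integral with an explicit error: the remainder of
  \<open>exp (h * ln t)\<close> after its linear part is at most
  \<open>|h ln t|^2 * exp (|h ln t|)\<close>, and the strip leaves room to integrate this uniformly
  in small h. The error is then quadratic in h.\<close>

lemma mellin_has_field_derivative:
  fixes f :: "real \<Rightarrow> real"
  assumes conv: "mellin_converges f a" "mellin_converges f b" and z: "a < Re z" "Re z < b"
  shows "set_integrable lborel {0<..} (\<lambda>t. of_real (f t) * exp ((z - 1) * of_real (ln t)))"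
    and "set_integrable lborel {0<..} (\<lambda>t. of_real (f t * ln t) * exp ((z - 1) * of_real (ln t)))"
    and "(mellin f has_field_derivative
           (LINT t:{0<..}|lborel. of_real (f t * ln t) * exp ((z - 1) * of_real (ln t)))) (at z)"
proof -
  define \<sigma> where "\<sigma> = Re z"
  \<comment> \<open>Half the distance to the nearer edge, so that \<delta> fits twice: once for the
    shift by h and once for the factor \<open>(ln t)^2\<close>.\<close>
  define \<delta> where "\<delta> = min (\<sigma> - a) (b - \<sigma>) / 2"
  have \<delta>: "\<delta> > 0" "a + 2 * \<delta> \<le> \<sigma>" "\<sigma> + 2 * \<delta> \<le> b"
    using z by (auto simp: \<delta>_def \<sigma>_def min_def field_simps)
  have [measurable]: "f \<in> borel_measurable borel"
    and ia: "set_integrable lborel {0<..} (\<lambda>t. f t * t powr (a - 1))"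
    and ib: "set_integrable lborel {0<..} (\<lambda>t. f t * t powr (b - 1))"
    using conv by (auto simp: mellin_converges_def)
  define B where "B t = \<bar>f t\<bar> * (t powr (a - 1) + t powr (b - 1))" for t
  have iB: "set_integrable lborel {0<..} B"
  proof -
    have "set_integrable lborel {0<..} (\<lambda>t. \<bar>f t * t powr (a - 1)\<bar> + \<bar>f t * t powr (b - 1)\<bar>)"
      using ia ib by (intro set_integral_add(1) set_integrable_abs)
    then show ?thesis unfolding B_def by (simp add: abs_mult algebra_simps)
  qed
  have B0: "B t \<ge> 0" for t by (simp add: B_def)
  have dom: "\<bar>f t\<bar> * t powr (\<sigma> - 1) * exp (2 * \<delta> * \<bar>ln t\<bar>) \<le> B t" if "t > 0" for t
    unfolding B_def using mult_left_mono[OF powr_exp_abs_ln_le[OF that \<delta>(2,3)], of "\<bar>f t\<bar>"]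
    by (simp add: mult_ac)
  have e1: "exp (2 * \<delta> * \<bar>ln t\<bar>) \<ge> 1" for t using \<delta> by simp
  have e2: "\<delta> * \<bar>ln t\<bar> \<le> exp (2 * \<delta> * \<bar>ln t\<bar>)" for t
  proof -
    have "\<delta> * \<bar>ln t\<bar> \<le> 1 + 2 * \<delta> * \<bar>ln t\<bar>" using \<delta> by (simp add: add_nonneg_nonneg)
    also have "\<dots> \<le> exp (2 * \<delta> * \<bar>ln t\<bar>)" by (rule exp_ge_add_one_self)
    finally show ?thesis .
  qed
  show i0: "set_integrable lborel {0<..} (\<lambda>t. of_real (f t) * exp ((z - 1) * of_real (ln t)))"
  proof (rule set_integrable_bound[OF iB])
    show "AE t in lborel. t \<in> {0<..} \<longrightarrow> norm (complex_of_real (f t) * exp ((z - 1) * of_real (ln t))) \<le> norm (B t)"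
    proof (intro AE_I2 impI)
      fix t :: real assume t: "t \<in> {0<..}"
      have "norm (complex_of_real (f t) * exp ((z - 1) * of_real (ln t))) = \<bar>f t\<bar> * t powr (\<sigma> - 1) * 1"
        using t by (simp add: norm_mult exp_of_real_ln \<sigma>_def)
      also have "\<dots> \<le> \<bar>f t\<bar> * t powr (\<sigma> - 1) * exp (2 * \<delta> * \<bar>ln t\<bar>)"
        by (intro mult_left_mono e1) auto
      finally show "norm (complex_of_real (f t) * exp ((z - 1) * of_real (ln t))) \<le> norm (B t)"
        using dom[of t] t by simp
    qed
  qed (simp add: set_borel_measurable_def)
  show i1: "set_integrable lborel {0<..} (\<lambda>t. of_real (f t * ln t) * exp ((z - 1) * of_real (ln t)))"
  proof (rule set_integrable_bound)
    show "set_integrable lborel {0<..} (\<lambda>t. 1 / \<delta> * B t)"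
      using iB by simp
    show "AE t in lborel. t \<in> {0<..} \<longrightarrow>
      norm (complex_of_real (f t * ln t) * exp ((z - 1) * of_real (ln t))) \<le> norm (1 / \<delta> * B t)"
    proof (intro AE_I2 impI)
      fix t :: real assume t: "t \<in> {0<..}"
      have "norm (complex_of_real (f t * ln t) * exp ((z - 1) * of_real (ln t)))
          = 1 / \<delta> * (\<bar>f t\<bar> * t powr (\<sigma> - 1) * (\<delta> * \<bar>ln t\<bar>))"
        using t \<delta> by (simp add: norm_mult exp_of_real_ln \<sigma>_def)
      also have "\<dots> \<le> 1 / \<delta> * (\<bar>f t\<bar> * t powr (\<sigma> - 1) * exp (2 * \<delta> * \<bar>ln t\<bar>))"
        using \<delta> by (intro mult_left_mono e2) auto
      also have "\<dots> \<le> 1 / \<delta> * B t"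
        using dom[of t] t \<delta> by (intro mult_left_mono) auto
      finally show "norm (complex_of_real (f t * ln t) * exp ((z - 1) * of_real (ln t))) \<le> norm (1 / \<delta> * B t)"
        using B0[of t] \<delta> by simp
    qed
  qed (simp add: set_borel_measurable_def)
  define M' where "M' = (LINT t:{0<..}|lborel. of_real (f t * ln t) * exp ((z - 1) * of_real (ln t)))"
  \<comment> \<open>The factor 2 / \<delta>^2 comes from
    \<open>(\<delta> * l)^2 / 2 \<le> exp (\<delta> * l)\<close>, which trades the squared logarithm
    for an exponential.\<close>
  define C where "C = 2 / \<delta>^2 * (LINT t:{0<..}|lborel. B t)"
  have main: "norm (mellin f (z + h) - mellin f z - M' * h) \<le> C * (norm h)^2" if h: "norm h \<le> \<delta>" for h
  proof -
    define g where "g t = of_real (f t) * exp ((z - 1) * of_real (ln t)) *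
         (exp (h * of_real (ln t)) - 1 - h * of_real (ln t))" for t
    have gb: "norm (g t) \<le> 2 / \<delta>^2 * (norm h)^2 * B t" if t: "t > 0" for t
    proof -
      define l where "l = \<bar>ln t\<bar>"
      have "norm (exp (h * of_real (ln t)) - 1 - h * of_real (ln t))
        \<le> (norm (h * of_real (ln t)))^2 * exp (norm (h * of_real (ln t)))"
        by (rule norm_exp_minus_affine_le)
      also have "\<dots> = (norm h)^2 * (l^2 * exp (norm h * l))"
        by (simp add: norm_mult power_mult_distrib l_def)
      also have "\<dots> \<le> (norm h)^2 * (l^2 * exp (\<delta> * l))"
        using h by (intro mult_left_mono) (auto simp: l_def mult_right_mono)
      also have "l^2 \<le> 2 / \<delta>^2 * exp (\<delta> * l)"
      proof -
        have "1 + \<delta> * l + (\<delta> * l)^2 / 2 \<le> exp (\<delta> * l)"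
          using \<delta> by (intro exp_lower_Taylor_quadratic) (simp add: l_def)
        moreover have "\<delta> * l \<ge> 0" using \<delta> by (simp add: l_def)
        ultimately have "(\<delta> * l)^2 / 2 \<le> exp (\<delta> * l)" by linarith
        then show ?thesis using \<delta> by (simp add: field_simps power_mult_distrib)
      qed
      then have "(norm h)^2 * (l^2 * exp (\<delta> * l)) \<le> (norm h)^2 * (2 / \<delta>^2 * exp (\<delta> * l) * exp (\<delta> * l))"
        by (intro mult_left_mono mult_right_mono) auto
      also have "\<dots> = 2 / \<delta>^2 * (norm h)^2 * exp (2 * \<delta> * l)"
        by (simp add: exp_add[symmetric] mult_ac)
      finally have "norm (exp (h * of_real (ln t)) - 1 - h * of_real (ln t)) \<le> 2 / \<delta>^2 * (norm h)^2 * exp (2 * \<delta> * l)" .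
      then have "norm (g t) \<le> \<bar>f t\<bar> * t powr (\<sigma> - 1) * (2 / \<delta>^2 * (norm h)^2 * exp (2 * \<delta> * l))"
        unfolding g_def norm_mult using t by (intro mult_mono) (auto simp: exp_of_real_ln \<sigma>_def)
      also have "\<dots> = 2 / \<delta>^2 * (norm h)^2 * (\<bar>f t\<bar> * t powr (\<sigma> - 1) * exp (2 * \<delta> * l))"
        by (simp add: mult_ac)
      also have "\<dots> \<le> 2 / \<delta>^2 * (norm h)^2 * B t"
        using dom[OF t] by (intro mult_left_mono) (auto simp: l_def)
      finally show ?thesis .
    qed
    have ig: "set_integrable lborel {0<..} g"
    proof (rule set_integrable_bound)
      show "set_integrable lborel {0<..} (\<lambda>t. 2 / \<delta>^2 * (norm h)^2 * B t)"
        using iB by (rule set_integrable_mult_right)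
      show "AE t in lborel. t \<in> {0<..} \<longrightarrow> norm (g t) \<le> norm (2 / \<delta>^2 * (norm h)^2 * B t)"
        using gb B0 by (intro AE_I2) auto
      show "set_borel_measurable lborel {0<..} g"
        unfolding g_def set_borel_measurable_def by measurable
    qed
    have eq: "of_real (f t) * exp ((z + h - 1) * of_real (ln t)) = g t + of_real (f t) * exp ((z - 1) * of_real (ln t))
       + of_real (f t * ln t) * exp ((z - 1) * of_real (ln t)) * h" for t
    proof -
      have "exp ((z + h - 1) * of_real (ln t)) = exp ((z - 1) * of_real (ln t)) * exp (h * of_real (ln t))"
        by (simp add: exp_add[symmetric] algebra_simps)
      then show ?thesis unfolding g_def by (simp add: algebra_simps)
    qed
    have "mellin f (z + h) = (LINT t:{0<..}|lborel. g t) + mellin f z + M' * h"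
      unfolding mellin_def eq M'_def
      using ig i0 i1 by (simp add: set_integral_add)
    then have "norm (mellin f (z + h) - mellin f z - M' * h) = norm (LINT t:{0<..}|lborel. g t)"
      by simp
    also have "\<dots> \<le> (LINT t:{0<..}|lborel. norm (g t))"
      using ig by (rule set_integral_norm_bound)
    also have "\<dots> \<le> (LINT t:{0<..}|lborel. 2 / \<delta>^2 * (norm h)^2 * B t)"
      using ig iB gb by (intro set_integral_mono set_integrable_norm) auto
    also have "\<dots> = C * (norm h)^2" by (simp add: C_def)
    finally show ?thesis .
  qed
  have "((\<lambda>h. norm ((mellin f (z + h) - mellin f z) / h - M')) \<longlongrightarrow> 0) (at 0)"
  proof (rule Lim_null_comparison)
    show "\<forall>\<^sub>F h in at 0. norm (norm ((mellin f (z + h) - mellin f z) / h - M')) \<le> C * norm h"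
      unfolding eventually_at
    proof (intro exI[of _ \<delta>] conjI ballI impI)
      fix h :: complex assume "h \<noteq> 0 \<and> dist h 0 < \<delta>"
      then have h: "h \<noteq> 0" "norm h \<le> \<delta>" by auto
      have "norm ((mellin f (z + h) - mellin f z) / h - M') = norm (mellin f (z + h) - mellin f z - M' * h) / norm h"
        using h by (simp add: field_simps flip: norm_divide)
      also have "\<dots> \<le> C * (norm h)^2 / norm h"
        using main[OF h(2)] by (intro divide_right_mono) auto
      also have "\<dots> = C * norm h" using h by (simp add: power2_eq_square)
      finally show "norm (norm ((mellin f (z + h) - mellin f z) / h - M')) \<le> C * norm h" by simp
    qed (fact \<delta>)
    show "((\<lambda>h. C * norm h) \<longlongrightarrow> 0) (at 0)"
      by (auto intro!: tendsto_eq_intros)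
  qed
  then have "((\<lambda>h. (mellin f (z + h) - mellin f z) / h - M') \<longlongrightarrow> 0) (at 0)"
    by (rule tendsto_norm_zero_cancel)
  then show "(mellin f has_field_derivative
           (LINT t:{0<..}|lborel. of_real (f t * ln t) * exp ((z - 1) * of_real (ln t)))) (at z)"
    unfolding DERIV_def M'_def[symmetric] using LIM_zero_iff by fastforce
qed

lemma Re_pos_notin_nonpos_Ints: "Re z > 0 \<Longrightarrow> z \<notin> \<int>\<^sub>\<le>\<^sub>0"
  by (auto elim!: nonpos_Ints_cases)

text \<open>The product rule produces ln t from the power of t and - \<psi>(z) from
  \<open>rGamma\<close>, and together they form the logarithmic density. The derivative is taken
  with respect to z = s / 2.\<close>

lemma mellin_has_log_riesz_derivative:
  fixes s :: real
  assumes conv: "mellin_converges f a" "mellin_converges f b" and s: "a < s / 2" "s / 2 < b" "s > 0"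
  shows "set_integrable lborel {0<..} (\<lambda>t. f t * log_riesz_density s t)"
    and "((\<lambda>z. mellin f z * rGamma z) has_field_derivative
            of_real (LINT t:{0<..}|lborel. f t * log_riesz_density s t)) (at (of_real (s / 2)))"
proof -
  define z :: complex where "z = of_real (s / 2)"
  have z: "a < Re z" "Re z < b" using s by (auto simp: z_def)
  note D = mellin_has_field_derivative[OF conv z]
  have nonpos: "z \<notin> \<int>\<^sub>\<le>\<^sub>0"
    using s by (intro Re_pos_notin_nonpos_Ints) (simp add: z_def)
  have Dig: "Digamma z = of_real (Digamma (s / 2))"
    unfolding z_def using s by (intro Polygamma_of_real) auto
  have rG: "rGamma z = of_real (1 / Gamma (s / 2))"
    using Gamma_complex_of_real[of "s / 2"] by (simp add: z_def rGamma_inverse_Gamma inverse_eq_divide)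
  have eq: "complex_of_real (f t * log_riesz_density s t) =
      rGamma z * (of_real (f t * ln t) * exp ((z - 1) * of_real (ln t)))
      - rGamma z * Digamma z * (of_real (f t) * exp ((z - 1) * of_real (ln t)))" if "t > 0" for t
    unfolding log_riesz_density_def Dig rG
    using exp_of_real_ln(2)[OF that, of "s / 2"] by (simp add: z_def algebra_simps diff_divide_distrib)
  define L where "L = (LINT t:{0<..}|lborel. of_real (f t * ln t) * exp ((z - 1) * of_real (ln t)))"
  have ic: "set_integrable lborel {0<..} (\<lambda>t. complex_of_real (f t * log_riesz_density s t))"
  proof -
    have "set_integrable lborel {0<..} (\<lambda>t. complex_of_real (f t * log_riesz_density s t)) \<longleftrightarrow>
      set_integrable lborel {0<..} (\<lambda>t. rGamma z * (of_real (f t * ln t) * exp ((z - 1) * of_real (ln t)))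
      - rGamma z * Digamma z * (of_real (f t) * exp ((z - 1) * of_real (ln t))))"
      by (rule set_integrable_cong) (auto simp: eq simp del: of_real_mult)
    also have \<dots> using D(1,2) by (intro set_integral_diff(1) set_integrable_mult_right)
    finally show ?thesis .
  qed
  then show "set_integrable lborel {0<..} (\<lambda>t. f t * log_riesz_density s t)"
    using integrable_Re[of lborel "\<lambda>t. indicator {0<..} t *\<^sub>R complex_of_real (f t * log_riesz_density s t)"]
    by (simp add: set_integrable_def)
  have "of_real (LINT t:{0<..}|lborel. f t * log_riesz_density s t)
      = (LINT t:{0<..}|lborel. complex_of_real (f t * log_riesz_density s t))"
    by (rule set_integral_complex_of_real[symmetric])
  also have "\<dots> = (LINT t:{0<..}|lborel. rGamma z * (of_real (f t * ln t) * exp ((z - 1) * of_real (ln t)))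
      - rGamma z * Digamma z * (of_real (f t) * exp ((z - 1) * of_real (ln t))))"
    by (rule set_lebesgue_integral_cong) (auto simp: eq simp del: of_real_mult)
  also have "\<dots> = rGamma z * L - rGamma z * Digamma z * mellin f z"
    unfolding mellin_def L_def using D(1,2)
    by (simp only: set_integral_diff(2) set_integrable_mult_right set_integral_mult_right)
  finally have val: "of_real (LINT t:{0<..}|lborel. f t * log_riesz_density s t) = rGamma z * L - rGamma z * Digamma z * mellin f z" .
  have "((\<lambda>z. mellin f z * rGamma z) has_field_derivative L * rGamma z + (- rGamma z * Digamma z) * mellin f z) (at z)"
    unfolding L_def by (rule DERIV_mult[OF D(3) has_field_derivative_rGamma_no_nonpos_int[OF nonpos]])
  then show "((\<lambda>z. mellin f z * rGamma z) has_field_derivative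
            of_real (LINT t:{0<..}|lborel. f t * log_riesz_density s t)) (at (of_real (s / 2)))"
    unfolding val z_def[symmetric] by (simp add: algebra_simps)
qed

section \<open>Mellin transforms of exponentials, truncated powers and rapidly decaying
  functions\<close>

lemma set_integrable_lborel_of_nonneg:
  fixes f :: "real \<Rightarrow> real"
  assumes [measurable]: "f \<in> borel_measurable borel" "A \<in> sets borel"
    and f: "f integrable_on A" "\<And>x. x \<in> A \<Longrightarrow> f x \<ge> 0"
  shows "set_integrable lborel A f"
proof -
  have "set_integrable lebesgue A f"
    using nonnegative_absolutely_integrable_1[OF f] .
  then show ?thesis
    unfolding set_integrable_def by (subst (asm) integrable_completion) auto
qed

lemma mellin_scale:
  fixes f :: "real \<Rightarrow> real"
  assumes c: "c > 0"
  shows "mellin (\<lambda>t. f (c * t)) z = exp (- z * of_real (ln c)) * mellin f z"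
    and "mellin_converges f a \<Longrightarrow> mellin_converges (\<lambda>t. f (c * t)) a"
proof -
  define F where "F u = indicator {0<..} u *\<^sub>R (complex_of_real (f u) * exp ((z - 1) * of_real (ln u)))" for u
  have 1: "F (0 + c * t) = exp ((z - 1) * of_real (ln c)) *
      (indicator {0<..} t *\<^sub>R (complex_of_real (f (c * t)) * exp ((z - 1) * of_real (ln t))))" for t
    using c by (auto simp: F_def indicator_def zero_less_mult_iff ln_mult exp_add[symmetric] algebra_simps)
  have "mellin f z = c *\<^sub>R (LINT t|lborel. F (0 + c * t))"
    using lborel_integral_real_affine[of c F 0] c by (simp add: mellin_def set_lebesgue_integral_def F_def)
  also have "\<dots> = of_real c * exp ((z - 1) * of_real (ln c)) * mellin (\<lambda>t. f (c * t)) z"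
    unfolding 1 by (simp add: mellin_def set_lebesgue_integral_def scaleR_conv_of_real)
  also have "of_real c * exp ((z - 1) * of_real (ln c)) = exp (z * of_real (ln c))"
  proof -
    have "complex_of_real c = exp (of_real (ln c))" using c by (simp add: exp_of_real)
    then show ?thesis by (simp only: exp_add[symmetric]) (simp add: algebra_simps)
  qed
  finally show "mellin (\<lambda>t. f (c * t)) z = exp (- z * of_real (ln c)) * mellin f z"
    by (simp add: exp_minus field_simps)
next
  assume "mellin_converges f a"
  then have [measurable]: "f \<in> borel_measurable borel"
    and i: "integrable lborel (\<lambda>t. indicator {0<..} t *\<^sub>R (f t * t powr (a - 1)))"
    by (auto simp: mellin_converges_def set_integrable_def)
  have "integrable lborel (\<lambda>t. indicator {0<..} (0 + c * t) *\<^sub>R (f (0 + c * t) * (0 + c * t) powr (a - 1)))"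
    using lborel_integrable_real_affine[OF i, of c 0] c by simp
  also have "(\<lambda>t. indicator {0<..} (0 + c * t) *\<^sub>R (f (0 + c * t) * (0 + c * t) powr (a - 1)))
    = (\<lambda>t. c powr (a - 1) * (indicator {0<..} t *\<^sub>R (f (c * t) * t powr (a - 1))))"
    using c by (auto simp: fun_eq_iff indicator_def zero_less_mult_iff powr_mult)
  finally show "mellin_converges (\<lambda>t. f (c * t)) a"
    using c by (simp add: mellin_converges_def set_integrable_def)
qed

lemma mellin_exp:
  shows "a > 0 \<Longrightarrow> mellin_converges (\<lambda>t. exp (- t)) a"
    and "Re z > 0 \<Longrightarrow> mellin (\<lambda>t. exp (- t)) z = Gamma z"
proof -
  show conv: "mellin_converges (\<lambda>t. exp (- t)) a" if a: "a > 0" for a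
    unfolding mellin_converges_def
  proof (intro conjI set_integrable_lborel_of_nonneg)
    have "(\<lambda>t. t powr (a - 1) / exp t) integrable_on {0..}"
      using Gamma_integral_real[OF a] by blast
    then have "(\<lambda>t. t powr (a - 1) / exp t) integrable_on {0<..}"
      by (rule integrable_spike_set) (auto intro: negligible_subset[of "{0}"])
    then show "(\<lambda>t. exp (- t) * t powr (a - 1)) integrable_on {0<..}"
      by (simp add: exp_minus field_simps)
  qed auto
  assume z: "Re z > 0"
  have "((\<lambda>t. of_real (exp (- t)) * exp ((z - 1) * of_real (ln t))) has_integral Gamma z) {0<..}"
  proof (rule has_integral_eq[OF _ Gamma_integral_complex'[OF z]])
    fix t :: real assume "t \<in> {0<..}"
    then show "of_real t powr (z - 1) / of_real (exp t) = of_real (exp (- t)) * exp ((z - 1) * of_real (ln t))"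
      by (simp add: powr_def Ln_of_real exp_minus field_simps)
  qed
  then show "mellin (\<lambda>t. exp (- t)) z = Gamma z"
    unfolding mellin_def
    by (subst set_borel_integral_eq_integral(2)[OF mellin_convergesD[OF conv[OF z]]]) (simp add: integral_unique)
qed

lemma mellin_exp_scaled:
  assumes c: "c > 0"
  shows "a > 0 \<Longrightarrow> mellin_converges (\<lambda>t. exp (- (c * t))) a"
    and "Re z > 0 \<Longrightarrow> mellin (\<lambda>t. exp (- (c * t))) z = exp (- z * of_real (ln c)) * Gamma z"
  using mellin_scale[OF c, of "\<lambda>t. exp (- t)"] mellin_exp by simp_all

text \<open>For q > 0 this is the potential q^(-s) log (q^(-2)).\<close>

definition log_riesz_potential :: "real \<Rightarrow> real \<Rightarrow> real" where
  "log_riesz_potential s q = - 2 * q powr (- s) * ln q"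

text \<open>The Mellin transform of the Gaussian in t is q^(-2z) \<Gamma>(z). Dividing by
  \<Gamma>(z) leaves q^(-2z), whose derivative at z = s / 2 is the potential.\<close>

lemma log_riesz_density_gaussian:
  assumes s: "s > 0" and q: "q > 0"
  shows "set_integrable lborel {0<..} (\<lambda>t. gaussian t q * log_riesz_density s t)"
    and "(LINT t:{0<..}|lborel. gaussian t q * log_riesz_density s t) = log_riesz_potential s q"
proof -
  have q2: "q^2 > 0" using q by simp
  have conv: "mellin_converges (\<lambda>t. gaussian t q) a" if "a > 0" for a
    unfolding gaussian_def by (rule mellin_exp_scaled(1)[OF q2 that])
  have ab: "s / 4 < s / 2" "s / 2 < s" "s / 4 > 0" using s by auto
  note D = mellin_has_log_riesz_derivative[OF conv[OF ab(3)] conv[OF s] ab(1,2) s]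
  show "set_integrable lborel {0<..} (\<lambda>t. gaussian t q * log_riesz_density s t)"
    by (rule D(1))
  have "((\<lambda>z::complex. exp (- z * of_real (ln (q^2)))) has_field_derivative
          of_real (LINT t:{0<..}|lborel. gaussian t q * log_riesz_density s t)) (at (of_real (s / 2)))"
  proof (rule has_field_derivative_transform_within_open[OF D(2)])
    show "open {z. Re z > 0}" by (rule open_halfspace_Re_gt)
    show "mellin (\<lambda>t. gaussian t q) z * rGamma z = exp (- z * of_real (ln (q^2)))" if "z \<in> {z. Re z > 0}" for z
    proof -
      have "Gamma z \<noteq> 0" using that by (simp add: Gamma_eq_zero_iff Re_pos_notin_nonpos_Ints)
      then show ?thesis
        unfolding gaussian_def using mellin_exp_scaled(2)[OF q2, of z] that
        by (simp add: rGamma_inverse_Gamma)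
    qed
  qed (use s in auto)
  moreover have "((\<lambda>z::complex. exp (- z * of_real (ln (q^2)))) has_field_derivative
          of_real (log_riesz_potential s q)) (at (complex_of_real (s / 2)))"
  proof -
    have l: "ln (q^2) = 2 * ln q" using q by (simp add: ln_realpow)
    have "((\<lambda>z::complex. exp (- z * of_real (ln (q^2)))) has_field_derivative
       exp (- of_real (s / 2) * of_real (ln (q^2))) * (- of_real (ln (q^2)))) (at (complex_of_real (s / 2)))"
      by (auto intro!: derivative_eq_intros)
    also have "exp (- of_real (s / 2) * of_real (ln (q^2))) = complex_of_real (q powr (- s))"
      using q l by (simp add: powr_def exp_of_real[symmetric])
    finally show ?thesis
      by (simp add: l log_riesz_potential_def mult_ac)
  qed
  ultimately have "complex_of_real (LINT t:{0<..}|lborel. gaussian t q * log_riesz_density s t)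
      = of_real (log_riesz_potential s q)"
    by (rule DERIV_unique)
  then show "(LINT t:{0<..}|lborel. gaussian t q * log_riesz_density s t) = log_riesz_potential s q"
    unfolding of_real_eq_iff .
qed

definition powr_below :: "real \<Rightarrow> real \<Rightarrow> real" where
  "powr_below p t = (if t < 1 then t powr p else 0)"

text \<open>The truncation of \<open>reg_theta\<close> sits at t = 1, and that of its rescaling by 1
  / N^2 at t = N^2. The mismatch between the two lives on the half-open interval [1, c) with c =
  N^2.\<close>

definition powr_between :: "real \<Rightarrow> real \<Rightarrow> real \<Rightarrow> real" where
  "powr_between c p t = (if 1 \<le> t \<and> t < c then t powr p else 0)"

lemma powr_below_measurable [measurable]: "powr_below p \<in> borel_measurable borel"
  unfolding powr_below_def by measurable

lemma powr_between_measurable [measurable]: "powr_between c p \<in> borel_measurable borel"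
  unfolding powr_between_def by measurable

lemma mellin_converges_powr_below:
  assumes "a + p > 0"
  shows "mellin_converges (powr_below p) a"
proof -
  have "(\<lambda>t. t powr (a + p - 1)) integrable_on {0..1}"
    using has_integral_powr_from_0[of "a + p - 1" 1] assms by auto
  then have "set_integrable lborel {0..1} (\<lambda>t. t powr (a + p - 1))"
    by (intro set_integrable_lborel_of_nonneg) auto
  then have "set_integrable lborel {0<..} (\<lambda>t. indicator {0..1} t * t powr (a + p - 1))"
    unfolding set_integrable_def by (intro integrable_mult_indicator) simp_all
  then have "set_integrable lborel {0<..} (\<lambda>t. powr_below p t * t powr (a - 1))"
    by (rule set_integrable_bound)
       (auto simp: set_borel_measurable_def powr_below_def powr_add[symmetric] algebra_simps intro!: AE_I2)
  then show ?thesis by (simp add: mellin_converges_def)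
qed

lemma mellin_converges_powr_between:
  assumes "c > 1"
  shows "mellin_converges (powr_between c p) a"
proof -
  have "set_integrable lborel {1..c} (\<lambda>t. t powr (a + p - 1))"
    by (rule borel_integrable_atLeastAtMost') (auto intro!: continuous_intros)
  then have "set_integrable lborel {0<..} (\<lambda>t. indicator {1..c} t * t powr (a + p - 1))"
    unfolding set_integrable_def by (intro integrable_mult_indicator) simp_all
  then have "set_integrable lborel {0<..} (\<lambda>t. powr_between c p t * t powr (a - 1))"
    by (rule set_integrable_bound)
       (auto simp: set_borel_measurable_def powr_between_def powr_add[symmetric] algebra_simps intro!: AE_I2)
  then show ?thesis by (simp add: mellin_converges_def)
qed

lemma has_vector_derivative_exp_ln:
  fixes w :: complex
  assumes "x > 0" "w \<noteq> 0"
  shows "((\<lambda>t. exp (w * of_real (ln t)) / w) has_vector_derivative exp ((w - 1) * of_real (ln x))) (at x)"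
proof -
  have "((\<lambda>t. of_real (ln t)) has_vector_derivative complex_of_real (1 / x)) (at x)"
    using assms by (intro has_vector_derivative_of_real DERIV_ln_divide)
  then have "((\<lambda>t. exp (w * of_real (ln t)) / w) has_vector_derivative
     complex_of_real (1 / x) * exp (w * of_real (ln x))) (at x)"
    by (rule field_vector_diff_chain_at[unfolded o_def, where g = "\<lambda>u. exp (w * u) / w"])
       (use assms in \<open>auto intro!: derivative_eq_intros\<close>)
  also have "complex_of_real (1 / x) = exp (- of_real (ln x))"
    using assms by (simp add: exp_minus exp_of_real field_simps)
  also have "exp (- complex_of_real (ln x)) * exp (w * of_real (ln x)) = exp ((w - 1) * of_real (ln x))"
    by (simp add: exp_add[symmetric] algebra_simps)
  finally show ?thesis .
qed

lemma isCont_exp_ln: "x > 0 \<Longrightarrow> isCont (\<lambda>t. exp (w * complex_of_real (ln t))) x"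
  by (intro continuous_intros) auto

lemma mellin_powr_below:
  assumes z: "Re z + p > 0"
  shows "mellin (powr_below p) z = 1 / (z + of_real p)"
proof -
  define w where "w = z + of_real p"
  have w0: "Re w > 0" using z by (simp add: w_def)
  then have w: "Re w > 0" "w \<noteq> 0" by auto
  have eq: "indicator {0<..} t *\<^sub>R (complex_of_real (powr_below p t) * exp ((z - 1) * of_real (ln t)))
     = indicator {0<..<1} t *\<^sub>R exp ((w - 1) * of_real (ln t))" for t
  proof (cases "0 < t \<and> t < 1")
    case True
    then have "complex_of_real (t powr p) = exp (of_real p * of_real (ln t))"
      by (simp add: powr_def exp_of_real[symmetric])
    then show ?thesis using True by (simp add: powr_below_def w_def exp_add[symmetric] algebra_simps)
  qed (auto simp: powr_below_def)
  have int: "set_integrable lborel {0<..<1} (\<lambda>t. exp ((w - 1) * of_real (ln t)))"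
    using mellin_convergesD[of "powr_below p" z] mellin_converges_powr_below[OF z]
    unfolding set_integrable_def eq by blast
  have "(LBINT t=ereal 0..ereal 1. exp ((w - 1) * of_real (ln t))) = exp (w * of_real (ln 1)) / w - 0"
  proof (rule interval_integral_FTC_integrable)
    show "((\<lambda>t. exp (w * of_real (ln t)) / w) has_vector_derivative exp ((w - 1) * of_real (ln x))) (at x)"
      if "ereal 0 < ereal x" for x
      using has_vector_derivative_exp_ln[of x w] w that by simp
    show "isCont (\<lambda>t. exp ((w - 1) * complex_of_real (ln t))) x" if "ereal 0 < ereal x" for x
      using that by (intro isCont_exp_ln) auto
    have "((\<lambda>t::real. exp (w * of_real (ln t)) / w) \<longlongrightarrow> 0) (at_right 0)"
    proof (rule tendsto_norm_zero_cancel)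
      have "((\<lambda>t. t powr Re w / norm w) \<longlongrightarrow> 0 / norm w) (at_right 0)"
        using w by (intro tendsto_intros tendsto_eq_rhs[OF tendsto_powr']) (auto intro!: eventually_at_rightI[of 0 1] tendsto_ident_at)
      moreover have "\<forall>\<^sub>F t::real in at_right 0. t powr Re w / norm w = norm (exp (w * of_real (ln t)) / w)"
        by (rule eventually_at_rightI[of 0 1]) (auto simp: norm_divide powr_def)
      ultimately show "((\<lambda>t::real. norm (exp (w * of_real (ln t)) / w)) \<longlongrightarrow> 0) (at_right 0)"
        using Lim_transform_eventually by fastforce
    qed
    then show "(((\<lambda>t. exp (w * of_real (ln t)) / w) \<circ> real_of_ereal) \<longlongrightarrow> 0) (at_right (ereal 0))"
      by (simp add: ereal_tendsto_simps1)
    have "isCont (\<lambda>t. exp (w * of_real (ln t)) / w) 1"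
      using w by (intro continuous_intros) auto
    then show "(((\<lambda>t. exp (w * of_real (ln t)) / w) \<circ> real_of_ereal) \<longlongrightarrow> exp (w * of_real (ln 1)) / w) (at_left (ereal 1))"
      unfolding ereal_tendsto_simps1 isCont_def by (rule tendsto_within_subset) auto
  qed (use int in simp_all)
  then have "(LINT t:{0<..<1}|lborel. exp ((w - 1) * of_real (ln t))) = 1 / w"
    by (simp add: interval_lebesgue_integral_le_eq)
  then show ?thesis
    unfolding mellin_def set_lebesgue_integral_def eq by (simp add: w_def)
qed

lemma mellin_powr_between:
  assumes c: "c > 1" and z: "z + of_real p \<noteq> 0"
  shows "mellin (powr_between c p) z = (exp ((z + of_real p) * of_real (ln c)) - 1) / (z + of_real p)"
proof -
  define w where "w = z + of_real p"
  have w: "w \<noteq> 0" using z by (auto simp: w_def)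
  have eq: "indicator {0<..} t *\<^sub>R (complex_of_real (powr_between c p t) * exp ((z - 1) * of_real (ln t)))
     = indicator {1..<c} t *\<^sub>R exp ((w - 1) * of_real (ln t))" for t
  proof (cases "1 \<le> t \<and> t < c")
    case True
    then have "complex_of_real (t powr p) = exp (of_real p * of_real (ln t))"
      by (simp add: powr_def exp_of_real[symmetric])
    then show ?thesis using True by (simp add: powr_between_def w_def exp_add[symmetric] algebra_simps)
  qed (auto simp: powr_between_def)
  have "(LBINT t=ereal 1..ereal c. exp ((w - 1) * of_real (ln t))) = exp (w * of_real (ln c)) / w - exp (w * of_real (ln 1)) / w"
  proof (rule interval_integral_FTC_finite)
    show "continuous_on {min 1 c..max 1 c} (\<lambda>t. exp ((w - 1) * complex_of_real (ln t)))"
      using c by (intro continuous_intros) auto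
    show "((\<lambda>t. exp (w * of_real (ln t)) / w) has_vector_derivative exp ((w - 1) * of_real (ln x))) (at x within {min 1 c..max 1 c})"
      if "min 1 c \<le> x" for x
    proof (rule has_vector_derivative_at_within[OF has_vector_derivative_exp_ln[OF _ w]])
      show "x > 0" using that c by simp
    qed
  qed
  then have "(LINT t:{1<..<c}|lborel. exp ((w - 1) * of_real (ln t))) = (exp (w * of_real (ln c)) - 1) / w"
    using c by (simp add: interval_lebesgue_integral_le_eq diff_divide_distrib)
  also have "(LINT t:{1<..<c}|lborel. exp ((w - 1) * of_real (ln t))) = (LINT t:{1..<c}|lborel. exp ((w - 1) * of_real (ln t)))"
    unfolding set_lebesgue_integral_def
  proof (intro integral_cong_AE)
    show "AE t in lborel. indicator {1<..<c} t *\<^sub>R exp ((w - 1) * complex_of_real (ln t))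
        = indicator {1..<c} t *\<^sub>R exp ((w - 1) * complex_of_real (ln t))"
      using AE_lborel_singleton[of 1] by eventually_elim (auto simp: indicator_def)
  qed measurable
  finally show ?thesis
    unfolding mellin_def set_lebesgue_integral_def eq by (simp add: w_def)
qed

lemma mellin_cong:
  assumes "\<And>t. t > 0 \<Longrightarrow> f t = g t"
  shows "mellin f z = mellin g z"
  unfolding mellin_def by (rule set_lebesgue_integral_cong) (use assms in auto)

lemma mellin_lincomb:
  assumes "mellin_converges f (Re z)" "mellin_converges g (Re z)"
  shows "mellin (\<lambda>t. c * f t + d * g t) z = of_real c * mellin f z + of_real d * mellin g z"
proof -
  have "mellin (\<lambda>t. c * f t + d * g t) z
    = (LINT t:{0<..}|lborel. of_real c * (of_real (f t) * exp ((z - 1) * of_real (ln t)))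
       + of_real d * (of_real (g t) * exp ((z - 1) * of_real (ln t))))"
    unfolding mellin_def by (simp add: algebra_simps)
  also have "\<dots> = of_real c * mellin f z + of_real d * mellin g z"
    unfolding mellin_def using assms[THEN mellin_convergesD]
    by (simp only: set_integral_add(2) set_integrable_mult_right set_integral_mult_right)
  finally show ?thesis .
qed

lemma mellin_converges_lincomb:
  assumes "mellin_converges f a" "mellin_converges g a"
  shows "mellin_converges (\<lambda>t. c * f t + d * g t) a"
proof -
  have "set_integrable lborel {0<..} (\<lambda>t. c * (f t * t powr (a - 1)) + d * (g t * t powr (a - 1)))"
    using assms by (intro set_integral_add(1) set_integrable_mult_right) (auto simp: mellin_converges_def)
  moreover have [measurable]: "f \<in> borel_measurable borel" "g \<in> borel_measurable borel"
    using assms by (auto simp: mellin_converges_def)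
  moreover have "(\<lambda>t. c * f t + d * g t) \<in> borel_measurable borel" by measurable
  ultimately show ?thesis by (simp add: mellin_converges_def algebra_simps)
qed

lemma power_le_fact_mult_exp:
  fixes y :: real
  assumes "y \<ge> 0"
  shows "y ^ k \<le> fact k * exp y"
proof -
  have "(\<Sum>n\<in>{k}. y ^ n /\<^sub>R fact n) \<le> exp y"
    unfolding exp_def using summable_exp_generic[of y] assms
    by (intro sum_le_suminf) auto
  then show ?thesis by (simp add: field_simps)
qed

text \<open>Exponential decay controls infinity, and exp (- 1 / t) beats every power of 1 / t near
  0, so a is arbitrary. This is what makes the transforms of the truncated theta functions
  entire.\<close>

lemma mellin_converges_of_decay:
  fixes f :: "real \<Rightarrow> real"
  assumes [measurable]: "f \<in> borel_measurable borel" and c: "c > 0"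
    and large: "\<And>t. t \<ge> 1 \<Longrightarrow> \<bar>f t\<bar> \<le> C * exp (- (c * t))"
    and small: "\<And>t. 0 < t \<Longrightarrow> t < 1 \<Longrightarrow> \<bar>f t\<bar> \<le> C * t powr (- 1 / 2) * exp (- (1 / t))"
  shows "mellin_converges f a"
proof -
  have C: "C \<ge> 0"
  proof -
    have "0 \<le> C * exp (- c)" using large[of 1] by simp
    then show ?thesis by (simp add: zero_le_mult_iff)
  qed
  \<comment> \<open>Near 0 the integrand is at most C (1 / t)^(3/2 - a) exp (- 1 / t). A natural
    number k above that exponent bounds this by C k!, using y^k \<le> k! exp y.\<close>
  define k where "k = nat \<lceil>\<bar>a\<bar> + 2\<rceil>"
  have k: "3 / 2 - a \<le> real k" unfolding k_def by linarith
  \<comment> \<open>Raising the exponent is harmless for t \<ge> 1, and b > 0 makes the Gamma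
    integral used as majorant converge at 0.\<close>
  define b where "b = max a 1"
  have b: "b > 0" "a \<le> b" by (auto simp: b_def)
  have i1: "set_integrable lborel {0<..} (\<lambda>t. C * (exp (- (c * t)) * t powr (b - 1)))"
    using mellin_exp_scaled(1)[OF c b(1)] by (simp add: mellin_converges_def)
  have i2: "set_integrable lborel {0<..} (\<lambda>t. C * fact k * (powr_below 0 t * t powr (1 - 1)))"
    using mellin_converges_powr_below[of 1 0] unfolding mellin_converges_def by (intro set_integrable_mult_right) simp
  have "set_integrable lborel {0<..} (\<lambda>t. f t * t powr (a - 1))"
  proof (rule set_integrable_bound[OF set_integral_add(1)[OF i1 i2]])
    show "AE t in lborel. t \<in> {0<..} \<longrightarrow> norm (f t * t powr (a - 1))
       \<le> norm (C * (exp (- (c * t)) * t powr (b - 1)) + C * fact k * (powr_below 0 t * t powr (1 - 1)))"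
    proof (intro AE_I2 impI)
      fix t :: real assume "t \<in> {0<..}"
      then have t: "t > 0" by simp
      have nn: "C * (exp (- (c * t)) * t powr (b - 1)) \<ge> 0" "C * fact k * (powr_below 0 t * t powr (1 - 1)) \<ge> 0"
        using C by (auto simp: powr_below_def)
      have "\<bar>f t\<bar> * t powr (a - 1) \<le> C * (exp (- (c * t)) * t powr (b - 1)) + C * fact k * (powr_below 0 t * t powr (1 - 1))"
      proof (cases "t \<ge> 1")
        case True
        have "\<bar>f t\<bar> * t powr (a - 1) \<le> C * exp (- (c * t)) * t powr (b - 1)"
          using large[OF True] True b by (intro mult_mono powr_mono) auto
        then show ?thesis using nn(2) by (simp add: mult.assoc)
      next
        case False
        have "\<bar>f t\<bar> * t powr (a - 1) \<le> C * t powr (- 1 / 2) * exp (- (1 / t)) * t powr (a - 1)"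
          using small[OF t] False by (intro mult_right_mono) auto
        also have "\<dots> = C * (t powr (a - 3 / 2) * exp (- (1 / t)))"
          using powr_add[of t "- 1 / 2" "a - 1"] by simp
        also have "t powr (a - 3 / 2) = (1 / t) powr (3 / 2 - a)"
          using t by (simp add: powr_divide powr_minus_divide[symmetric])
        also have "\<dots> \<le> (1 / t) powr real k"
          using t False k by (intro powr_mono) auto
        also have "\<dots> \<le> fact k * exp (1 / t)"
          using t power_le_fact_mult_exp[of "1 / t" k] by (simp add: powr_realpow)
        finally have "\<bar>f t\<bar> * t powr (a - 1) \<le> C * fact k"
          using C by (simp add: mult_right_mono mult_left_mono exp_minus field_simps)
        then show ?thesis using nn(1) False t by (simp add: powr_below_def)
      qed
      then show "norm (f t * t powr (a - 1))
       \<le> norm (C * (exp (- (c * t)) * t powr (b - 1)) + C * fact k * (powr_below 0 t * t powr (1 - 1)))"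
        using nn by (simp add: abs_mult)
    qed
  qed (simp add: set_borel_measurable_def)
  then show ?thesis by (simp add: mellin_converges_def)
qed

subsection \<open>The theta function\<close>

definition theta :: "real \<Rightarrow> real \<Rightarrow> real" where
  "theta x t = (\<Sum>n. paired_term (gaussian t) x n)"

text \<open>The parameter \<open>e\<close> removes the term that does not decay as \<open>t\<close> grows: it is 1 if \<open>x\<close> is an
  integer and 0 otherwise.\<close>
definition reg_theta :: "real \<Rightarrow> real \<Rightarrow> real \<Rightarrow> real" where
  "reg_theta e x t = theta x t - (if t < 1 then sqrt pi * t powr (- 1 / 2) else e)"

lemma theta_measurable [measurable]: "theta x \<in> borel_measurable borel"
  unfolding theta_def paired_term_def gaussian_def by measurable

lemma reg_theta_measurable [measurable]: "reg_theta e x \<in> borel_measurable borel"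
  unfolding reg_theta_def by measurable

lemma sqrt_pi_div: "t > 0 \<Longrightarrow> sqrt (pi / t) = sqrt pi * t powr (- 1 / 2)"
  by (simp add: real_sqrt_divide powr_minus_divide powr_half_sqrt)

text \<open>Since (n + y)^2 \<ge> n + m^2, the terms decay geometrically in n with a ratio
  independent of t \<ge> 1, and the whole decay in t is kept in the first factor.\<close>

lemma gaussian_shift_le:
  assumes "t \<ge> 1" "0 \<le> m" "m \<le> y"
  shows "gaussian t (real n + y) \<le> exp (- (m^2 * t)) * exp (- 1) ^ n"
proof -
  have "m^2 \<le> y^2" using assms by (intro power_mono) auto
  moreover have "real n \<le> (real n)^2" by (cases n) (auto simp: power2_eq_square)
  moreover have "0 \<le> 2 * real n * y" using assms by simp
  moreover have "(real n + y)^2 = (real n)^2 + y^2 + 2 * real n * y" by (rule power2_sum)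
  ultimately have "real n + m^2 \<le> (real n + y)^2" by linarith
  then have "(real n + m^2) * t \<le> (real n + y)^2 * t"
    using assms by (intro mult_right_mono) auto
  moreover have "real n \<le> real n * t" using assms by (simp add: mult_le_cancel_left1)
  ultimately have "m^2 * t + real n \<le> (real n + y)^2 * t" by (simp add: algebra_simps)
  then show ?thesis
    by (simp add: gaussian_def exp_of_nat_mult[symmetric] exp_add[symmetric])
qed

lemma summable_exp_minus_1: "summable (\<lambda>n. exp (- 1 :: real) ^ n)"
  by (rule summable_exp_power) simp

lemma suminf_geometric_bound:
  fixes f :: "nat \<Rightarrow> real"
  assumes "\<And>n. \<bar>f n\<bar> \<le> c * exp (- 1) ^ n"
  shows "summable f" "\<bar>\<Sum>n. f n\<bar> \<le> c * (\<Sum>n. exp (- 1) ^ n)"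
proof -
  have s: "summable (\<lambda>n. c * exp (- 1 :: real) ^ n)" by (intro summable_mult summable_exp_minus_1)
  have a: "summable (\<lambda>n. \<bar>f n\<bar>)"
    by (rule summable_comparison_test'[OF s, where N = 0]) (use assms in auto)
  then show "summable f" by (rule summable_rabs_cancel)
  have "\<bar>\<Sum>n. f n\<bar> \<le> (\<Sum>n. \<bar>f n\<bar>)" by (rule summable_rabs[OF a])
  also have "\<dots> \<le> (\<Sum>n. c * exp (- 1) ^ n)" by (rule suminf_le[OF assms a s])
  also have "\<dots> = c * (\<Sum>n. exp (- 1) ^ n)" by (rule suminf_mult[OF summable_exp_minus_1])
  finally show "\<bar>\<Sum>n. f n\<bar> \<le> c * (\<Sum>n. exp (- 1) ^ n)" .
qed

lemma theta_0:
  assumes "t > 0"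
  shows "theta 0 t = 1 + 2 * (\<Sum>n. gaussian t (real (Suc n)))" "summable (\<lambda>n. gaussian t (real (Suc n)))"
proof -
  have s: "summable (\<lambda>n. gaussian t (real n))"
  proof (rule summable_comparison_test'[OF summable_exp_power[OF assms], where N = 0])
    show "norm (gaussian t (real n)) \<le> exp (- t) ^ n" for n
      using gaussian_le[of t n "real n"] assms by simp
  qed
  then show s': "summable (\<lambda>n. gaussian t (real (Suc n)))"
    using summable_Suc_iff[of "\<lambda>n. gaussian t (real n)"] by simp
  have "theta 0 t = (\<Sum>n. gaussian t (real n) + gaussian t (real (Suc n)))"
    by (simp add: theta_def paired_term_def add.commute)
  also have "\<dots> = (\<Sum>n. gaussian t (real n)) + (\<Sum>n. gaussian t (real (Suc n)))"
    using s s' by (rule suminf_add[symmetric])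
  also have "(\<Sum>n. gaussian t (real n)) = gaussian t (real 0) + (\<Sum>n. gaussian t (real (Suc n)))"
    using suminf_split_initial_segment[OF s, of 1] by simp
  also have "gaussian t (real 0) = 1" by (simp add: gaussian_def)
  finally show "theta 0 t = 1 + 2 * (\<Sum>n. gaussian t (real (Suc n)))" by simp
qed

lemma exp_dual_le:
  assumes t: "0 < t" "t < 1"
  shows "exp (- (pi^2 * (real (Suc n))^2 / t)) \<le> exp (- (1 / t)) * exp (- 1) ^ n"
proof -
  have "real n + 1 \<le> (real n + 1)^2" by (simp add: power2_eq_square)
  moreover have "pi^2 \<ge> 1" using pi_ge_two by (intro one_le_power) auto
  ultimately have "1 * (real n + 1) \<le> pi^2 * (real n + 1)^2" by (intro mult_mono) auto
  then have "(real n + 1) / t \<le> pi^2 * (real n + 1)^2 / t" using t by (intro divide_right_mono) auto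
  moreover have "real n \<le> real n / t" using t mult_right_mono[of t 1 "real n"] by (simp add: field_simps)
  ultimately have "1 / t + real n \<le> pi^2 * (real (Suc n))^2 / t" by (simp add: add_divide_distrib add.commute)
  then show ?thesis by (simp add: exp_of_nat_mult[symmetric] exp_add[symmetric])
qed

lemma theta_small_bound:
  assumes t: "0 < t" "t < 1" and x: "x \<in> {0..1}"
  shows "\<bar>theta x t - sqrt pi * t powr (- 1 / 2)\<bar> \<le> 2 * sqrt pi * (\<Sum>n. exp (- 1) ^ n) * t powr (- 1 / 2) * exp (- (1 / t))"
proof -
  have "\<bar>dual_term t x n\<bar> \<le> exp (- (1 / t)) * exp (- 1) ^ n" for n
  proof -
    have "\<bar>dual_term t x n\<bar> \<le> exp (- (pi^2 * (real (Suc n))^2 / t)) * 1"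
      unfolding dual_term_def abs_mult by (intro mult_mono) auto
    then show ?thesis using exp_dual_le[OF t, of n] by simp
  qed
  from suminf_geometric_bound(2)[OF this]
  have b: "\<bar>\<Sum>n. dual_term t x n\<bar> \<le> exp (- (1 / t)) * (\<Sum>n. exp (- 1) ^ n)" .
  have "theta x t - sqrt pi * t powr (- 1 / 2) = sqrt pi * t powr (- 1 / 2) * (2 * (\<Sum>n. dual_term t x n))"
    unfolding theta_def poisson_summation_gaussian[OF t(1) x] sqrt_pi_div[OF t(1)] by (simp add: algebra_simps)
  then have "\<bar>theta x t - sqrt pi * t powr (- 1 / 2)\<bar> = sqrt pi * t powr (- 1 / 2) * (2 * \<bar>\<Sum>n. dual_term t x n\<bar>)"
    by (simp add: abs_mult)
  also have "\<dots> \<le> sqrt pi * t powr (- 1 / 2) * (2 * (exp (- (1 / t)) * (\<Sum>n. exp (- 1) ^ n)))"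
    using b by (intro mult_left_mono) auto
  finally show ?thesis by (simp add: mult_ac)
qed

text \<open>The rate is the squared distance from x to the nearest integer. It degenerates at the
  integers, where the constant term 1 survives and has to be subtracted instead.\<close>

lemma theta_large_bound:
  assumes t: "t \<ge> 1" and x: "x \<in> {0<..<1}"
  shows "\<bar>theta x t\<bar> \<le> 2 * (\<Sum>n. exp (- 1) ^ n) * exp (- ((min x (1 - x))^2 * t))"
proof -
  define m where "m = min x (1 - x)"
  have m: "0 \<le> m" "m \<le> x" "m \<le> 1 - x" using x by (auto simp: m_def)
  have "\<bar>paired_term (gaussian t) x n\<bar> \<le> 2 * exp (- (m^2 * t)) * exp (- 1) ^ n" for n
    using gaussian_shift_le[OF t m(1,2), of n] gaussian_shift_le[OF t m(1,3), of n]
    by (simp add: paired_term_def add_diff_eq)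
  from suminf_geometric_bound(2)[OF this] show ?thesis
    by (simp add: theta_def m_def mult_ac)
qed

lemma theta_0_large_bound:
  assumes t: "t \<ge> 1"
  shows "\<bar>theta 0 t - 1\<bar> \<le> 2 * (\<Sum>n. exp (- 1) ^ n) * exp (- (1 * t))"
proof -
  have "\<bar>gaussian t (real (Suc n))\<bar> \<le> exp (- t) * exp (- 1) ^ n" for n
    using gaussian_shift_le[OF t, of 1 1 n] by (simp add: add.commute)
  from suminf_geometric_bound(2)[OF this] show ?thesis
    using theta_0(1)[of t] t by (simp add: mult_ac)
qed

text \<open>Small t is settled for all x at once by Poisson summation, so only the behaviour at
  large t distinguishes x = 0 from interior points.\<close>

lemma mellin_converges_reg_theta_of_bound:
  assumes c: "c > 0" and x: "x \<in> {0..1}"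
    and large: "\<And>t. t \<ge> 1 \<Longrightarrow> \<bar>theta x t - e\<bar> \<le> 2 * (\<Sum>n. exp (- 1) ^ n) * exp (- (c * t))"
  shows "mellin_converges (reg_theta e x) a"
proof (rule mellin_converges_of_decay[OF _ c, where C = "2 * sqrt pi * (\<Sum>n. exp (- 1) ^ n)"])
  define S :: real where "S = (\<Sum>n. exp (- 1) ^ n)"
  have S: "S \<ge> 0" unfolding S_def by (intro suminf_nonneg summable_exp_minus_1) auto
  show "\<bar>reg_theta e x t\<bar> \<le> 2 * sqrt pi * (\<Sum>n. exp (- 1) ^ n) * exp (- (c * t))" if t: "t \<ge> 1" for t
  proof -
    have "\<bar>reg_theta e x t\<bar> \<le> 2 * S * exp (- (c * t))"
      using large[OF t] t by (simp add: reg_theta_def S_def)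
    also have "\<dots> \<le> 2 * sqrt pi * S * exp (- (c * t))"
      using S pi_ge_two by (intro mult_right_mono) auto
    finally show ?thesis unfolding S_def .
  qed
  show "\<bar>reg_theta e x t\<bar> \<le> 2 * sqrt pi * (\<Sum>n. exp (- 1) ^ n) * t powr (- 1 / 2) * exp (- (1 / t))" if "0 < t" "t < 1" for t
    using theta_small_bound[OF that x] that by (simp add: reg_theta_def)
qed measurable

lemma mellin_converges_reg_theta: "x \<in> {0<..<1} \<Longrightarrow> mellin_converges (reg_theta 0 x) a"
  using theta_large_bound[of _ x]
  by (intro mellin_converges_reg_theta_of_bound[of "(min x (1 - x))^2"]) (auto simp: min_def)

lemma mellin_converges_reg_theta_0: "mellin_converges (reg_theta 1 0) a"
  using theta_0_large_bound by (intro mellin_converges_reg_theta_of_bound[of 1]) auto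

subsection \<open>The zeta function as a Mellin transform\<close>

lemma mellin_entire:
  assumes "\<And>a. mellin_converges f a"
  shows "mellin f holomorphic_on A"
proof -
  have "mellin f field_differentiable (at z)" for z
    using mellin_has_field_derivative(3)[OF assms[of "Re z - 1"] assms[of "Re z + 1"], of z]
    by (auto simp: field_differentiable_def)
  then show ?thesis
    by (auto simp: holomorphic_on_def intro: field_differentiable_at_within)
qed

lemma exp_of_nat_powr:
  fixes s :: complex
  shows "exp (- s * of_real (ln (real (Suc n)))) = of_nat (Suc n) powr (- s)"
proof -
  have "Ln (of_nat (Suc n)) = of_real (ln (real (Suc n)))"
    using Ln_of_real[of "real (Suc n)"] by simp
  moreover have "(of_nat (Suc n) :: complex) \<noteq> 0" by (simp del: of_nat_Suc)
  ultimately show ?thesis by (simp add: powr_def del: of_nat_Suc)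
qed

lemma summable_Suc_powr:
  assumes "a > 1"
  shows "summable (\<lambda>n. real (Suc n) powr (- a))"
  using assms summable_real_powr_iff[of "- a"] summable_Suc_iff[of "\<lambda>n. real n powr (- a)"] by simp

lemma summable_dirichlet_series:
  assumes "Re s > 1"
  shows "summable (\<lambda>n. (of_nat (Suc n) :: complex) powr (- s))"
proof (rule summable_norm_cancel)
  have "norm ((of_nat (Suc n) :: complex) powr (- s)) = real (Suc n) powr (- Re s)" for n
    using norm_powr_real_powr[of "of_nat (Suc n)" "- s"] by simp
  then show "summable (\<lambda>n. norm ((of_nat (Suc n) :: complex) powr (- s)))"
    using summable_Suc_powr[OF assms] by simp
qed

text \<open>Termwise integration gives \<Gamma>(z) (n + 1)^(-2z). The integrals of the absolute
  values are given by the same formula at the real point Re z, and they are summable because 2 Re z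
  > 1.\<close>

lemma mellin_theta_0:
  assumes z: "Re z > 1 / 2"
  shows "mellin_converges (\<lambda>t. \<Sum>n. gaussian t (real (Suc n))) (Re z)"
    and "mellin (\<lambda>t. \<Sum>n. gaussian t (real (Suc n))) z = Gamma z * (\<Sum>n. of_nat (Suc n) powr (- (2 * z)))"
proof -
  define \<sigma> where "\<sigma> = Re z"
  have \<sigma>: "\<sigma> > 1 / 2" using z by (simp add: \<sigma>_def)
  define f where "f n w t = indicator {0<..} t *\<^sub>R (complex_of_real (gaussian t (real (Suc n))) * exp ((w - 1) * of_real (ln t)))"
    for n w and t :: real
  have conv: "mellin_converges (\<lambda>t. gaussian t (real (Suc n))) \<sigma>" for n
    unfolding gaussian_def using \<sigma> by (intro mellin_exp_scaled(1)) auto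
  have int: "integrable lborel (f n w)" if "Re w = \<sigma>" for n w
    using mellin_convergesD[of "\<lambda>t. gaussian t (real (Suc n))" w] conv[of n] that
    unfolding set_integrable_def f_def by simp
  have val: "integral\<^sup>L lborel (f n w) = Gamma w * of_nat (Suc n) powr (- (2 * w))" if "Re w = \<sigma>" for n w
  proof -
    have "integral\<^sup>L lborel (f n w) = mellin (\<lambda>t. gaussian t (real (Suc n))) w"
      unfolding mellin_def set_lebesgue_integral_def
      by (intro Bochner_Integration.integral_cong refl) (simp add: f_def)
    also have "\<dots> = exp (- w * of_real (ln ((real (Suc n))^2))) * Gamma w"
      unfolding gaussian_def using \<sigma> that by (intro mellin_exp_scaled(2)) auto
    also have "exp (- w * of_real (ln ((real (Suc n))^2))) = of_nat (Suc n) powr (- (2 * w))"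
    proof -
      have "ln ((real (Suc n))^2) = 2 * ln (real (Suc n))"
        using ln_realpow[of "real (Suc n)" 2] by simp
      then show ?thesis using exp_of_nat_powr[of "2 * w" n] by (simp add: mult_ac)
    qed
    finally show ?thesis by (simp add: mult.commute)
  qed
  have nrm: "norm (f n w t) = indicator {0<..} t *\<^sub>R (gaussian t (real (Suc n)) * t powr (Re w - 1))" for n w t
    by (auto simp: f_def norm_mult exp_of_real_ln indicator_def)
  have "(LINT t|lborel. norm (f n z t)) = Gamma \<sigma> * real (Suc n) powr (- (2 * \<sigma>))" for n
  proof -
    \<comment> \<open>The absolute value of the integrand at z is the integrand at the real part
      \<sigma>, so the formula \<open>val\<close> also evaluates the integral of the norm.\<close>
    have "complex_of_real (norm (f n z t)) = f n (of_real \<sigma>) t" for t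
      unfolding nrm by (auto simp: f_def exp_of_real_ln indicator_def \<sigma>_def[symmetric])
    then have "complex_of_real (LINT t|lborel. norm (f n z t)) = integral\<^sup>L lborel (f n (of_real \<sigma>))"
      by (simp add: integral_complex_of_real[symmetric])
    also have "\<dots> = Gamma (of_real \<sigma>) * of_nat (Suc n) powr (- (2 * of_real \<sigma>))"
      by (rule val) simp
    also have "(of_nat (Suc n) :: complex) powr (- (2 * of_real \<sigma>)) = of_real (real (Suc n) powr (- (2 * \<sigma>)))"
      using powr_of_real[of "real (Suc n)" "- (2 * \<sigma>)"] by simp
    also have "Gamma (complex_of_real \<sigma>) = of_real (Gamma \<sigma>)" by (simp add: Gamma_complex_of_real)
    finally show ?thesis by (simp only: of_real_mult[symmetric] of_real_eq_iff)
  qed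
  moreover have "summable (\<lambda>n. Gamma \<sigma> * real (Suc n) powr (- (2 * \<sigma>)))"
    using \<sigma> by (intro summable_mult summable_Suc_powr) simp
  ultimately have sumint: "summable (\<lambda>n. LINT t|lborel. norm (f n z t))" by simp
  have ae: "AE t in lborel. summable (\<lambda>n. norm (f n z t))"
  proof (rule AE_I2)
    fix t :: real
    show "summable (\<lambda>n. norm (f n z t))"
      unfolding nrm using theta_0(2)[of t]
      by (cases "t > 0") (auto simp: indicator_def intro!: summable_mult2)
  qed
  have fz: "integrable lborel (f n z)" for n by (rule int) (simp add: \<sigma>_def)
  have s: "(\<Sum>n. f n z t) = indicator {0<..} t *\<^sub>R (complex_of_real (\<Sum>n. gaussian t (real (Suc n))) * exp ((z - 1) * of_real (ln t)))" for t
  proof (cases "t > 0")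
    case True
    have "(\<Sum>n. f n z t) = (\<Sum>n. complex_of_real (gaussian t (real (Suc n))) * exp ((z - 1) * of_real (ln t)))"
      using True by (simp add: f_def)
    also have "\<dots> = (\<Sum>n. complex_of_real (gaussian t (real (Suc n)))) * exp ((z - 1) * of_real (ln t))"
      using theta_0(2)[OF True] by (intro suminf_mult2[symmetric] summable_of_real)
    also have "(\<Sum>n. complex_of_real (gaussian t (real (Suc n)))) = of_real (\<Sum>n. gaussian t (real (Suc n)))"
      using theta_0(2)[OF True] by (rule suminf_of_real[symmetric])
    finally show ?thesis using True by simp
  qed (simp add: f_def)
  have isum: "integrable lborel (\<lambda>t. \<Sum>n. f n z t)"
    by (rule integrable_suminf[OF fz ae sumint])
  show "mellin_converges (\<lambda>t. \<Sum>n. gaussian t (real (Suc n))) (Re z)"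
    unfolding mellin_converges_def
  proof
    show "(\<lambda>t. \<Sum>n. gaussian t (real (Suc n))) \<in> borel_measurable borel"
      unfolding gaussian_def by measurable
    have "integrable lborel (\<lambda>t. norm (\<Sum>n. f n z t))" using isum by simp
    also have "(\<lambda>t. norm (\<Sum>n. f n z t)) = (\<lambda>t. indicator {0<..} t *\<^sub>R ((\<Sum>n. gaussian t (real (Suc n))) * t powr (Re z - 1)))"
    proof
      fix t :: real
      show "norm (\<Sum>n. f n z t) = indicator {0<..} t *\<^sub>R ((\<Sum>n. gaussian t (real (Suc n))) * t powr (Re z - 1))"
        unfolding s using suminf_nonneg[OF theta_0(2)[of t]]
        by (cases "t > 0") (auto simp: norm_mult exp_of_real_ln)
    qed
    finally show "set_integrable lborel {0<..} (\<lambda>t. (\<Sum>n. gaussian t (real (Suc n))) * t powr (Re z - 1))"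
      by (simp add: set_integrable_def)
  qed
  have "mellin (\<lambda>t. \<Sum>n. gaussian t (real (Suc n))) z = (LINT t|lborel. (\<Sum>n. f n z t))"
    unfolding mellin_def set_lebesgue_integral_def s ..
  also have "\<dots> = (\<Sum>n. integral\<^sup>L lborel (f n z))"
    by (rule integral_suminf[OF fz ae sumint])
  also have "\<dots> = (\<Sum>n. Gamma z * of_nat (Suc n) powr (- (2 * z)))"
    by (simp add: val \<sigma>_def)
  also have "\<dots> = Gamma z * (\<Sum>n. of_nat (Suc n) powr (- (2 * z)))"
    using z by (intro suminf_mult summable_dirichlet_series) simp
  finally show "mellin (\<lambda>t. \<Sum>n. gaussian t (real (Suc n))) z = Gamma z * (\<Sum>n. of_nat (Suc n) powr (- (2 * z)))" .
qed

text \<open>Riemann's continuation with z = s / 2. The second and third terms are the transforms of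
  the two truncated pieces removed in \<open>reg_theta\<close>; \<open>rGamma (z + 1)\<close> stands
  for \<open>rGamma z / z\<close>, so that no singularity appears at 0 and 1 is the only exceptional
  point.\<close>

definition zeta_mellin :: "complex \<Rightarrow> complex" where
  "zeta_mellin s = (rGamma (s / 2) * mellin (reg_theta 1 0) (s / 2)
     + 2 * of_real (sqrt pi) * rGamma (s / 2) / (s - 1) - rGamma (s / 2 + 1)) / 2"

lemma zeta_mellin_eq_series:
  assumes s: "Re s > 1"
  shows "zeta_mellin s = (\<Sum>n. of_nat (Suc n) powr (- s))"
proof -
  define z where "z = s / 2"
  have z: "Re z > 1 / 2" using s by (simp add: z_def)
  have zn: "z \<noteq> 0" "s = 2 * z" using z by (auto simp: z_def)
  have s1: "s \<noteq> 1" using s by auto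
  have conv: "mellin_converges (powr_below (- 1 / 2)) (Re z)" "mellin_converges (powr_below 0) (Re z)"
    using z by (auto intro!: mellin_converges_powr_below)
  have "2 * (Gamma z * (\<Sum>n. of_nat (Suc n) powr (- (2 * z)))) =
    mellin (\<lambda>t. 2 * (\<Sum>n. gaussian t (real (Suc n))) + 0 * powr_below 0 t) z"
    using mellin_lincomb[OF mellin_theta_0(1)[OF z] conv(2), of 2 0] mellin_theta_0(2)[OF z] by simp
  also have "\<dots> = mellin (\<lambda>t. 1 * reg_theta 1 0 t + 1 * (sqrt pi * powr_below (- 1 / 2) t + (- 1) * powr_below 0 t)) z"
    by (rule mellin_cong) (auto simp: theta_0(1) reg_theta_def powr_below_def)
  also have "\<dots> = mellin (reg_theta 1 0) z + (of_real (sqrt pi) * mellin (powr_below (- 1 / 2)) z - mellin (powr_below 0) z)"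
    using mellin_lincomb[OF mellin_converges_reg_theta_0 mellin_converges_lincomb[OF conv], of 1 1 "sqrt pi" "- 1"]
      mellin_lincomb[OF conv, of "sqrt pi" "- 1"] by simp
  also have "mellin (powr_below (- 1 / 2)) z = 1 / (z - 1 / 2)"
    using mellin_powr_below[of z "- 1 / 2"] z by simp
  also have "mellin (powr_below 0) z = 1 / z"
    using mellin_powr_below[of z 0] z by simp
  finally have 1: "2 * (Gamma z * (\<Sum>n. of_nat (Suc n) powr (- s))) =
      mellin (reg_theta 1 0) z + (of_real (sqrt pi) * (1 / (z - 1 / 2)) - 1 / z)"
    by (simp add: zn(2))
  have G: "rGamma z * Gamma z = 1"
    using z by (simp add: rGamma_inverse_Gamma Gamma_eq_zero_iff Re_pos_notin_nonpos_Ints)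
  have r1: "rGamma (z + 1) = rGamma z / z"
    using rGamma_plus1[of z] zn by (simp add: field_simps)
  have h: "2 / (s - 1) = 1 / (z - 1 / 2)"
    using s1 by (simp add: zn(2) field_simps)
  have "2 * zeta_mellin s = rGamma z * (mellin (reg_theta 1 0) z + (of_real (sqrt pi) * (2 / (s - 1)) - 1 / z))"
  proof -
    have "2 * zeta_mellin s = rGamma z * mellin (reg_theta 1 0) z + 2 * of_real (sqrt pi) * rGamma z / (s - 1) - rGamma z / z"
      unfolding zeta_mellin_def z_def[symmetric] r1 by simp
    then show ?thesis by (simp add: algebra_simps)
  qed
  also have "\<dots> = rGamma z * (2 * (Gamma z * (\<Sum>n. of_nat (Suc n) powr (- s))))"
    unfolding h 1 ..
  also have "\<dots> = 2 * (rGamma z * Gamma z) * (\<Sum>n. of_nat (Suc n) powr (- s))"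
    by (simp add: mult_ac)
  finally show ?thesis by (simp add: G)
qed

lemma zeta_mellin_holomorphic: "zeta_mellin holomorphic_on - {1}"
proof -
  have "(\<lambda>s. mellin (reg_theta 1 0) (s / 2)) holomorphic_on - {1}"
  proof (rule holomorphic_on_compose_gen[of "\<lambda>s. s / 2" _ _ UNIV, unfolded o_def])
    show "mellin (reg_theta 1 0) holomorphic_on UNIV"
      by (rule mellin_entire[OF mellin_converges_reg_theta_0])
  qed (auto intro!: holomorphic_intros)
  then show ?thesis
    unfolding zeta_mellin_def by (intro holomorphic_intros) auto
qed

text \<open>\<open>zeta_mellin\<close> witnesses the existence that the choice in the definition of
  \<open>zeta\<close> requires.\<close>

lemma zeta_properties:
  shows zeta_holomorphic: "zeta holomorphic_on - {1}"
    and zeta_eq_series: "Re s > 1 \<Longrightarrow> zeta s = (\<Sum>n. of_nat (Suc n) powr (- s))"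
proof -
  have "zeta holomorphic_on - {1} \<and> (\<forall>s. Re s > 1 \<longrightarrow> zeta s = (\<Sum>n. of_nat (Suc n) powr (- s)))"
    unfolding zeta_def
    by (rule someI[where x = zeta_mellin]) (use zeta_mellin_holomorphic zeta_mellin_eq_series in auto)
  then show "zeta holomorphic_on - {1}" "Re s > 1 \<Longrightarrow> zeta s = (\<Sum>n. of_nat (Suc n) powr (- s))"
    by auto
qed

lemma zeta_eq_zeta_mellin:
  assumes "s \<noteq> 1"
  shows "zeta s = zeta_mellin s"
proof (rule analytic_continuation_open[of "{s. Re s > 1}" "- {1}" zeta zeta_mellin])
  show "open {s. Re s > 1}" by (rule open_halfspace_Re_gt)
  show "{s. Re s > 1} \<noteq> {}" by (auto intro!: exI[of _ 2])
  show "connected (- {1 :: complex})" by (rule connected_punctured_universe) simp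
  fix z assume "z \<in> {s. Re s > 1}"
  then show "zeta z = zeta_mellin z"
    using zeta_eq_series zeta_mellin_eq_series by auto
qed (use assms zeta_holomorphic zeta_mellin_holomorphic in auto)

subsection \<open>Evaluation of the periodic kernel\<close>

lemma log_riesz_density_measurable [measurable]: "log_riesz_density s \<in> borel_measurable borel"
  unfolding log_riesz_density_def by measurable

lemma log_riesz_integral_eq:
  assumes "set_integrable lborel A (\<lambda>t. f t * log_riesz_density s t)"
  shows "log_riesz_integral s A f = ereal (LINT t:A|lborel. f t * log_riesz_density s t)"
proof -
  define g where "g = (\<lambda>t. indicator A t *\<^sub>R (f t * log_riesz_density s t))"
  have g: "integrable lborel g"
    using assms unfolding set_integrable_def g_def .
  have pos: "(\<integral>\<^sup>+t\<in>A. ennreal (f t * log_riesz_density s t) \<partial>lborel) = (\<integral>\<^sup>+t. ennreal (g t) \<partial>lborel)"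
    and neg: "(\<integral>\<^sup>+t\<in>A. ennreal (- (f t * log_riesz_density s t)) \<partial>lborel) = (\<integral>\<^sup>+t. ennreal (- g t) \<partial>lborel)"
    by (auto intro!: nn_integral_cong simp: g_def indicator_def)
  have fin: "(\<integral>\<^sup>+t. ennreal (g t) \<partial>lborel) \<noteq> \<infinity>" "(\<integral>\<^sup>+t. ennreal (- g t) \<partial>lborel) \<noteq> \<infinity>"
    using g by (auto simp: real_integrable_def)
  have e: "enn2ereal a = ereal (enn2real a)" if "a \<noteq> \<infinity>" for a
    using that by (cases a) auto
  have "log_riesz_integral s A f
      = ereal (enn2real (\<integral>\<^sup>+t. ennreal (g t) \<partial>lborel)) - ereal (enn2real (\<integral>\<^sup>+t. ennreal (- g t) \<partial>lborel))"
    unfolding log_riesz_integral_def pos neg e[OF fin(1)] e[OF fin(2)] ..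
  also have "\<dots> = ereal (integral\<^sup>L lborel g)"
    using real_lebesgue_integral_def[OF g] by simp
  finally show ?thesis
    by (simp add: set_lebesgue_integral_def g_def)
qed

lemma has_sum_ereal:
  assumes "(f has_sum S) A"
  shows "((\<lambda>x. ereal (f x)) has_sum ereal S) A"
proof -
  have "((\<lambda>F. ereal (sum f F)) \<longlongrightarrow> ereal S) (finite_subsets_at_top A)"
    using assms by (intro tendsto_ereal) (simp add: has_sum_def)
  moreover have "sum (\<lambda>x. ereal (f x)) = (\<lambda>F. ereal (sum f F))"
    by (auto simp: fun_eq_iff)
  ultimately show ?thesis unfolding has_sum_def by simp
qed

text \<open>A majorant that separates into a summable sequence and an integrable function is what
  both lattice sums of the kernel provide, with w a Gaussian times the density for the direct sum
  and an exponential in 1 / t for the dual one.\<close>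

lemma dominated_suminf_set_integral:
  fixes f :: "nat \<Rightarrow> real \<Rightarrow> real"
  assumes [measurable]: "\<And>n. f n \<in> borel_measurable borel" "A \<in> sets borel"
    and a: "summable a" and w: "set_integrable lborel A w"
    and le: "\<And>n t. t \<in> A \<Longrightarrow> \<bar>f n t\<bar> \<le> a n * w t"
  shows "summable (\<lambda>n. \<bar>LINT t:A|lborel. f n t\<bar>)"
    and "(LINT t:A|lborel. (\<Sum>n. f n t)) = (\<Sum>n. LINT t:A|lborel. f n t)"
proof -
  have i: "set_integrable lborel A (f n)" for n
  proof (rule set_integrable_bound)
    show "set_integrable lborel A (\<lambda>t. a n * w t)" using w by (rule set_integrable_mult_right)
    show "AE t in lborel. t \<in> A \<longrightarrow> norm (f n t) \<le> norm (a n * w t)"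
    proof (intro AE_I2 impI)
      fix t assume "t \<in> A"
      from le[OF this, of n] show "norm (f n t) \<le> norm (a n * w t)" by simp
    qed
  qed (simp add: set_borel_measurable_def)
  define g where "g = (\<lambda>n t. indicator A t *\<^sub>R f n t)"
  have g: "integrable lborel (g n)" for n
    using i[of n] unfolding set_integrable_def g_def .
  have bound: "(LINT t|lborel. norm (g n t)) \<le> a n * (LINT t:A|lborel. w t)" for n
  proof -
    have "(LINT t|lborel. norm (g n t)) \<le> (LINT t|lborel. indicator A t *\<^sub>R (a n * w t))"
    proof (rule integral_mono)
      show "integrable lborel (\<lambda>t. norm (g n t))" using g by simp
      show "integrable lborel (\<lambda>t. indicator A t *\<^sub>R (a n * w t))"
        using set_integrable_mult_right[of "a n", OF w] unfolding set_integrable_def .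
      show "norm (g n t) \<le> indicator A t *\<^sub>R (a n * w t)" for t
        using le[of t n] by (auto simp: g_def indicator_def)
    qed
    also have "\<dots> = (LINT t:A|lborel. a n * w t)"
      by (simp only: set_lebesgue_integral_def)
    also have "\<dots> = a n * (LINT t:A|lborel. w t)"
      by (rule set_integral_mult_right)
    finally show ?thesis .
  qed
  have s1: "summable (\<lambda>n. LINT t|lborel. norm (g n t))"
    by (rule summable_comparison_test'[OF summable_mult2[OF a], where N = 0]) (use bound in auto)
  have ae: "AE t in lborel. summable (\<lambda>n. norm (g n t))"
  proof (rule AE_I2)
    fix t :: real
    show "summable (\<lambda>n. norm (g n t))"
    proof (cases "t \<in> A")
      case True
      then show ?thesis
        by (intro summable_comparison_test'[OF summable_mult2[OF a, of "w t"], where N = 0]) (use le in \<open>auto simp: g_def\<close>)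
    qed (simp add: g_def)
  qed
  show "summable (\<lambda>n. \<bar>LINT t:A|lborel. f n t\<bar>)"
  proof (rule summable_comparison_test'[OF s1, where N = 0])
    show "norm \<bar>LINT t:A|lborel. f n t\<bar> \<le> (LINT t|lborel. norm (g n t))" for n
      using integral_norm_bound[of lborel "g n"] by (simp add: set_lebesgue_integral_def g_def)
  qed
  have eq: "(\<Sum>n. g n t) = indicator A t *\<^sub>R (\<Sum>n. f n t)" for t
    by (auto simp: g_def indicator_def)
  show "(LINT t:A|lborel. (\<Sum>n. f n t)) = (\<Sum>n. LINT t:A|lborel. f n t)"
    using integral_suminf[OF g ae s1] unfolding eq by (simp add: set_lebesgue_integral_def g_def)
qed

text \<open>After a translation by the floor of u, the integers split into v \<ge> 0 and v \<le> -
  1; evenness turns the second half into the arguments n + 1 - frac u.\<close>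

lemma has_sum_int_paired:
  fixes g :: "real \<Rightarrow> real"
  assumes even: "\<And>q. g (- q) = g q"
    and s: "summable (\<lambda>n. \<bar>g (real n + frac u)\<bar>)" "summable (\<lambda>n. \<bar>g (real n + 1 - frac u)\<bar>)"
  shows "((\<lambda>v::int. g (u + of_int v)) has_sum (\<Sum>n. paired_term g (frac u) n)) UNIV"
proof -
  define h where "h v = g (frac u + of_int v)" for v :: int
  have "(h has_sum (\<Sum>n. g (real n + frac u))) (range int)"
  proof (subst has_sum_reindex)
    have "h (int n) = g (real n + frac u)" for n by (simp add: h_def add.commute)
    then show "((h \<circ> int) has_sum (\<Sum>n. g (real n + frac u))) UNIV"
      using s(1) by (intro norm_summable_imp_has_sum) (simp_all add: o_def summable_sums summable_rabs_cancel)
  qed (auto simp: inj_on_def)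
  moreover have "(h has_sum (\<Sum>n. g (real n + 1 - frac u))) (range (\<lambda>n. - 1 - int n))"
  proof (subst has_sum_reindex)
    have "h (- 1 - int n) = g (real n + 1 - frac u)" for n
      using even[of "real n + 1 - frac u"] by (simp add: h_def algebra_simps)
    then show "((h \<circ> (\<lambda>n. - 1 - int n)) has_sum (\<Sum>n. g (real n + 1 - frac u))) UNIV"
      using s(2) by (intro norm_summable_imp_has_sum) (simp_all add: o_def summable_sums summable_rabs_cancel)
  qed (auto simp: inj_on_def)
  ultimately have "(h has_sum ((\<Sum>n. g (real n + frac u)) + (\<Sum>n. g (real n + 1 - frac u)))) (range int \<union> range (\<lambda>n. - 1 - int n))"
    by (rule has_sum_Un_disjoint) auto
  also have "range int \<union> range (\<lambda>n. - 1 - int n) = UNIV"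
  proof safe
    fix v :: int assume "v \<notin> range (\<lambda>n. - 1 - int n)"
    then have "v \<noteq> - 1 - int (nat (- 1 - v))" by blast
    then have "v = int (nat v)" by linarith
    then show "v \<in> range int" by blast
  qed auto
  also have "(\<Sum>n. g (real n + frac u)) + (\<Sum>n. g (real n + 1 - frac u)) = (\<Sum>n. paired_term g (frac u) n)"
    unfolding paired_term_def using s by (intro suminf_add) (auto intro: summable_rabs_cancel)
  finally have "(h has_sum (\<Sum>n. paired_term g (frac u) n)) UNIV" .
  moreover have "bij_betw (\<lambda>v. v + \<lfloor>u\<rfloor>) UNIV UNIV"
    by (rule bij_betwI[of _ _ _ "\<lambda>v. v - \<lfloor>u\<rfloor>"]) auto
  ultimately have "((\<lambda>v. h (v + \<lfloor>u\<rfloor>)) has_sum (\<Sum>n. paired_term g (frac u) n)) UNIV"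
    using has_sum_reindex_bij_betw[of "\<lambda>v. v + \<lfloor>u\<rfloor>" UNIV UNIV h] by blast
  moreover have "h (v + \<lfloor>u\<rfloor>) = g (u + of_int v)" for v
    by (simp add: h_def frac_def algebra_simps)
  ultimately show ?thesis by simp
qed

lemma kernel_direct_sum:
  fixes u s :: real
  assumes s: "s > 0" and u: "u \<notin> \<int>"
  shows "(\<Sum>\<^sub>\<infinity>v\<in>(UNIV :: int set). log_riesz_integral s {1<..} (\<lambda>t. exp (- (\<bar>u + of_int v\<bar>^2) * t)))
    = ereal (LINT t:{1<..}|lborel. theta (frac u) t * log_riesz_density s t)"
proof -
  define d where "d = frac u"
  have d: "0 < d" "d < 1" using u by (auto simp: d_def frac_lt_1 frac_gt_0_iff)
  define I where "I q = (LINT t:{1<..}|lborel. gaussian t q * log_riesz_density s t)" for q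
  have ui: "u + of_int v \<noteq> 0" for v :: int
  proof
    assume "u + of_int v = 0"
    then have "u = of_int (- v)" by simp
    then show False using u by (metis Ints_of_int)
  qed
  have ge: "gaussian t q = gaussian t \<bar>q\<bar>" for t q by (simp add: gaussian_def)
  have gi: "set_integrable lborel {0<..} (\<lambda>t. gaussian t q * log_riesz_density s t)" if "q \<noteq> 0" for q
    unfolding ge[of _ q] using that by (intro log_riesz_density_gaussian(1)[OF s]) auto
  have gi1: "set_integrable lborel {1<..} (\<lambda>t. gaussian t q * log_riesz_density s t)" if "q \<noteq> 0" for q
    by (rule set_integrable_subset[OF gi[OF that]]) auto
  have trm: "log_riesz_integral s {1<..} (\<lambda>t. exp (- (\<bar>u + of_int v\<bar>^2) * t)) = ereal (I (u + of_int v))" for v :: int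
    using log_riesz_integral_eq[OF gi1[OF ui[of v]]] by (simp add: I_def gaussian_def)
  \<comment> \<open>The distance from u to the nearest integer. The Gaussian at m, times a geometric
    factor in n, dominates all terms for t > 1.\<close>
  define m where "m = min d (1 - d)"
  have m: "0 \<le> m" "m \<le> d" "m \<le> 1 - d" "m > 0" using d by (auto simp: m_def)
  define w where "w t = \<bar>gaussian t m * log_riesz_density s t\<bar>" for t
  have w: "set_integrable lborel {1<..} w"
    unfolding w_def using gi1[of m] m by (intro set_integrable_abs) auto
  have mg [measurable]: "(\<lambda>t. gaussian t q * log_riesz_density s t) \<in> borel_measurable borel" for q
    unfolding gaussian_def by measurable
  have le: "\<bar>gaussian t (real n + y) * log_riesz_density s t\<bar> \<le> exp (- 1) ^ n * w t"
    if "t \<in> {1<..}" "m \<le> y" for n t y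
  proof -
    have "gaussian t (real n + y) \<le> exp (- (m^2 * t)) * exp (- 1) ^ n"
      using that m by (intro gaussian_shift_le) auto
    then have "gaussian t (real n + y) * \<bar>log_riesz_density s t\<bar> \<le> exp (- (m^2 * t)) * exp (- 1) ^ n * \<bar>log_riesz_density s t\<bar>"
      by (rule mult_right_mono) simp
    then show ?thesis by (simp add: w_def abs_mult gaussian_def mult_ac)
  qed
  note dom = dominated_suminf_set_integral[OF _ _ summable_exp_minus_1 w]
  have s1: "summable (\<lambda>n. \<bar>I (real n + d)\<bar>)"
    unfolding I_def by (rule dom(1)) (use le m in auto)
  have s2: "summable (\<lambda>n. \<bar>I (real n + 1 - d)\<bar>)"
    unfolding I_def by (rule dom(1)) (use le[of _ "1 - d"] m in \<open>auto simp: add_diff_eq\<close>)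
  have "((\<lambda>v::int. I (u + of_int v)) has_sum (\<Sum>n. paired_term I (frac u) n)) UNIV"
  proof (rule has_sum_int_paired)
    show "I (- q) = I q" for q by (simp add: I_def)
  qed (use s1 s2 in \<open>auto simp: d_def\<close>)
  then have 1: "(\<Sum>\<^sub>\<infinity>v\<in>(UNIV :: int set). ereal (I (u + of_int v))) = ereal (\<Sum>n. paired_term I d n)"
    unfolding d_def by (intro infsumI has_sum_ereal)
  have "(\<Sum>n. paired_term I d n) = (\<Sum>n. LINT t:{1<..}|lborel. paired_term (gaussian t) d n * log_riesz_density s t)"
  proof (rule suminf_cong)
    fix n
    have "real n + d \<noteq> 0" "real n + 1 - d \<noteq> 0" using d by (auto simp: add_nonneg_eq_0_iff)
    from this[THEN gi1]
    show "paired_term I d n = (LINT t:{1<..}|lborel. paired_term (gaussian t) d n * log_riesz_density s t)"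
      by (simp add: paired_term_def I_def ring_distribs set_integral_add)
  qed
  also have "\<dots> = (LINT t:{1<..}|lborel. (\<Sum>n. paired_term (gaussian t) d n * log_riesz_density s t))"
  proof (rule dominated_suminf_set_integral(2)[symmetric, OF _ _ summable_mult[OF summable_exp_minus_1, of 2] w])
    show "(\<lambda>t. paired_term (gaussian t) d n * log_riesz_density s t) \<in> borel_measurable borel" for n
      unfolding paired_term_def gaussian_def by measurable
    show "\<bar>paired_term (gaussian t) d n * log_riesz_density s t\<bar> \<le> 2 * exp (- 1) ^ n * w t" if t: "t \<in> {1<..}" for n t
    proof -
      have "\<bar>paired_term (gaussian t) d n * log_riesz_density s t\<bar>
         \<le> \<bar>gaussian t (real n + d) * log_riesz_density s t\<bar> + \<bar>gaussian t (real n + (1 - d)) * log_riesz_density s t\<bar>"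
        unfolding paired_term_def ring_distribs add_diff_eq by (rule abs_triangle_ineq)
      then show ?thesis using le[OF t m(2), of n] le[OF t m(3), of n] by linarith
    qed
  qed auto
  also have "\<dots> = (LINT t:{1<..}|lborel. theta d t * log_riesz_density s t)"
    using d by (intro set_lebesgue_integral_cong) (auto simp: theta_def intro!: suminf_mult2[symmetric] summable_paired_gaussian)
  finally show ?thesis
    unfolding trm 1 d_def by simp
qed

text \<open>The frequencies w and - w combine to a cosine, and by Poisson summation the nonzero
  frequencies add up to theta minus \<open>sqrt (pi / t)\<close>, which is \<open>reg_theta\<close>
  for t < 1.\<close>

lemma kernel_dual_sum:
  fixes u s :: real
  assumes s: "s > 0"
  shows "Re (\<Sum>\<^sub>\<infinity>w\<in>UNIV - {0 :: int}.
        exp (2 * of_real pi * \<i> * of_int w * of_real u) *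
        of_real (LINT t:{0<..<1}|lborel.
          sqrt pi / sqrt t * exp (- (pi^2 * (of_int w)^2 / t)) * log_riesz_density s t))
    = (LINT t:{0<..<1}|lborel. reg_theta 0 (frac u) t * log_riesz_density s t)"
proof -
  define d where "d = frac u"
  have d: "d \<in> {0..1}" by (auto simp: d_def frac_lt_1 less_imp_le)
  \<comment> \<open>Extending the majorant by 0 to t \<ge> 1 makes it a function to which
    \<open>mellin_converges_of_decay\<close> applies, and this gives integrability against the
    density.\<close>
  define w where "w t = \<bar>(if t < 1 then t powr (- 1 / 2) * exp (- (1 / t)) else 0) * log_riesz_density s t\<bar>" for t
  have w: "set_integrable lborel {0<..<1} w"
  proof -
    have c: "mellin_converges (\<lambda>t. if t < 1 then t powr (- 1 / 2) * exp (- (1 / t)) else 0) a" for a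
      by (rule mellin_converges_of_decay[where c = 1 and C = 1]) auto
    have "set_integrable lborel {0<..} w"
      unfolding w_def using s
      by (intro set_integrable_abs mellin_has_log_riesz_derivative(1)[OF c[of 0] c[of s]]) auto
    then show ?thesis by (rule set_integrable_subset) auto
  qed
  define J where "J k = (LINT t:{0<..<1}|lborel. sqrt pi / sqrt t * exp (- (pi^2 * k^2 / t)) * log_riesz_density s t)" for k
  have J_even: "J (- k) = J k" for k by (simp add: J_def)
  have le: "\<bar>sqrt pi / sqrt t * exp (- (pi^2 * (real (Suc n))^2 / t)) * log_riesz_density s t\<bar> \<le> sqrt pi * exp (- 1) ^ n * w t"
    if t: "t \<in> {0<..<1}" for n t
  proof -
    have "\<bar>sqrt pi / sqrt t * exp (- (pi^2 * (real (Suc n))^2 / t)) * log_riesz_density s t\<bar>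
      = sqrt pi * t powr (- 1 / 2) * exp (- (pi^2 * (real (Suc n))^2 / t)) * \<bar>log_riesz_density s t\<bar>"
      using t by (simp add: abs_mult powr_minus_divide powr_half_sqrt)
    also have "\<dots> \<le> sqrt pi * t powr (- 1 / 2) * (exp (- (1 / t)) * exp (- 1) ^ n) * \<bar>log_riesz_density s t\<bar>"
      using exp_dual_le[of t n] t by (intro mult_right_mono mult_left_mono) auto
    also have "\<dots> = sqrt pi * exp (- 1) ^ n * w t"
      using t by (simp add: w_def abs_mult)
    finally show ?thesis .
  qed
  have sum_a: "summable (\<lambda>n. sqrt pi * exp (- 1 :: real) ^ n)" by (intro summable_mult summable_exp_minus_1)
  have sJ: "summable (\<lambda>n. \<bar>J (real (Suc n))\<bar>)"
    unfolding J_def by (rule dominated_suminf_set_integral(1)[OF _ _ sum_a w le]) auto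
  define h where "h v = exp (2 * of_real pi * \<i> * of_int v * of_real u) * complex_of_real (J (of_int v))" for v :: int
  have nh: "norm (h v) = \<bar>J (of_int v)\<bar>" for v
    by (simp add: h_def norm_mult norm_exp_eq_Re)
  have "summable (\<lambda>n. norm ((h \<circ> (\<lambda>n. int (Suc n))) n))" "summable (\<lambda>n. norm ((h \<circ> (\<lambda>n. - int (Suc n))) n))"
    using sJ J_even[of "real (Suc _)"] by (simp_all only: o_def nh of_int_minus of_int_of_nat_eq J_even)
  then have "(h has_sum (\<Sum>n. h (int (Suc n)))) (range (\<lambda>n. int (Suc n)))"
      "(h has_sum (\<Sum>n. h (- int (Suc n)))) (range (\<lambda>n. - int (Suc n)))"
    by (auto simp: has_sum_reindex inj_on_def o_def intro!: norm_summable_imp_has_sum summable_sums summable_norm_cancel)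
  then have "(h has_sum ((\<Sum>n. h (int (Suc n))) + (\<Sum>n. h (- int (Suc n))))) (range (\<lambda>n. int (Suc n)) \<union> range (\<lambda>n. - int (Suc n)))"
    by (rule has_sum_Un_disjoint) auto
  also have "range (\<lambda>n. int (Suc n)) \<union> range (\<lambda>n. - int (Suc n)) = UNIV - {0}"
  proof safe
    fix v :: int assume v: "v \<noteq> 0" "v \<notin> range (\<lambda>n. - int (Suc n))"
    then have "v \<noteq> - int (Suc (nat (- v - 1)))" by blast
    then have "v = int (Suc (nat (v - 1)))" using v by linarith
    then show "v \<in> range (\<lambda>n. int (Suc n))" by blast
  qed auto
  finally have inf: "infsum h (UNIV - {0}) = (\<Sum>n. h (int (Suc n))) + (\<Sum>n. h (- int (Suc n)))"
    by (rule infsumI)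
  have re: "Re (infsum h (UNIV - {0})) = (\<Sum>n. Re (h (int (Suc n)))) + (\<Sum>n. Re (h (- int (Suc n))))"
    using \<open>summable (\<lambda>n. norm ((h \<circ> (\<lambda>n. int (Suc n))) n))\<close> \<open>summable (\<lambda>n. norm ((h \<circ> (\<lambda>n. - int (Suc n))) n))\<close>
    by (simp add: inf Re_suminf summable_norm_cancel o_def)
  have cosd: "Re (h (int (Suc n))) = cos (2 * pi * real (Suc n) * d) * J (real (Suc n))"
    "Re (h (- int (Suc n))) = cos (2 * pi * real (Suc n) * d) * J (real (Suc n))" for n
  proof -
    have "2 * pi * real (Suc n) * u = 2 * pi * real (Suc n) * d + of_int (int (Suc n) * \<lfloor>u\<rfloor>) * (2 * pi)"
      by (simp add: d_def frac_def algebra_simps)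
    then have c: "cos (2 * pi * real (Suc n) * u) = cos (2 * pi * real (Suc n) * d)"
      using cos.plus_of_int[of "2 * pi * real (Suc n) * d" "int (Suc n) * \<lfloor>u\<rfloor>"] by simp
    have "Re (h (int (Suc n))) = cos (2 * pi * real (Suc n) * u) * J (real (Suc n))"
      by (simp add: h_def Re_exp mult_ac del: of_nat_Suc)
    then show "Re (h (int (Suc n))) = cos (2 * pi * real (Suc n) * d) * J (real (Suc n))"
      by (simp only: c)
    have "Re (h (- int (Suc n))) = cos (2 * pi * real (Suc n) * u) * J (real (Suc n))"
      by (simp add: h_def Re_exp mult_ac J_even del: of_nat_Suc)
    then show "Re (h (- int (Suc n))) = cos (2 * pi * real (Suc n) * d) * J (real (Suc n))"
      by (simp only: c)
  qed
  have sc: "summable (\<lambda>n. cos (2 * pi * real (Suc n) * d) * J (real (Suc n)))"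
  proof (rule summable_comparison_test'[OF sJ, where N = 0])
    show "norm (cos (2 * pi * real (Suc n) * d) * J (real (Suc n))) \<le> \<bar>J (real (Suc n))\<bar>" for n
      using mult_right_mono[OF abs_cos_le_one[of "2 * pi * real (Suc n) * d"], of "\<bar>J (real (Suc n))\<bar>"]
      by (simp add: abs_mult)
  qed
  have "(\<Sum>n. Re (h (int (Suc n)))) + (\<Sum>n. Re (h (- int (Suc n)))) = 2 * (\<Sum>n. cos (2 * pi * real (Suc n) * d) * J (real (Suc n)))"
    by (simp only: cosd mult_2)
  also have "\<dots> = (\<Sum>n. 2 * (cos (2 * pi * real (Suc n) * d) * J (real (Suc n))))"
    by (rule suminf_mult[OF sc, symmetric])
  also have "\<dots> = (\<Sum>n. LINT t:{0<..<1}|lborel. sqrt pi / sqrt t * (2 * dual_term t d n) * log_riesz_density s t)"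
  proof (rule suminf_cong)
    fix n
    have "2 * (cos (2 * pi * real (Suc n) * d) * J (real (Suc n)))
       = (LINT t:{0<..<1}|lborel. 2 * cos (2 * pi * real (Suc n) * d) * (sqrt pi / sqrt t * exp (- (pi^2 * (real (Suc n))^2 / t)) * log_riesz_density s t))"
      unfolding J_def by (simp only: mult.assoc set_integral_mult_right)
    also have "\<dots> = (LINT t:{0<..<1}|lborel. sqrt pi / sqrt t * (2 * dual_term t d n) * log_riesz_density s t)"
      by (simp add: dual_term_def mult_ac)
    finally show "2 * (cos (2 * pi * real (Suc n) * d) * J (real (Suc n)))
      = (LINT t:{0<..<1}|lborel. sqrt pi / sqrt t * (2 * dual_term t d n) * log_riesz_density s t)" .
  qed
  also have "\<dots> = (LINT t:{0<..<1}|lborel. (\<Sum>n. sqrt pi / sqrt t * (2 * dual_term t d n) * log_riesz_density s t))"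
  proof (rule dominated_suminf_set_integral(2)[symmetric, OF _ _ summable_mult[OF sum_a, of 2] w])
    show "(\<lambda>t. sqrt pi / sqrt t * (2 * dual_term t d n) * log_riesz_density s t) \<in> borel_measurable borel" for n
      unfolding dual_term_def by measurable
    fix n t assume t: "t \<in> {0<..<1::real}"
    have "\<bar>sqrt pi / sqrt t * (2 * dual_term t d n) * log_riesz_density s t\<bar>
      = 2 * (\<bar>cos (2 * pi * real (Suc n) * d)\<bar> * \<bar>sqrt pi / sqrt t * exp (- (pi^2 * (real (Suc n))^2 / t)) * log_riesz_density s t\<bar>)"
      by (simp add: dual_term_def abs_mult mult_ac)
    also have "\<dots> \<le> 2 * (1 * (sqrt pi * exp (- 1) ^ n * w t))"
      by (intro mult_left_mono mult_mono le[OF t]) auto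
    finally show "\<bar>sqrt pi / sqrt t * (2 * dual_term t d n) * log_riesz_density s t\<bar> \<le> 2 * (sqrt pi * exp (- 1) ^ n) * w t"
      by simp
  qed auto
  also have "\<dots> = (LINT t:{0<..<1}|lborel. reg_theta 0 d t * log_riesz_density s t)"
  proof (rule set_lebesgue_integral_cong)
    show "\<forall>t. t \<in> {0<..<1} \<longrightarrow> (\<Sum>n. sqrt pi / sqrt t * (2 * dual_term t d n) * log_riesz_density s t)
        = reg_theta 0 d t * log_riesz_density s t"
    proof (intro allI impI)
      fix t :: real assume t: "t \<in> {0<..<1}"
      have "theta d t = sqrt (pi / t) * (1 + 2 * (\<Sum>n. dual_term t d n))"
        unfolding theta_def using poisson_summation_gaussian[of t d] t d by simp
      then have "reg_theta 0 d t = sqrt pi / sqrt t * (2 * (\<Sum>n. dual_term t d n))"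
      proof -
        have e: "sqrt (pi / t) = sqrt pi / sqrt t" by (rule real_sqrt_divide)
        have "reg_theta 0 d t = theta d t - sqrt pi / sqrt t"
          using t sqrt_pi_div[of t] by (simp add: reg_theta_def e)
        with \<open>theta d t = _\<close> show ?thesis unfolding e by (simp add: ring_distribs)
      qed
      also have "\<dots> = (\<Sum>n. sqrt pi / sqrt t * (2 * dual_term t d n))"
        using t summable_dual_term(2)[of t d] suminf_mult[of "dual_term t d" 2]
          suminf_mult[of "\<lambda>n. 2 * dual_term t d n" "sqrt pi / sqrt t"]
        by (simp only: summable_mult greaterThanLessThan_iff)
      also have "\<dots> * log_riesz_density s t = (\<Sum>n. sqrt pi / sqrt t * (2 * dual_term t d n) * log_riesz_density s t)"
        using summable_dual_term(2)[of t d] t by (intro suminf_mult2 summable_mult) auto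
      finally show "(\<Sum>n. sqrt pi / sqrt t * (2 * dual_term t d n) * log_riesz_density s t)
        = reg_theta 0 d t * log_riesz_density s t" by simp
    qed
  qed simp
  finally show ?thesis
    unfolding re[symmetric] unfolding h_def J_def d_def .
qed

definition periodic_log_riesz :: "real \<Rightarrow> real \<Rightarrow> real" where
  "periodic_log_riesz s d = (LINT t:{0<..}|lborel. reg_theta 0 d t * log_riesz_density s t)"

lemma set_integrable_reg_theta:
  assumes "s > 0" "d \<in> {0<..<1}"
  shows "set_integrable lborel {0<..} (\<lambda>t. reg_theta 0 d t * log_riesz_density s t)"
  using mellin_converges_reg_theta[OF assms(2)] assms(1)
  by (intro mellin_has_log_riesz_derivative(1)[where a = 0 and b = s]) auto

text \<open>The split of the kernel at t = 1 agrees with the truncation of \<open>reg_theta\<close>: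
  the dual sum is its integral over (0, 1), the direct sum its integral over (1,
  \<infinity>).\<close>

lemma log_riesz_kernel_nonint:
  assumes s: "s > 0" and u: "x - y \<notin> \<int>"
  shows "log_riesz_kernel s x y = ereal (periodic_log_riesz s (frac (x - y)))"
proof -
  define d where "d = frac (x - y)"
  have d: "d \<in> {0<..<1}" using u by (auto simp: d_def frac_lt_1 frac_gt_0_iff)
  note int = set_integrable_reg_theta[OF s d]
  have i1: "set_integrable lborel {0<..<1} (\<lambda>t. reg_theta 0 d t * log_riesz_density s t)"
    by (rule set_integrable_subset[OF int]) auto
  have i2: "set_integrable lborel {1<..} (\<lambda>t. reg_theta 0 d t * log_riesz_density s t)"
    by (rule set_integrable_subset[OF int]) auto
  have "periodic_log_riesz s d = (LINT t:{0<..<1} \<union> {1<..}|lborel. reg_theta 0 d t * log_riesz_density s t)"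
    unfolding periodic_log_riesz_def set_lebesgue_integral_def
  proof (intro integral_cong_AE)
    show "AE t in lborel. indicator {0<..} t *\<^sub>R (reg_theta 0 d t * log_riesz_density s t)
        = indicator ({0<..<1} \<union> {1<..}) t *\<^sub>R (reg_theta 0 d t * log_riesz_density s t)"
      using AE_lborel_singleton[of 1] by eventually_elim (auto simp: indicator_def)
  qed measurable
  also have "\<dots> = (LINT t:{0<..<1}|lborel. reg_theta 0 d t * log_riesz_density s t)
      + (LINT t:{1<..}|lborel. reg_theta 0 d t * log_riesz_density s t)"
    by (rule set_integral_Un[OF _ i1 i2]) auto
  also have "(LINT t:{1<..}|lborel. reg_theta 0 d t * log_riesz_density s t)
      = (LINT t:{1<..}|lborel. theta d t * log_riesz_density s t)"
    by (rule set_lebesgue_integral_cong) (auto simp: reg_theta_def)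
  finally show ?thesis
    unfolding log_riesz_kernel_def kernel_direct_sum[OF s u] kernel_dual_sum[OF s] d_def by simp
qed

text \<open>In the extended reals used here, \<infinity> plus - \<infinity> is \<infinity>, so a
  single infinite term decides every finite partial sum that contains it.\<close>

lemma has_sum_infinity_ereal:
  fixes f :: "'a \<Rightarrow> ereal"
  assumes "a \<in> A" "f a = \<infinity>"
  shows "(f has_sum \<infinity>) A"
  unfolding has_sum_def
proof (rule tendsto_eventually)
  have "sum f F = \<infinity>" if "finite F" "{a} \<subseteq> F" "F \<subseteq> A" for F
    using that assms by (subst sum_Pinfty) auto
  then show "\<forall>\<^sub>F F in finite_subsets_at_top A. sum f F = \<infinity>"
    unfolding eventually_finite_subsets_at_top using assms(1) by (intro exI[of _ "{a}"]) auto
qed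

text \<open>For large t the density is at least a constant times 1 / t, so the integral of its
  positive part diverges logarithmically. Its negative part on (1, \<infinity>) lives on a bounded
  interval and has a finite integral.\<close>

lemma log_riesz_integral_const:
  assumes s: "s > 0"
  shows "log_riesz_integral s {1<..} (\<lambda>t. 1) = \<infinity>"
proof -
  define G where "G = Gamma (s / 2)"
  have G: "G > 0" using s by (simp add: G_def Gamma_real_pos)
  \<comment> \<open>Beyond T the factor ln t - \<psi>(s / 2) is at least 1; the maximum with 0
    ensures T > 1.\<close>
  define T where "T = exp (max 0 (Digamma (s / 2)) + 1)"
  have T: "T > 1" by (simp add: T_def)
  have lnT: "ln t - Digamma (s / 2) \<ge> 1" if "t \<ge> T" for t
  proof -
    have "ln t \<ge> ln T" using that T by (subst ln_le_cancel_iff) auto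
    then show ?thesis by (simp add: T_def max_def split: if_splits)
  qed
  have lower: "1 / G * (1 / t) \<le> log_riesz_density s t" if "t \<ge> T" for t
  proof -
    have t: "t > 1" using that T by simp
    have "1 / t = t powr (- 1)" using t by (simp add: powr_minus_divide)
    also have "\<dots> \<le> t powr (s / 2 - 1)" using t s by (intro powr_mono) auto
    also have "\<dots> \<le> t powr (s / 2 - 1) * (ln t - Digamma (s / 2))"
      using lnT[OF that] by (simp add: mult_le_cancel_left1)
    finally have "1 / t / G \<le> t powr (s / 2 - 1) * (ln t - Digamma (s / 2)) / G"
      using G by (intro divide_right_mono) auto
    then show ?thesis by (simp add: log_riesz_density_def G_def mult.commute)
  qed
  have ge: "ennreal (real n / G) \<le> (\<integral>\<^sup>+t\<in>{1<..}. ennreal (1 * log_riesz_density s t) \<partial>lborel)" for n :: nat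
  proof -
    \<comment> \<open>On [T, T e^n] the lower bound 1 / (G t) integrates to exactly n / G.\<close>
    have Tn: "T \<le> T * exp (real n)" using T by simp
    have "(\<integral>\<^sup>+t. ennreal (1 / G * (1 / t)) * indicator {T..T * exp (real n)} t \<partial>lborel)
        = ennreal (1 / G * ln (T * exp (real n)) - 1 / G * ln T)"
    proof (rule nn_integral_FTC_Icc[OF _ _ _ Tn])
      fix t assume "t \<in> {T..T * exp (real n)}"
      then have "t > 0" using T by simp
      then show "((\<lambda>t. 1 / G * ln t) has_real_derivative 1 / G * (1 / t)) (at t)"
        using G by (auto intro!: derivative_eq_intros)
      show "0 \<le> 1 / G * (1 / t)" using G \<open>t > 0\<close> by simp
    qed measurable
    also have "1 / G * ln (T * exp (real n)) - 1 / G * ln T = real n / G"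
      using T by (simp add: ln_mult algebra_simps)
    finally have "ennreal (real n / G) = (\<integral>\<^sup>+t. ennreal (1 / G * (1 / t)) * indicator {T..T * exp (real n)} t \<partial>lborel)" ..
    also have "\<dots> \<le> (\<integral>\<^sup>+t\<in>{1<..}. ennreal (1 * log_riesz_density s t) \<partial>lborel)"
      using T lower by (intro nn_integral_mono) (auto simp: indicator_def intro!: ennreal_leI)
    finally show ?thesis .
  qed
  have top: "(\<integral>\<^sup>+t\<in>{1<..}. ennreal (1 * log_riesz_density s t) \<partial>lborel) = \<infinity>"
  proof (rule ccontr)
    assume "(\<integral>\<^sup>+t\<in>{1<..}. ennreal (1 * log_riesz_density s t) \<partial>lborel) \<noteq> \<infinity>"
    then obtain r where r: "r \<ge> 0" "(\<integral>\<^sup>+t\<in>{1<..}. ennreal (1 * log_riesz_density s t) \<partial>lborel) = ennreal r"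
      by (cases "\<integral>\<^sup>+t\<in>{1<..}. ennreal (1 * log_riesz_density s t) \<partial>lborel") auto
    have "real n / G \<le> r" for n :: nat
      using ge[of n] r G by simp
    moreover obtain n :: nat where "real n > r * G" using reals_Archimedean2 by blast
    ultimately show False using G by (metis divide_le_eq not_less)
  qed
  have "set_integrable lborel {1..T} (\<lambda>t. \<bar>log_riesz_density s t\<bar>)"
    using s G unfolding log_riesz_density_def G_def[symmetric]
    by (intro borel_integrable_atLeastAtMost' continuous_intros) auto
  then have fin: "(\<integral>\<^sup>+t. ennreal (norm (indicator {1..T} t *\<^sub>R \<bar>log_riesz_density s t\<bar>)) \<partial>lborel) < \<infinity>"
    unfolding set_integrable_def by (simp only: integrable_iff_bounded)
  have "(\<integral>\<^sup>+t\<in>{1<..}. ennreal (- (1 * log_riesz_density s t)) \<partial>lborel)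
      \<le> (\<integral>\<^sup>+t. ennreal (norm (indicator {1..T} t *\<^sub>R \<bar>log_riesz_density s t\<bar>)) \<partial>lborel)"
  proof (rule nn_integral_mono)
    fix t :: real
    have "log_riesz_density s t \<ge> 0" if "t \<ge> T"
    proof -
      have "0 \<le> 1 / G * (1 / t)" using G T that by simp
      then show ?thesis using lower[OF that] by linarith
    qed
    then show "ennreal (- (1 * log_riesz_density s t)) * indicator {1<..} t
       \<le> ennreal (norm (indicator {1..T} t *\<^sub>R \<bar>log_riesz_density s t\<bar>))"
      by (cases "t \<ge> T") (auto simp: indicator_def ennreal_neg intro!: ennreal_leI)
  qed
  also note fin
  finally obtain r where "r \<ge> 0" "(\<integral>\<^sup>+t\<in>{1<..}. ennreal (- (1 * log_riesz_density s t)) \<partial>lborel) = ennreal r"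
    by (cases "\<integral>\<^sup>+t\<in>{1<..}. ennreal (- (1 * log_riesz_density s t)) \<partial>lborel") auto
  then show ?thesis
    unfolding log_riesz_integral_def top by simp
qed

lemma log_riesz_kernel_same:
  assumes s: "s > 0"
  shows "log_riesz_kernel s x x = \<infinity>"
proof -
  define f where "f = (\<lambda>v::int. log_riesz_integral s {1<..} (\<lambda>t. exp (- (\<bar>x - x + of_int v\<bar>^2) * t)))"
  have "f 0 = \<infinity>" using log_riesz_integral_const[OF s] by (simp add: f_def)
  then have "infsum f UNIV = \<infinity>"
    by (intro infsumI has_sum_infinity_ereal[of 0]) auto
  then show ?thesis
    unfolding log_riesz_kernel_def f_def by simp
qed

subsection \<open>Convexity of the periodic kernel\<close>

lemma gaussian_antimono:
  assumes "t \<ge> 0" "0 \<le> a" "a \<le> b"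
  shows "gaussian t b \<le> gaussian t a"
proof -
  have "a^2 * t \<le> b^2 * t" using assms by (intro mult_right_mono power_mono) auto
  then show ?thesis by (simp add: gaussian_def)
qed

text \<open>The points \<open>n + a\<close> and \<open>n + b\<close> interlace, so the partial sums are bounded by the total variation
  of the Gaussian, uniformly as \<open>t\<close> tends to 0.\<close>
lemma interlacing_gaussian_sum_bound:
  assumes t: "t \<ge> 0" and m: "0 \<le> m" "m \<le> a" "m \<le> b" and ab: "a \<le> 1" "b \<le> 1"
  shows "\<bar>\<Sum>n<M. gaussian t (real n + a) - gaussian t (real n + b)\<bar> \<le> gaussian t m"
proof -
  have *: "0 \<le> (\<Sum>n<M. gaussian t (real n + a) - gaussian t (real n + b))
      \<and> (\<Sum>n<M. gaussian t (real n + a) - gaussian t (real n + b)) \<le> gaussian t m"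
    if "m \<le> a" "a \<le> b" "b \<le> 1" for a b
  proof
    show "0 \<le> (\<Sum>n<M. gaussian t (real n + a) - gaussian t (real n + b))"
      using that m t by (intro sum_nonneg) (auto intro!: gaussian_antimono)
    \<comment> \<open>Interlacing: n + b \<le> n + 1 + a because b \<le> 1, and replacing b in this
      way makes the sum telescope.\<close>
    have "(\<Sum>n<M. gaussian t (real n + a) - gaussian t (real n + b))
       \<le> (\<Sum>n<M. gaussian t (real n + a) - gaussian t (real (Suc n) + a))"
      using that m t by (intro sum_mono diff_left_mono gaussian_antimono) auto
    also have "\<dots> = gaussian t (real 0 + a) - gaussian t (real M + a)"
      by (rule sum_lessThan_telescope')
    also have "\<dots> \<le> gaussian t a" by simp
    also have "\<dots> \<le> gaussian t m" using that m t by (intro gaussian_antimono) auto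
    finally show "(\<Sum>n<M. gaussian t (real n + a) - gaussian t (real n + b)) \<le> gaussian t m" .
  qed
  show ?thesis
  proof (cases "a \<le> b")
    case True
    then show ?thesis using *[of a b] m ab by auto
  next
    case False
    have "(\<Sum>n<M. gaussian t (real n + a) - gaussian t (real n + b)) = - (\<Sum>n<M. gaussian t (real n + b) - gaussian t (real n + a))"
      by (simp add: sum_subtractf)
    then show ?thesis using *[of b a] m ab False by auto
  qed
qed

text \<open>The counterterm of \<open>reg_theta\<close> does not depend on x and cancels. Taking the
  difference inside the sum matters: it makes the partial sums bounded by 2
  \<open>gaussian t m\<close> for all t and M, with m > 0, and this is integrable against the
  density at both ends.\<close>

lemma periodic_log_riesz_diff_LIMSEQ:
  assumes s: "s > 0" and x: "x \<in> {0<..<1}" and y: "y \<in> {0<..<1}"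
  shows "(\<lambda>M. \<Sum>n<M. paired_term (log_riesz_potential s) x n - paired_term (log_riesz_potential s) y n)
     \<longlonglongrightarrow> periodic_log_riesz s x - periodic_log_riesz s y"
proof -
  define m where "m = min (min x (1 - x)) (min y (1 - y))"
  have m: "0 < m" "m \<le> x" "m \<le> 1 - x" "m \<le> y" "m \<le> 1 - y" using x y by (auto simp: m_def)
  define \<rho> where "\<rho> = log_riesz_density s"
  have [measurable]: "\<rho> \<in> borel_measurable borel" by (simp add: \<rho>_def)
  define D where "D n t = paired_term (gaussian t) x n - paired_term (gaussian t) y n" for n t
  have [measurable]: "D n \<in> borel_measurable borel" for n
    unfolding D_def paired_term_def gaussian_def by measurable
  have ptl: "set_integrable lborel {0<..} (\<lambda>t. paired_term (gaussian t) z n * \<rho> t) \<and>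
      (LINT t:{0<..}|lborel. paired_term (gaussian t) z n * \<rho> t) = paired_term (log_riesz_potential s) z n"
    if "z \<in> {0<..<1}" for z n
  proof -
    have "real n + z > 0" "real n + 1 - z > 0" using that by auto
    note G = this[THEN log_riesz_density_gaussian(1)[OF s]] this[THEN log_riesz_density_gaussian(2)[OF s]]
    show ?thesis
      using set_integral_add[OF G(1,2)] G(3,4) by (simp add: paired_term_def \<rho>_def ring_distribs)
  qed
  have Dint: "set_integrable lborel {0<..} (\<lambda>t. D n t * \<rho> t)"
    "(LINT t:{0<..}|lborel. D n t * \<rho> t) = paired_term (log_riesz_potential s) x n - paired_term (log_riesz_potential s) y n" for n
    using set_integral_diff[OF ptl[OF x, THEN conjunct1] ptl[OF y, THEN conjunct1], of n n] ptl[OF x, of n] ptl[OF y, of n]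
    by (simp_all add: D_def left_diff_distrib)
  have part: "(\<Sum>n<M. paired_term (log_riesz_potential s) x n - paired_term (log_riesz_potential s) y n)
      = (LINT t|lborel. indicator {0<..} t * ((\<Sum>n<M. D n t) * \<rho> t))" for M
  proof -
    have "(LINT t|lborel. indicator {0<..} t * ((\<Sum>n<M. D n t) * \<rho> t)) = (LINT t|lborel. (\<Sum>n<M. indicator {0<..} t *\<^sub>R (D n t * \<rho> t)))"
      by (simp add: sum_distrib_left sum_distrib_right)
    also have "\<dots> = (\<Sum>n<M. LINT t|lborel. indicator {0<..} t *\<^sub>R (D n t * \<rho> t))"
      using Dint(1) by (intro Bochner_Integration.integral_sum) (simp add: set_integrable_def)
    also have "\<dots> = (\<Sum>n<M. LINT t:{0<..}|lborel. D n t * \<rho> t)"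
      unfolding set_lebesgue_integral_def ..
    finally show ?thesis by (simp only: Dint(2))
  qed
  have lim: "periodic_log_riesz s x - periodic_log_riesz s y = (LINT t|lborel. indicator {0<..} t * ((theta x t - theta y t) * \<rho> t))"
  proof -
    have "periodic_log_riesz s x - periodic_log_riesz s y
      = (LINT t:{0<..}|lborel. reg_theta 0 x t * \<rho> t - reg_theta 0 y t * \<rho> t)"
      unfolding periodic_log_riesz_def \<rho>_def
      using set_integrable_reg_theta[OF s x] set_integrable_reg_theta[OF s y] by (rule set_integral_diff(2)[symmetric])
    also have "\<dots> = (LINT t:{0<..}|lborel. (theta x t - theta y t) * \<rho> t)"
      by (simp add: reg_theta_def algebra_simps)
    finally show ?thesis by (simp add: set_lebesgue_integral_def)
  qed
  have iw: "integrable lborel (\<lambda>t. 2 * (indicator {0<..} t * \<bar>gaussian t m * \<rho> t\<bar>))"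
    using set_integrable_abs[OF log_riesz_density_gaussian(1)[OF s m(1)]] by (simp add: set_integrable_def \<rho>_def)
  show ?thesis
    unfolding part lim
  proof (rule integral_dominated_convergence[OF _ _ iw])
    show "AE t in lborel. (\<lambda>M. indicator {0<..} t * ((\<Sum>n<M. D n t) * \<rho> t))
        \<longlonglongrightarrow> indicator {0<..} t * ((theta x t - theta y t) * \<rho> t)"
    proof (rule AE_I2)
      fix t :: real
      show "(\<lambda>M. indicator {0<..} t * ((\<Sum>n<M. D n t) * \<rho> t)) \<longlonglongrightarrow> indicator {0<..} t * ((theta x t - theta y t) * \<rho> t)"
      proof (cases "t > 0")
        case True
        have "(\<lambda>n. D n t) sums (theta x t - theta y t)"
          unfolding D_def theta_def using x y True
          by (intro sums_diff summable_sums summable_paired_gaussian) auto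
        then show ?thesis
          unfolding sums_def by (intro tendsto_mult tendsto_const)
      qed simp
    qed
    show "AE t in lborel. norm (indicator {0<..} t * ((\<Sum>n<M. D n t) * \<rho> t)) \<le> 2 * (indicator {0<..} t * \<bar>gaussian t m * \<rho> t\<bar>)" for M
    proof (rule AE_I2)
      fix t :: real
      show "norm (indicator {0<..} t * ((\<Sum>n<M. D n t) * \<rho> t)) \<le> 2 * (indicator {0<..} t * \<bar>gaussian t m * \<rho> t\<bar>)"
      proof (cases "t > 0")
        case True
        \<comment> \<open>The terms are regrouped into two interlacing sums, one for x against y and
          one for 1 - x against 1 - y.\<close>
        have "(\<Sum>n<M. D n t) = (\<Sum>n<M. gaussian t (real n + x) - gaussian t (real n + y))
            + (\<Sum>n<M. gaussian t (real n + (1 - x)) - gaussian t (real n + (1 - y)))"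
          unfolding D_def paired_term_def sum.distrib[symmetric]
          by (intro sum.cong refl) (simp add: algebra_simps)
        also have "\<bar>\<dots>\<bar> \<le> gaussian t m + gaussian t m"
          using m x y True by (intro order_trans[OF abs_triangle_ineq] add_mono interlacing_gaussian_sum_bound) auto
        finally have "\<bar>\<Sum>n<M. D n t\<bar> * \<bar>\<rho> t\<bar> \<le> 2 * gaussian t m * \<bar>\<rho> t\<bar>"
          by (intro mult_right_mono) auto
        then show ?thesis using True by (simp add: abs_mult)
      qed simp
    qed
  qed measurable
qed

text \<open>A form of Chebyshev's sum inequality: the ratio of \<open>u powr (- a)\<close> to the integral of
  \<open>v powr (- a)\<close> over \<open>[u, u + 1]\<close> decreases in \<open>u\<close> and equals \<open>1 / R\<close> at \<open>u = exp \<kappa>\<close>, where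
  \<open>\<kappa> - ln u\<close> changes sign. Here \<open>G\<close> is an antiderivative of \<open>v powr (- a) * (\<kappa> - ln v)\<close>.\<close>
lemma powr_weight_telescope:
  fixes a u :: real
  assumes a: "a > 1" and u: "u > 0"
  defines "\<kappa> \<equiv> 1 / (a - 1)"
  defines "G \<equiv> \<lambda>v. v powr (1 - a) * ln v / (a - 1)"
  defines "R \<equiv> integral {0..1} (\<lambda>q. (exp \<kappa> / (exp \<kappa> + q)) powr a)"
  shows "G (u + 1) - G u \<le> R * (u powr (- a) * (\<kappa> - ln u))"
proof -
  define p where "p = exp \<kappa>"
  have p: "p > 0" "ln p = \<kappa>" by (auto simp: p_def)
  have R: "((\<lambda>q. (p / (p + q)) powr a) has_integral R) {0..1}"
    unfolding R_def p_def[symmetric]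
    by (intro integrable_integral integrable_continuous_real continuous_intros) (use p in auto)
  have "((\<lambda>q. (u + q) powr (- a) * (\<kappa> - ln (u + q))) has_integral (G (u + 1) - G (u + 0))) {0..1}"
  proof (rule fundamental_theorem_of_calculus)
    fix q :: real assume q: "q \<in> {0..1}"
    have v: "u + q > 0" using q u by simp
    have "((\<lambda>v. v powr (1 - a) * ln v) has_real_derivative
       ((1 - a) * (u + q) powr (1 - a - 1)) * ln (u + q) + (1 / (u + q)) * (u + q) powr (1 - a)) (at (u + q))"
      by (rule DERIV_mult[OF has_real_derivative_powr[OF v] DERIV_ln_divide[OF v]])
    then have "((\<lambda>v. v powr (1 - a) * ln v / (a - 1)) has_real_derivative
       (((1 - a) * (u + q) powr (1 - a - 1)) * ln (u + q) + (1 / (u + q)) * (u + q) powr (1 - a)) / (a - 1)) (at (u + q))"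
      by (rule DERIV_cdivide)
    then have "((\<lambda>q. G (u + q)) has_real_derivative
       (((1 - a) * (u + q) powr (1 - a - 1)) * ln (u + q) + (u + q) powr (1 - a) * (1 / (u + q))) / (a - 1)) (at q)"
      unfolding G_def using DERIV_shift[of "\<lambda>v. v powr (1 - a) * ln v / (a - 1)" _ q u] by (simp add: add.commute mult.commute)
    also have "(((1 - a) * (u + q) powr (1 - a - 1)) * ln (u + q) + (u + q) powr (1 - a) * (1 / (u + q))) / (a - 1)
      = (u + q) powr (- a) * (\<kappa> - ln (u + q))"
    proof -
      have "(u + q) powr (1 - a) * (1 / (u + q)) = (u + q) powr (- a)"
        using v powr_diff[of "u + q" "1 - a" 1] by simp
      then show ?thesis using a by (simp add: \<kappa>_def field_simps)
    qed
    finally show "((\<lambda>q. G (u + q)) has_vector_derivative (u + q) powr (- a) * (\<kappa> - ln (u + q))) (at q within {0..1})"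
      by (simp add: has_real_derivative_iff_has_vector_derivative[symmetric] has_field_derivative_at_within)
  qed simp
  moreover have "((\<lambda>q. (p / (p + q)) powr a * (u powr (- a) * (\<kappa> - ln u))) has_integral (R * (u powr (- a) * (\<kappa> - ln u)))) {0..1}"
    using R by (rule has_integral_mult_left)
  ultimately have "G (u + 1) - G (u + 0) \<le> R * (u powr (- a) * (\<kappa> - ln u))"
  proof (rule has_integral_le)
    fix q :: real assume q: "q \<in> {0..1}"
    have mono: "ln u \<le> ln (u + q)" using q u by (subst ln_le_cancel_iff) auto
    have e1: "(p / (p + q)) powr a * u powr (- a) = (p / ((p + q) * u)) powr a"
    proof -
      have "p / ((p + q) * u) = p / (p + q) * (1 / u)" by simp
      moreover have "(1 / u) powr a = u powr (- a)" using u by (simp add: powr_divide powr_minus_divide)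
      ultimately show ?thesis using p u q by (simp only: powr_mult)
    qed
    have e2: "(u + q) powr (- a) = (1 / (u + q)) powr a"
      using u q by (simp add: powr_divide powr_minus field_simps)
    have "(u + q) powr (- a) * (\<kappa> - ln (u + q)) \<le> (u + q) powr (- a) * (\<kappa> - ln u)"
      using mono by (intro mult_left_mono) auto
    \<comment> \<open>The two weights multiplying \<kappa> - ln u are ordered one way for u \<le> p
      and the other way for u \<ge> p. Since p = exp \<kappa> is also where \<kappa> - ln u changes
      sign, the products compare the same way in both cases.\<close>
    also have "\<dots> \<le> (p / ((p + q) * u)) powr a * (\<kappa> - ln u)"
    proof (cases "u \<le> p")
      case True
      then have "ln u \<le> \<kappa>" using u p by (metis ln_le_cancel_iff)
      moreover have "1 / (u + q) \<le> p / ((p + q) * u)"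
      proof -
        have "(p + q) * u \<le> p * (u + q)" using mult_right_mono[OF True, of q] q by (simp add: algebra_simps)
        then have "p / (p * (u + q)) \<le> p / ((p + q) * u)" using u p q by (intro divide_left_mono) auto
        then show ?thesis using p by simp
      qed
      then have "(1 / (u + q)) powr a \<le> (p / ((p + q) * u)) powr a"
        using a u q by (intro powr_mono2) auto
      ultimately show ?thesis unfolding e2 by (intro mult_right_mono) auto
    next
      case False
      then have "ln u \<ge> \<kappa>" using u p by (metis ln_le_cancel_iff linorder_le_cases)
      moreover have "p / ((p + q) * u) \<le> 1 / (u + q)"
      proof -
        have "p * (u + q) \<le> (p + q) * u" using mult_right_mono[of p u q] False q by (simp add: algebra_simps)
        then have "p / ((p + q) * u) \<le> p / (p * (u + q))" using u p q by (intro divide_left_mono) auto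
        then show ?thesis using p by simp
      qed
      then have "(p / ((p + q) * u)) powr a \<le> (1 / (u + q)) powr a"
        using a u p q by (intro powr_mono2) auto
      ultimately show ?thesis unfolding e2 by (intro mult_right_mono_neg) auto
    qed
    finally show "(u + q) powr (- a) * (\<kappa> - ln (u + q)) \<le> (p / (p + q)) powr a * (u powr (- a) * (\<kappa> - ln u))"
      by (simp add: e1[symmetric] mult.assoc)
  qed
  then show ?thesis by simp
qed

text \<open>The constant 1 / (a - 1) is the one for which the antiderivative G is a multiple of v^(1
  - a) ln v and hence changes sign at 1. Summing \<open>powr_weight_telescope\<close> bounds R times
  the sum from below by G (M + x) - G x, where M + x \<ge> 1 and x \<le> 1.\<close>

lemma powr_weighted_ln_sum_nonneg:
  fixes a x :: real
  assumes a: "a > 1" and x: "0 < x" "x \<le> 1"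
  shows "0 \<le> (\<Sum>n<M. (real n + x) powr (- a) * (1 / (a - 1) - ln (real n + x)))"
proof (cases "M = 0")
  case False
  define \<kappa> where "\<kappa> = 1 / (a - 1)"
  define G where "G v = v powr (1 - a) * ln v / (a - 1)" for v :: real
  define R where "R = integral {0..1} (\<lambda>q. (exp \<kappa> / (exp \<kappa> + q)) powr a)"
  have "R > 0"
  proof -
    \<comment> \<open>The integrand of R is decreasing in q, so its value at q = 1 is a positive
      lower bound.\<close>
    have "(exp \<kappa> / (exp \<kappa> + 1)) powr a = integral {0..1::real} (\<lambda>q. (exp \<kappa> / (exp \<kappa> + 1)) powr a)"
      by simp
    also have "\<dots> \<le> R"
      unfolding R_def
    proof (rule Henstock_Kurzweil_Integration.integral_le)
      show "(\<lambda>q. (exp \<kappa> / (exp \<kappa> + q)) powr a) integrable_on {0..1}"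
        by (intro integrable_continuous_real continuous_intros) (auto simp: add_pos_nonneg less_imp_neq[symmetric])
      show "(exp \<kappa> / (exp \<kappa> + 1)) powr a \<le> (exp \<kappa> / (exp \<kappa> + q)) powr a" if "q \<in> {0..1}" for q :: real
        using that a by (intro powr_mono2 divide_left_mono) (auto simp: add_pos_nonneg)
    qed auto
    finally show ?thesis
      by (rule less_le_trans[rotated]) (simp add: add_pos_pos less_imp_neq[symmetric])
  qed
  have "G (real M + x) \<ge> 0" unfolding G_def using False x a by (intro divide_nonneg_nonneg mult_nonneg_nonneg ln_ge_zero) auto
  moreover have "G (real 0 + x) \<le> 0" unfolding G_def using x a
    by (intro divide_nonpos_nonneg mult_nonneg_nonpos) auto
  ultimately have "0 \<le> G (real M + x) - G (real 0 + x)" by simp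
  also have "\<dots> = (\<Sum>n<M. G (real (Suc n) + x) - G (real n + x))"
    by (rule sum_lessThan_telescope[symmetric])
  also have "\<dots> \<le> (\<Sum>n<M. R * ((real n + x) powr (- a) * (\<kappa> - ln (real n + x))))"
  proof (rule sum_mono)
    fix n
    have eq: "real (Suc n) + x = real n + x + 1" by simp
    show "G (real (Suc n) + x) - G (real n + x) \<le> R * ((real n + x) powr (- a) * (\<kappa> - ln (real n + x)))"
      using powr_weight_telescope[OF a, of "real n + x"] x unfolding G_def R_def \<kappa>_def eq by simp
  qed
  also have "\<dots> = R * (\<Sum>n<M. (real n + x) powr (- a) * (\<kappa> - ln (real n + x)))"
    by (simp add: sum_distrib_left)
  finally show ?thesis using \<open>R > 0\<close> by (simp add: zero_le_mult_iff \<kappa>_def)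
qed simp

lemma log_riesz_potential_derivatives:
  assumes "u > 0"
  shows "(log_riesz_potential s has_real_derivative 2 * u powr (- s - 1) * (s * ln u - 1)) (at u)"
    and "((\<lambda>u. 2 * u powr (- s - 1) * (s * ln u - 1)) has_real_derivative
           2 * u powr (- s - 2) * ((2 * s + 1) - s * (s + 1) * ln u)) (at u)"
proof -
  have e: "(- s - 1) + 1 = - s" "(- s - 2) + 1 = - s - 1" by auto
  have p: "u powr (- s) = u powr (- s - 1) * u" "u powr (- s - 1) = u powr (- s - 2) * u"
    using assms powr_add[of u "- s - 1" 1] powr_add[of u "- s - 2" 1] unfolding e by auto
  have "(log_riesz_potential s has_real_derivative
      - 2 * ((- s) * u powr (- s - 1)) * ln u + (- 2 * u powr (- s)) * (1 / u)) (at u)"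
    unfolding log_riesz_potential_def[abs_def] using assms by (auto intro!: derivative_eq_intros)
  also have "- 2 * ((- s) * u powr (- s - 1)) * ln u + (- 2 * u powr (- s)) * (1 / u) = 2 * u powr (- s - 1) * (s * ln u - 1)"
    using assms by (simp add: p(1) algebra_simps)
  finally show "(log_riesz_potential s has_real_derivative 2 * u powr (- s - 1) * (s * ln u - 1)) (at u)" .
  have "((\<lambda>u. 2 * u powr (- s - 1) * (s * ln u - 1)) has_real_derivative
      2 * ((- s - 1) * u powr (- s - 1 - 1)) * (s * ln u - 1) + 2 * u powr (- s - 1) * (s * (1 / u))) (at u)"
    using assms by (auto intro!: derivative_eq_intros)
  also have "2 * ((- s - 1) * u powr (- s - 1 - 1)) * (s * ln u - 1) + 2 * u powr (- s - 1) * (s * (1 / u))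
      = 2 * u powr (- s - 2) * ((2 * s + 1) - s * (s + 1) * ln u)"
    using assms by (simp add: p(2) algebra_simps)
  finally show "((\<lambda>u. 2 * u powr (- s - 1) * (s * ln u - 1)) has_real_derivative
           2 * u powr (- s - 2) * ((2 * s + 1) - s * (s + 1) * ln u)) (at u)" .
qed

text \<open>The second derivative is a sum of weights with a = s + 2. For that a the critical
  constant is 1 / (s + 1), so s - s (s + 1) ln u would already have a nonnegative weighted sum; the
  actual bracket exceeds it by s + 1.\<close>

lemma convex_on_log_riesz_partial_sum:
  assumes s: "s > 0"
  shows "convex_on {0<..<1} (\<lambda>x. \<Sum>n<M. log_riesz_potential s (real n + x))"
proof (rule f''_ge0_imp_convex)
  fix x :: real assume x: "x \<in> {0<..<1}"
  then have pos: "real n + x > 0" for n by (simp add: add_nonneg_pos)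
  have shift: "((\<lambda>x. f (c + x)) has_real_derivative D) (at x)" if "(f has_real_derivative D) (at (c + x))" for f c D
    using that DERIV_shift[of f D x c] by (simp add: add.commute)
  show "((\<lambda>x. \<Sum>n<M. log_riesz_potential s (real n + x)) has_real_derivative
     (\<Sum>n<M. 2 * (real n + x) powr (- s - 1) * (s * ln (real n + x) - 1))) (at x)"
    by (intro DERIV_sum) (rule shift[OF log_riesz_potential_derivatives(1)[OF pos]])
  show "((\<lambda>x. \<Sum>n<M. 2 * (real n + x) powr (- s - 1) * (s * ln (real n + x) - 1)) has_real_derivative
     (\<Sum>n<M. 2 * (real n + x) powr (- s - 2) * ((2 * s + 1) - s * (s + 1) * ln (real n + x)))) (at x)"
    by (intro DERIV_sum) (rule shift[OF log_riesz_potential_derivatives(2)[OF pos]])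
  \<comment> \<open>The factor s (s + 1) converts 1 / (s + 1) - ln u into s - s (s + 1) ln
    u.\<close>
  have "0 \<le> 2 * (s * (s + 1)) * (\<Sum>n<M. (real n + x) powr (- (s + 2)) * (1 / (s + 2 - 1) - ln (real n + x)))"
    using powr_weighted_ln_sum_nonneg[of "s + 2" x M] s x by (intro mult_nonneg_nonneg) auto
  also have "\<dots> = (\<Sum>n<M. 2 * (real n + x) powr (- s - 2) * (s - s * (s + 1) * ln (real n + x)))"
    unfolding sum_distrib_left using s by (intro sum.cong refl) (simp add: field_simps)
  also have "\<dots> \<le> (\<Sum>n<M. 2 * (real n + x) powr (- s - 2) * ((2 * s + 1) - s * (s + 1) * ln (real n + x)))"
    using s by (intro sum_mono mult_left_mono) auto
  finally show "0 \<le> (\<Sum>n<M. 2 * (real n + x) powr (- s - 2) * ((2 * s + 1) - s * (s + 1) * ln (real n + x)))" .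
qed simp

text \<open>Convexity passes to limits, but the partial sums converge only after subtraction of
  their value at the reference point 1/2. The weights 1 - l and l add up to 1, so this constant
  drops out of the inequality.\<close>

theorem convex_on_periodic_log_riesz:
  assumes s: "s > 0"
  shows "convex_on {0<..<1} (periodic_log_riesz s)"
proof (rule convex_onI)
  fix l x y :: real assume l: "0 < l" "l < 1" and x: "x \<in> {0<..<1}" and y: "y \<in> {0<..<1}"
  define F where "F = periodic_log_riesz s"
  define C where "C M x = (\<Sum>n<M. log_riesz_potential s (real n + x))" for M x
  define P where "P M x = C M x + C M (1 - x)" for M x
  have C: "C M ((1 - l) * x + l * y) \<le> (1 - l) * C M x + l * C M y" if "x \<in> {0<..<1}" "y \<in> {0<..<1}" for M x y
    using convex_onD[OF convex_on_log_riesz_partial_sum[OF s], of l x y M] l that by (simp add: C_def)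
  define z where "z = (1 - l) * x + l * y"
  have z: "z \<in> {0<..<1}"
    using convexD[OF convex_real_interval(8)[of 0 "1::real"] x y, of "1 - l" l] l by (simp add: z_def)
  have "1 - z = (1 - l) * (1 - x) + l * (1 - y)" by (simp add: z_def algebra_simps)
  then have Pz: "P M z \<le> (1 - l) * P M x + l * P M y" for M
    using C[OF x y, of M] C[of "1 - x" "1 - y" M] x y by (simp add: P_def z_def algebra_simps)
  have P: "(\<lambda>M. P M u - P M (1/2)) \<longlonglongrightarrow> F u - F (1/2)" if "u \<in> {0<..<1}" for u
  proof -
    have "(\<Sum>n<M. paired_term (log_riesz_potential s) u n - paired_term (log_riesz_potential s) (1/2) n) = P M u - P M (1/2)" for M
      by (simp add: P_def C_def paired_term_def sum_subtractf sum.distrib sum_distrib_left algebra_simps)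
    then show ?thesis
      using periodic_log_riesz_diff_LIMSEQ[OF s that, of "1/2"] by (simp add: F_def)
  qed
  have "F z - F (1/2) \<le> (1 - l) * (F x - F (1/2)) + l * (F y - F (1/2))"
  proof (rule LIMSEQ_le)
    show "(\<lambda>M. P M z - P M (1/2)) \<longlonglongrightarrow> F z - F (1/2)" by (rule P[OF z])
    show "(\<lambda>M. (1 - l) * (P M x - P M (1/2)) + l * (P M y - P M (1/2))) \<longlonglongrightarrow> (1 - l) * (F x - F (1/2)) + l * (F y - F (1/2))"
      by (intro tendsto_intros P x y)
    show "\<exists>N. \<forall>M\<ge>N. P M z - P M (1/2) \<le> (1 - l) * (P M x - P M (1/2)) + l * (P M y - P M (1/2))"
      using Pz by (auto simp: algebra_simps)
  qed
  then show "periodic_log_riesz s ((1 - l) *\<^sub>R x + l *\<^sub>R y) \<le> (1 - l) * periodic_log_riesz s x + l * periodic_log_riesz s y"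
    by (simp add: F_def z_def algebra_simps)
qed (rule convex_real_interval)

subsection \<open>Equally spaced points minimise the energy\<close>

lemma sum_offdiagonal_swap:
  fixes g :: "nat \<Rightarrow> nat \<Rightarrow> 'a::comm_monoid_add"
  shows "(\<Sum>j<N. \<Sum>k\<in>{..<N} - {j}. g j k) = (\<Sum>k<N. \<Sum>j\<in>{..<N} - {k}. g j k)"
proof -
  have "(\<Sum>j<N. \<Sum>k\<in>{..<N} - {j}. g j k) = (\<Sum>j<N. \<Sum>k<N. if j = k then 0 else g j k)"
    by (intro sum.cong refl sum.mono_neutral_cong_left) auto
  also have "\<dots> = (\<Sum>k<N. \<Sum>j<N. if j = k then 0 else g j k)"
    by (rule sum.swap)
  also have "\<dots> = (\<Sum>k<N. \<Sum>j\<in>{..<N} - {k}. g j k)"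
    by (intro sum.cong refl sum.mono_neutral_cong_right) auto
  finally show ?thesis .
qed

lemma bij_betw_cyclic_shift:
  fixes j N :: nat
  assumes "j < N"
  shows "bij_betw (\<lambda>r. (j + r) mod N) {1..<N} ({..<N} - {j})"
proof (rule bij_betwI[of _ _ _ "\<lambda>i. (i + N - j) mod N"])
  have a: "(j + r) mod N = (if j + r < N then j + r else j + r - N)" if "r < N" for r
    using that assms by (auto simp: mod_if)
  have b: "(i + N - j) mod N = (if i < j then i + N - j else i - j)" if "i < N" for i
    using that assms by (auto simp: mod_if)
  show "(\<lambda>r. (j + r) mod N) \<in> {1..<N} \<rightarrow> {..<N} - {j}"
    using a assms by (auto split: if_splits)
  show "(\<lambda>i. (i + N - j) mod N) \<in> {..<N} - {j} \<rightarrow> {1..<N}"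
    using b assms by (auto split: if_splits)
  show "((j + r) mod N + N - j) mod N = r" if "r \<in> {1..<N}" for r
  proof -
    have "(j + r) mod N < N" using assms by simp
    from b[OF this] show ?thesis using a[of r] that by auto
  qed
  show "(j + (i + N - j) mod N) mod N = i" if "i \<in> {..<N} - {j}" for i
  proof -
    have "(i + N - j) mod N < N" using assms by simp
    from a[OF this] show ?thesis using b[of i] that assms by auto
  qed
qed

text \<open>The lift of a configuration on the circle to the line: passing N indices advances the
  point by 1.\<close>

definition periodic_extension :: "nat \<Rightarrow> (nat \<Rightarrow> real) \<Rightarrow> nat \<Rightarrow> real" where
  "periodic_extension N y m = y (m mod N) + real (m div N)"

context
  fixes N :: nat and y :: "nat \<Rightarrow> real"
  assumes y: "\<And>i. i < N \<Longrightarrow> y i \<in> {0..<1}" and mono: "\<And>i j. i < j \<Longrightarrow> j < N \<Longrightarrow> y i < y j"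
begin

lemma periodic_gap:
  assumes "j < N" "r \<in> {1..<N}"
  shows "periodic_extension N y (j + r) - y j \<in> {0<..<1}"
    and "frac (y ((j + r) mod N) - y j) = periodic_extension N y (j + r) - y j"
proof -
  have r: "0 < r" "r < N" using assms by auto
  show *: "periodic_extension N y (j + r) - y j \<in> {0<..<1}"
  proof (cases "j + r < N")
    case True
    then show ?thesis
      using y[OF True] y[OF assms(1)] mono[of j "j + r"] r by (simp add: periodic_extension_def)
  next
    case False
    then have m: "(j + r) mod N = j + r - N" "(j + r) div N = 1"
      using assms r by (auto simp: mod_if div_if)
    have "j + r - N < j" using False r by simp
    then show ?thesis
      using y[of "j + r - N"] y[OF assms(1)] mono[of "j + r - N" j] assms by (simp add: periodic_extension_def m)
  qed
  show "frac (y ((j + r) mod N) - y j) = periodic_extension N y (j + r) - y j"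
    using * unfolding frac_unique_iff by (simp add: periodic_extension_def)
qed

lemma cyclic_pair_sum:
  "(\<Sum>j<N. \<Sum>k\<in>{..<N} - {j}. F (frac (y j - y k)))
     = (\<Sum>r=1..<N. \<Sum>j<N. F (periodic_extension N y (j + r) - y j) :: real)"
proof -
  \<comment> \<open>The order of summation is exchanged so that the subtracted point is the outer
    index; the other point is then reached from it by r forward steps around the circle.\<close>
  have "(\<Sum>j<N. \<Sum>k\<in>{..<N} - {j}. F (frac (y j - y k))) = (\<Sum>k<N. \<Sum>j\<in>{..<N} - {k}. F (frac (y j - y k)))"
    by (rule sum_offdiagonal_swap)
  also have "\<dots> = (\<Sum>k<N. \<Sum>r=1..<N. F (frac (y ((k + r) mod N) - y k)))"
    using bij_betw_cyclic_shift by (intro sum.cong refl sum.reindex_bij_betw[symmetric]) auto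
  also have "\<dots> = (\<Sum>k<N. \<Sum>r=1..<N. F (periodic_extension N y (k + r) - y k))"
    using periodic_gap(2) by (intro sum.cong refl) auto
  also have "\<dots> = (\<Sum>r=1..<N. \<Sum>k<N. F (periodic_extension N y (k + r) - y k))"
    by (rule sum.swap)
  finally show ?thesis .
qed

text \<open>Increasing r by 1 only shifts the index j, so the change telescopes to one full turn of
  the circle.\<close>

lemma periodic_gap_sum:
  assumes "N > 0"
  shows "(\<Sum>j<N. periodic_extension N y (j + r) - y j) = real r"
proof (induction r)
  case 0
  then show ?case by (simp add: periodic_extension_def)
next
  case (Suc r)
  have "(\<Sum>j<N. periodic_extension N y (j + Suc r) - y j) - (\<Sum>j<N. periodic_extension N y (j + r) - y j)
     = (\<Sum>j<N. periodic_extension N y (Suc j + r) - periodic_extension N y (j + r))"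
    by (simp add: sum_subtractf)
  also have "\<dots> = periodic_extension N y (N + r) - periodic_extension N y (0 + r)"
    by (rule sum_lessThan_telescope)
  also have "\<dots> = 1" using assms by (simp add: periodic_extension_def)
  finally show ?case using Suc by simp
qed

lemma convex_cyclic_pair_sum_ge:
  assumes F: "convex_on {0<..<1} F"
  shows "real N * (\<Sum>r=1..<N. F (real r / real N)) \<le> (\<Sum>j<N. \<Sum>k\<in>{..<N} - {j}. F (frac (y j - y k)))"
proof -
  have "real N * F (real r / real N) \<le> (\<Sum>j<N. F (periodic_extension N y (j + r) - y j))" if r: "r \<in> {1..<N}" for r
  proof -
    have N: "N > 0" using r by auto
    have "F (\<Sum>j<N. (1 / real N) *\<^sub>R (periodic_extension N y (j + r) - y j))
       \<le> (\<Sum>j<N. 1 / real N * F (periodic_extension N y (j + r) - y j))"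
      using N periodic_gap(1)[OF _ r] by (intro convex_on_sum[OF _ _ F]) auto
    also have "(\<Sum>j<N. (1 / real N) *\<^sub>R (periodic_extension N y (j + r) - y j)) = real r / real N"
      using periodic_gap_sum[OF N, of r] by (simp add: sum_divide_distrib[symmetric])
    also have "(\<Sum>j<N. 1 / real N * F (periodic_extension N y (j + r) - y j))
       = 1 / real N * (\<Sum>j<N. F (periodic_extension N y (j + r) - y j))"
      by (rule sum_distrib_left[symmetric])
    finally show ?thesis using N by (simp add: field_simps)
  qed
  then show ?thesis
    unfolding cyclic_pair_sum sum_distrib_left by (rule sum_mono)
qed

end

theorem log_riesz_energy_eq:
  assumes s: "s > 0" and N: "N \<ge> 1"
  shows "log_riesz_energy s N = ereal (real N * (\<Sum>r=1..<N. periodic_log_riesz s (real r / real N)))"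
proof (rule antisym)
  define F where "F = periodic_log_riesz s"
  define E where "E x = (\<Sum>j<N. \<Sum>k\<in>{..<N} - {j}. log_riesz_kernel s (x j) (x k))" for x :: "nat \<Rightarrow> real"
  have E: "log_riesz_energy s N = (INF x\<in>{..<N} \<rightarrow>\<^sub>E {0..<1::real}. E x)"
    by (simp add: log_riesz_energy_def E_def)
  have nonint: "a - b \<notin> \<int>" if "a \<in> {0..<1}" "b \<in> {0..<1}" "a \<noteq> b" for a b :: real
  proof
    assume "a - b \<in> \<int>"
    then obtain n where n: "a - b = of_int n" by (auto elim: Ints_cases)
    then have "\<bar>real_of_int n\<bar> < 1" using that by auto
    then have "n = 0" by linarith
    then show False using n that by simp
  qed
  have inj_E: "E x = ereal (\<Sum>j<N. \<Sum>k\<in>{..<N} - {j}. F (frac (x j - x k)))"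
    if x: "\<And>j. j < N \<Longrightarrow> x j \<in> {0..<1}" and inj: "inj_on x {..<N}" for x
  proof -
    have "E x = (\<Sum>j<N. \<Sum>k\<in>{..<N} - {j}. ereal (F (frac (x j - x k))))"
      unfolding E_def F_def
    proof (intro sum.cong refl log_riesz_kernel_nonint[OF s] nonint)
      fix j k assume jk: "j \<in> {..<N}" "k \<in> {..<N} - {j}"
      show "x j \<in> {0..<1}" by (rule x) (use jk in simp)
      show "x k \<in> {0..<1}" by (rule x) (use jk in simp)
      show "x j \<noteq> x k" using inj_onD[OF inj, of j k] jk by auto
    qed
    then show ?thesis by simp
  qed
  show "log_riesz_energy s N \<le> ereal (real N * (\<Sum>r=1..<N. periodic_log_riesz s (real r / real N)))"
  proof -
    define x where "x = (\<lambda>j\<in>{..<N}. real j / real N)"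
    have x: "x \<in> {..<N} \<rightarrow>\<^sub>E {0..<1::real}" using N by (auto simp: x_def)
    have xr: "\<And>j. j < N \<Longrightarrow> x j \<in> {0..<1}" by (rule PiE_mem[OF x]) simp
    have mono: "x i < x j" if "i < j" "j < N" for i j using that by (simp add: x_def divide_strict_right_mono)
    have inj: "inj_on x {..<N}"
    proof (rule inj_onI)
      fix i j assume "i \<in> {..<N}" "j \<in> {..<N}" "x i = x j"
      then show "i = j" using mono[of i j] mono[of j i] by (cases i j rule: linorder_cases) auto
    qed
    have gap: "periodic_extension N x (j + r) - x j = real r / real N" if "j < N" for j r
    proof -
      have "periodic_extension N x (j + r) = real ((j + r) mod N) / real N + real ((j + r) div N)"
        using N by (simp add: periodic_extension_def x_def)
      also have "\<dots> = real ((j + r) mod N + ((j + r) div N) * N) / real N"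
      proof -
        have "real N \<noteq> 0" using N by simp
        then show ?thesis by (simp only: of_nat_add of_nat_mult add_divide_distrib) simp
      qed
      also have "(j + r) mod N + ((j + r) div N) * N = j + r" by simp
      finally have "periodic_extension N x (j + r) = real (j + r) / real N" .
      moreover have "x j = real j / real N" using that by (simp add: x_def)
      ultimately show ?thesis by (simp add: add_divide_distrib)
    qed
    have "log_riesz_energy s N \<le> E x"
      unfolding E by (rule INF_lower[OF x])
    also have "E x = ereal (\<Sum>r=1..<N. \<Sum>j<N. F (periodic_extension N x (j + r) - x j))"
      using inj_E[OF xr inj] cyclic_pair_sum[of N x F, OF xr mono] by simp
    also have "\<dots> = ereal (real N * (\<Sum>r=1..<N. F (real r / real N)))"
      by (simp add: gap sum_distrib_left)
    finally show ?thesis unfolding F_def .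
  qed
  show "ereal (real N * (\<Sum>r=1..<N. periodic_log_riesz s (real r / real N))) \<le> log_riesz_energy s N"
    unfolding E
  proof (rule INF_greatest)
    fix x :: "nat \<Rightarrow> real" assume "x \<in> {..<N} \<rightarrow>\<^sub>E {0..<1}"
    then have x: "\<And>j. j < N \<Longrightarrow> x j \<in> {0..<1}" by (rule PiE_mem) simp
    show "ereal (real N * (\<Sum>r=1..<N. periodic_log_riesz s (real r / real N))) \<le> E x"
    proof (cases "inj_on x {..<N}")
      case True
      define S where "S = x ` {..<N}"
      have S: "finite S" "card S = N" "S \<subseteq> {0..<1}"
        using x True by (auto simp: S_def card_image)
      define y where "y i = sorted_list_of_set S ! i" for i
      have len: "length (sorted_list_of_set S) = N" using S by simp
      have sorted: "sorted_wrt (<) (sorted_list_of_set S)" by simp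
      have mono: "y i < y j" if "i < j" "j < N" for i j
        using sorted_wrt_nth_less[OF sorted that(1)] that len by (simp add: y_def)
      have bij: "bij_betw y {..<N} S"
        unfolding y_def using bij_betw_nth[of "sorted_list_of_set S" "{..<N}" S] S len by simp
      have y: "y i \<in> {0..<1}" if "i < N" for i
        using bij that S(3) by (auto simp: bij_betw_def)
      have bijx: "bij_betw x {..<N} S" using True by (simp add: bij_betw_def S_def)
      \<comment> \<open>The double sum depends only on the set of points, so the increasing
        enumeration y may replace x.\<close>
      have pairs: "(\<Sum>j<N. \<Sum>k\<in>{..<N} - {j}. F (frac (z j - z k))) = (\<Sum>a\<in>S. \<Sum>b\<in>S - {a}. F (frac (a - b)))"
        if z: "bij_betw z {..<N} S" for z
      proof -
        have "(\<Sum>a\<in>S. \<Sum>b\<in>S - {a}. F (frac (a - b))) = (\<Sum>j<N. \<Sum>b\<in>S - {z j}. F (frac (z j - b)))"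
          by (rule sum.reindex_bij_betw[OF z, symmetric])
        also have "\<dots> = (\<Sum>j<N. \<Sum>k\<in>{..<N} - {j}. F (frac (z j - z k)))"
        proof (rule sum.cong[OF refl])
          fix j assume j: "j \<in> {..<N}"
          have "bij_betw z ({..<N} - {j}) (S - {z j})"
            using bij_betw_DiffI[OF z, of "{j}" "{z j}"] bij_betwE[OF z] j by (simp add: bij_betw_def)
          then show "(\<Sum>b\<in>S - {z j}. F (frac (z j - b))) = (\<Sum>k\<in>{..<N} - {j}. F (frac (z j - z k)))"
            by (rule sum.reindex_bij_betw[symmetric])
        qed
        finally show ?thesis ..
      qed
      have "real N * (\<Sum>r=1..<N. F (real r / real N)) \<le> (\<Sum>j<N. \<Sum>k\<in>{..<N} - {j}. F (frac (y j - y k)))"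
        unfolding F_def by (rule convex_cyclic_pair_sum_ge[OF y mono convex_on_periodic_log_riesz[OF s]])
      also have "\<dots> = (\<Sum>j<N. \<Sum>k\<in>{..<N} - {j}. F (frac (x j - x k)))"
        unfolding pairs[OF bij] pairs[OF bijx] ..
      finally show ?thesis
        using inj_E[OF x True] by (simp add: F_def)
    next
      case False
      then obtain j k where jk: "j < N" "k < N" "j \<noteq> k" "x j = x k"
        by (auto simp: inj_on_def)
      \<comment> \<open>Two coincident points give a kernel value \<infinity>, and one such term
        makes the whole sum \<infinity>, whatever the others are.\<close>
      have "(\<Sum>k\<in>{..<N} - {j}. log_riesz_kernel s (x j) (x k)) = \<infinity>"
        using jk log_riesz_kernel_same[OF s, of "x j"] by (subst sum_Pinfty) (auto intro!: bexI[of _ k])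
      then have "E x = \<infinity>"
        unfolding E_def using jk(1) by (subst sum_Pinfty) (auto intro!: bexI[of _ j])
      then show ?thesis by simp
    qed
  qed
qed

subsection \<open>The zeta function near its pole\<close>

lemma has_vector_derivative_exp_mult_ln:
  fixes w :: complex
  assumes "x > 0"
  shows "((\<lambda>t. exp (w * of_real (ln t))) has_vector_derivative w * exp ((w - 1) * of_real (ln x))) (at x)"
proof (cases "w = 0")
  case False
  from has_vector_derivative_mult_right[OF has_vector_derivative_exp_ln[OF assms False], of w]
  show ?thesis using False by simp
qed simp

lemma norm_increment_le:
  fixes f :: "real \<Rightarrow> complex"
  assumes ab: "a \<le> b" and f: "\<And>x. x \<in> {a..b} \<Longrightarrow> (f has_vector_derivative f' x) (at x)"
    and B: "\<And>x. x \<in> {a..b} \<Longrightarrow> norm (f' x) \<le> B"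
  shows "norm (f b - f a) \<le> B * (b - a)"
proof (cases "a = b")
  case False
  then have "a < b" using ab by simp
  then have "norm (f b - f a) \<le> B * b - B * a"
  proof (rule differentiable_bound_general)
    show "continuous_on {a..b} f"
      using f by (meson continuous_at_imp_continuous_on has_vector_derivative_continuous)
    show "continuous_on {a..b} (\<lambda>x. B * x)" by (intro continuous_intros)
    show "((\<lambda>x. B * x) has_vector_derivative B) (at x)" for x
      by (auto intro!: derivative_eq_intros simp: has_real_derivative_iff_has_vector_derivative[symmetric])
    show "(f has_vector_derivative f' x) (at x)" "norm (f' x) \<le> B" if "a < x" "x < b" for x
      using that by (auto intro!: f B)
  qed
  then show ?thesis by (simp add: algebra_simps)
qed simp

text \<open>With m = n + 1 this is s - 1 times the difference between m^(-s) and the integral of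
  x^(-s) over [m, m + 1], with the integral evaluated so that nothing is singular at s = 1.\<close>

definition zeta_increment :: "nat \<Rightarrow> complex \<Rightarrow> complex" where
  "zeta_increment n s = (s - 1) * exp (- s * of_real (ln (real (Suc n))))
     + exp ((1 - s) * of_real (ln (real (Suc (Suc n))))) - exp ((1 - s) * of_real (ln (real (Suc n))))"

text \<open>The mean value inequality is used twice, once for x^(-s) over a unit interval and once
  for a function whose derivative is a multiple of that increment; this gains the extra power of m
  that makes the series converge for Re s > 0.\<close>

lemma norm_zeta_increment_le:
  assumes s: "Re s > 0"
  shows "norm (zeta_increment n s) \<le> norm (s - 1) * norm s * real (Suc n) powr (- Re s - 1)"
proof -
  define m where "m = real (Suc n)"
  have m: "m \<ge> 1" by (simp add: m_def)
  have 1: "norm (exp (- s * of_real (ln x)) - exp (- s * of_real (ln m))) \<le> norm s * m powr (- Re s - 1)"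
    if x: "x \<in> {m..m + 1}" for x
  proof -
    have "norm (exp (- s * of_real (ln x)) - exp (- s * of_real (ln m))) \<le> norm s * m powr (- Re s - 1) * (x - m)"
    proof (rule norm_increment_le)
      fix y assume y: "y \<in> {m..x}"
      show "((\<lambda>x. exp (- s * of_real (ln x))) has_vector_derivative - s * exp ((- s - 1) * of_real (ln y))) (at y)"
        using y m by (intro has_vector_derivative_exp_mult_ln) auto
      have "norm (exp ((- s - 1) * of_real (ln y))) = y powr (- Re s - 1)"
        using y m exp_of_real_ln(1)[of y "- s"] by simp
      also have "\<dots> \<le> m powr (- Re s - 1)"
        using y m s by (intro powr_mono2') auto
      finally show "norm (- s * exp ((- s - 1) * of_real (ln y))) \<le> norm s * m powr (- Re s - 1)"
        unfolding norm_mult norm_minus_cancel by (rule mult_left_mono) simp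
    qed (use x in auto)
    also have "\<dots> \<le> norm s * m powr (- Re s - 1) * 1"
      using x by (intro mult_left_mono) auto
    finally show ?thesis by simp
  qed
  \<comment> \<open>Its increment over [m, m + 1] is \<open>zeta_increment n s\<close>, and its
    derivative is s - 1 times m^(-s) - x^(-s).\<close>
  define f where "f x = (s - 1) * exp (- s * of_real (ln m)) * of_real x + exp ((1 - s) * of_real (ln x))" for x :: real
  have "norm (f (m + 1) - f m) \<le> norm (s - 1) * (norm s * m powr (- Re s - 1)) * (m + 1 - m)"
  proof (rule norm_increment_le)
    fix x assume x: "x \<in> {m..m + 1}"
    show "(f has_vector_derivative (s - 1) * exp (- s * of_real (ln m)) * of_real 1 + (1 - s) * exp ((1 - s - 1) * of_real (ln x))) (at x)"
      unfolding f_def using x m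
      by (intro has_vector_derivative_add has_vector_derivative_mult_right has_vector_derivative_of_real
          has_vector_derivative_exp_mult_ln) (auto intro: DERIV_ident)
    have "(s - 1) * exp (- s * of_real (ln m)) * of_real 1 + (1 - s) * exp ((1 - s - 1) * of_real (ln x))
      = - (s - 1) * (exp (- s * of_real (ln x)) - exp (- s * of_real (ln m)))"
      by (simp add: algebra_simps)
    then show "norm ((s - 1) * exp (- s * of_real (ln m)) * of_real 1 + (1 - s) * exp ((1 - s - 1) * of_real (ln x)))
      \<le> norm (s - 1) * (norm s * m powr (- Re s - 1))"
      using 1[OF x] by (simp only: norm_mult norm_minus_cancel) (intro mult_left_mono, auto)
  qed simp
  moreover have "f (m + 1) - f m = zeta_increment n s"
    by (simp add: f_def zeta_increment_def m_def algebra_simps)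
  ultimately show ?thesis by (simp add: m_def mult.assoc)
qed

text \<open>The function \<open>(s - 1) zeta s\<close> on a neighbourhood of 1, where it has a removable singularity.\<close>
definition zeta_regular :: "complex \<Rightarrow> complex" where
  "zeta_regular s = 1 + (\<Sum>n. zeta_increment n s)"

text \<open>The telescoped partial sums of \<open>zeta_regular\<close>; the constant 1 there is m^(1
  - s) at m = 1.\<close>

definition zeta_partial :: "nat \<Rightarrow> complex \<Rightarrow> complex" where
  "zeta_partial M s = (s - 1) * (\<Sum>n<M. exp (- s * of_real (ln (real (Suc n))))) + exp ((1 - s) * of_real (ln (real (Suc M))))"

lemma zeta_partial_eq: "zeta_partial M s = 1 + (\<Sum>n<M. zeta_increment n s)"
  by (induction M) (simp_all add: zeta_partial_def zeta_increment_def algebra_simps del: of_nat_Suc, simp)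

lemma uniform_limit_zeta_partial:
  "uniform_limit (ball 1 (1/2)) zeta_partial zeta_regular sequentially"
proof -
  have "uniform_limit (ball 1 (1/2)) (\<lambda>M s. \<Sum>n<M. zeta_increment n s) (\<lambda>s. \<Sum>n. zeta_increment n s) sequentially"
  proof (rule Weierstrass_m_test)
    fix n and s :: complex assume s: "s \<in> ball 1 (1/2)"
    then have n1: "norm (s - 1) < 1/2" by (simp add: dist_norm norm_minus_commute)
    have "\<bar>Re (s - 1)\<bar> \<le> norm (s - 1)" by (rule abs_Re_le_cmod)
    then have re: "Re s > 1/2" using n1 by simp
    have "norm s \<le> norm (s - 1) + norm (1 :: complex)" using norm_triangle_ineq[of "s - 1" 1] by simp
    then have ns: "norm s \<le> 2" using n1 by simp
    have "norm (zeta_increment n s) \<le> norm (s - 1) * norm s * real (Suc n) powr (- Re s - 1)"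
      using re by (intro norm_zeta_increment_le) simp
    also have "\<dots> \<le> (1/2 * 2) * real (Suc n) powr (- 3 / 2)"
      using n1 ns re by (intro mult_mono powr_mono) auto
    finally show "norm (zeta_increment n s) \<le> real (Suc n) powr (- 3 / 2)" by simp
  next
    show "summable (\<lambda>n. real (Suc n) powr (- 3 / 2))"
      using summable_Suc_powr[of "3 / 2"] by simp
  qed
  then have "uniform_limit (ball 1 (1/2)) (\<lambda>M s. 1 + (\<Sum>n<M. zeta_increment n s)) (\<lambda>s. 1 + (\<Sum>n. zeta_increment n s)) sequentially"
    by (intro uniform_limit_intros)
  then show ?thesis
    by (simp add: zeta_partial_eq[abs_def] zeta_regular_def[abs_def])
qed

lemma zeta_partial_holomorphic: "zeta_partial M holomorphic_on A"
  unfolding zeta_partial_def by (intro holomorphic_intros)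

lemma zeta_regular_holomorphic: "zeta_regular holomorphic_on ball 1 (1/2)"
proof (rule holomorphic_uniform_sequence)
  show "\<exists>d>0. cball x d \<subseteq> ball 1 (1/2) \<and> uniform_limit (cball x d) zeta_partial zeta_regular sequentially"
    if x: "x \<in> ball 1 (1/2)" for x :: complex
  proof -
    obtain d where "d > 0" "cball x d \<subseteq> ball 1 (1/2)"
      using x by (meson open_ball open_contains_cball)
    then show ?thesis using uniform_limit_on_subset[OF uniform_limit_zeta_partial] by blast
  qed
qed (auto intro: zeta_partial_holomorphic)

text \<open>For Re s > 1 the boundary term of \<open>zeta_partial\<close> tends to 0 and the
  Dirichlet series remains; the identity theorem does the rest on the punctured disc.\<close>

lemma zeta_regular_eq:
  assumes "s \<in> ball 1 (1/2)" "s \<noteq> 1"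
  shows "zeta_regular s = (s - 1) * zeta s"
proof (rule analytic_continuation_open[of "ball 1 (1/2) \<inter> {s. Re s > 1}" "ball 1 (1/2) - {1}" zeta_regular "\<lambda>s. (s - 1) * zeta s"])
  show "open (ball 1 (1/2) \<inter> {s. Re s > 1})" by (intro open_Int open_halfspace_Re_gt open_ball)
  have "5 / 4 \<in> ball 1 (1/2) \<inter> {s. Re s > 1}" by (simp add: dist_norm)
  then show "ball 1 (1/2) \<inter> {s. Re s > 1} \<noteq> {}" by blast
  show "connected (ball (1 :: complex) (1/2) - {1})"
    by (intro connected_open_delete) auto
  show "zeta_regular holomorphic_on ball 1 (1/2) - {1}"
    by (rule holomorphic_on_subset[OF zeta_regular_holomorphic]) auto
  show "(\<lambda>s. (s - 1) * zeta s) holomorphic_on ball 1 (1/2) - {1}"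
    by (intro holomorphic_intros holomorphic_on_subset[OF zeta_holomorphic]) auto
  fix z assume z: "z \<in> ball 1 (1/2) \<inter> {s. Re s > 1}"
  have "(\<lambda>M. zeta_partial M z) \<longlonglongrightarrow> zeta_regular z"
    using tendsto_uniform_limitI[OF uniform_limit_zeta_partial, of z] z by simp
  moreover have "(\<lambda>M. zeta_partial M z) \<longlonglongrightarrow> (z - 1) * zeta z + 0"
    unfolding zeta_partial_def
  proof (intro tendsto_add tendsto_mult tendsto_const)
    have "summable (\<lambda>n. (of_nat (Suc n) :: complex) powr (- z))"
      using z by (intro summable_dirichlet_series) auto
    then show "(\<lambda>M. \<Sum>n<M. exp (- z * of_real (ln (real (Suc n))))) \<longlonglongrightarrow> zeta z"
      unfolding exp_of_nat_powr using zeta_eq_series[of z] z summable_LIMSEQ by auto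
    show "(\<lambda>M. exp ((1 - z) * of_real (ln (real (Suc M))))) \<longlonglongrightarrow> 0"
    proof (rule tendsto_norm_zero_cancel)
      have "norm (exp ((1 - z) * of_real (ln (real (Suc M))))) = real (Suc M) powr (1 - Re z)" for M
        by (simp add: powr_def del: of_nat_Suc)
      moreover have "(\<lambda>M. real (Suc M) powr (1 - Re z)) \<longlonglongrightarrow> 0"
        using z by (intro tendsto_neg_powr filterlim_compose[OF filterlim_real_sequentially filterlim_Suc]) auto
      ultimately show "(\<lambda>M. norm (exp ((1 - z) * of_real (ln (real (Suc M)))))) \<longlonglongrightarrow> 0"
        by simp
    qed
  qed
  ultimately show "zeta_regular z = (z - 1) * zeta z"
    using LIMSEQ_unique by fastforce
qed (use assms in auto)

lemma zeta_partial_derivs: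
  shows "deriv (zeta_partial M) 1 = of_real (harm M - ln (real (Suc M)))"
    and "deriv (deriv (zeta_partial M)) 1
       = of_real (- 2 * (\<Sum>n<M. ln (real (Suc n)) / real (Suc n)) + (ln (real (Suc M)))^2)"
proof -
  define l where "l n = complex_of_real (ln (real (Suc n)))" for n
  define D where "D s = (\<Sum>n<M. exp (- s * l n)) + (s - 1) * (\<Sum>n<M. - l n * exp (- s * l n)) - l M * exp ((1 - s) * l M)" for s
  have d1: "(zeta_partial M has_field_derivative D s) (at s)" for s
    unfolding zeta_partial_def[abs_def] D_def l_def[symmetric]
    by (rule derivative_eq_intros refl | simp add: mult_ac)+
  then have D: "deriv (zeta_partial M) = D" by (auto intro!: DERIV_imp_deriv)
  have d2: "(D has_field_derivative ((\<Sum>n<M. - l n * exp (- s * l n)) + ((\<Sum>n<M. - l n * exp (- s * l n))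
      + (s - 1) * (\<Sum>n<M. l n * l n * exp (- s * l n))) + l M * l M * exp ((1 - s) * l M))) (at s)" for s
    unfolding D_def[abs_def]
    by (rule derivative_eq_intros refl | simp add: mult_ac)+
  have e: "exp (- 1 * l n) = of_real (1 / real (Suc n))" for n
    by (simp add: l_def exp_minus exp_of_real inverse_eq_divide del: of_nat_Suc)
  have "harm M = (\<Sum>n<M. 1 / real (Suc n))"
    unfolding harm_def by (simp add: sum.atLeast1_atMost_eq inverse_eq_divide)
  then show "deriv (zeta_partial M) 1 = of_real (harm M - ln (real (Suc M)))"
    unfolding D D_def e by (simp add: l_def)
  show "deriv (deriv (zeta_partial M)) 1
       = of_real (- 2 * (\<Sum>n<M. ln (real (Suc n)) / real (Suc n)) + (ln (real (Suc M)))^2)"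
    unfolding D DERIV_imp_deriv[OF d2] e
    by (simp add: l_def power2_eq_square sum_negf)
qed

text \<open>Uniform convergence of holomorphic functions carries over to all derivatives at 1. This
  identifies the values and also proves that \<open>gamma1_seq\<close> converges, so that
  \<open>lim\<close> in \<open>gamma1\<close> is meaningful.\<close>

lemma zeta_regular_derivs:
  shows "zeta_regular 1 = 1" "deriv zeta_regular 1 = of_real euler_mascheroni"
    and "gamma1_seq \<longlonglongrightarrow> gamma1" "deriv (deriv zeta_regular) 1 = of_real (- 2 * gamma1)"
proof -
  have "zeta_increment n 1 = 0" for n by (simp add: zeta_increment_def)
  then show "zeta_regular 1 = 1" by (simp add: zeta_regular_def)
  have lim: "(\<lambda>M. (deriv ^^ m) (zeta_partial M) 1) \<longlonglongrightarrow> (deriv ^^ m) zeta_regular 1" for m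
    by (rule higher_deriv_complex_uniform_limit[OF uniform_limit_zeta_partial])
       (auto intro!: always_eventually zeta_partial_holomorphic)
  \<comment> \<open>The logarithm is taken at M + 1 while the harmonic sum stops at M; the missing
    term 1 / (M + 1) tends to 0.\<close>
  have "(\<lambda>M. harm (Suc M) - ln (real (Suc M)) - 1 / real (Suc M)) \<longlonglongrightarrow> euler_mascheroni - 0"
    by (intro tendsto_diff LIMSEQ_Suc[OF euler_mascheroni_LIMSEQ] LIMSEQ_Suc[OF lim_1_over_n])
  then have "(\<lambda>M. harm M - ln (real (Suc M))) \<longlonglongrightarrow> euler_mascheroni"
    by (simp add: harm_Suc inverse_eq_divide algebra_simps del: of_nat_Suc)
  then have "(\<lambda>M. complex_of_real (harm M - ln (real (Suc M)))) \<longlonglongrightarrow> of_real euler_mascheroni"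
    by (rule tendsto_of_real)
  then show "deriv zeta_regular 1 = of_real euler_mascheroni"
    using lim[of 1] LIMSEQ_unique by (fastforce simp: zeta_partial_derivs(1))
  define c where "c = deriv (deriv zeta_regular) 1"
  define d where "d M = - 2 * (\<Sum>n<M. ln (real (Suc n)) / real (Suc n)) + (ln (real (Suc M)))^2" for M
  have dc: "(\<lambda>M. complex_of_real (d M)) \<longlonglongrightarrow> c"
    using lim[of 2] by (simp add: numeral_2_eq_2 zeta_partial_derivs(2) c_def d_def)
  \<comment> \<open>The same shift by one: \<open>gamma1_seq (Suc M)\<close> contains the summand
    with k = M + 1, which d M lacks.\<close>
  have g: "gamma1_seq (Suc M) = ln (real (Suc M)) / real (Suc M) - d M / 2" for M
    unfolding gamma1_seq_def d_def by (simp add: sum.atLeast1_atMost_eq algebra_simps add_divide_distrib diff_divide_distrib)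
  have "d \<longlonglongrightarrow> Re c" using tendsto_Re[OF dc] by simp
  moreover have "(\<lambda>M. ln (real (Suc M)) / real (Suc M)) \<longlonglongrightarrow> 0"
    by (rule LIMSEQ_Suc[OF lim_ln_over_n])
  ultimately have "(\<lambda>M. gamma1_seq (Suc M)) \<longlonglongrightarrow> 0 - Re c / 2"
    unfolding g by (intro tendsto_intros) auto
  then have "(\<lambda>M. gamma1_seq (Suc M)) \<longlonglongrightarrow> - Re c / 2" by simp
  then have gl: "gamma1_seq \<longlonglongrightarrow> - Re c / 2" by (rule LIMSEQ_imp_Suc)
  then have g1: "gamma1 = - Re c / 2" unfolding gamma1_def by (rule limI)
  show "gamma1_seq \<longlonglongrightarrow> gamma1" unfolding g1 by (rule gl)
  have "c = of_real (Re c)"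
    using LIMSEQ_unique[OF dc tendsto_of_real[OF \<open>d \<longlonglongrightarrow> Re c\<close>]] .
  then show "deriv (deriv zeta_regular) 1 = of_real (- 2 * gamma1)"
    unfolding g1 c_def[symmetric] by simp
qed

text \<open>Dividing by z shifts the coefficients by one, so the coefficient in question is half of
  the second derivative of \<open>zeta_regular\<close> at 1.\<close>

lemma zeta_laurent_expansion:
  "\<exists>F. (\<lambda>z. zeta (1 + z)) has_laurent_expansion F \<and> fls_nth F 1 = - of_real gamma1"
proof -
  define G where "G = fps_expansion zeta_regular 1"
  have "zeta_regular analytic_on {1}"
    using zeta_regular_holomorphic by (auto simp: analytic_at intro!: exI[of _ "ball 1 (1/2)"])
  then have G: "(\<lambda>z. zeta_regular (1 + z)) has_fps_expansion G"
    unfolding G_def by (rule analytic_at_imp_has_fps_expansion)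
  have "(\<lambda>z. zeta_regular (1 + z) * inverse z) has_laurent_expansion fps_to_fls G * inverse fls_X"
    by (intro laurent_expansion_intros has_laurent_expansion_fps G)
  also have "?this \<longleftrightarrow> (\<lambda>z. zeta (1 + z)) has_laurent_expansion fps_to_fls G * inverse fls_X"
  proof (rule has_laurent_expansion_cong)
    have "eventually (\<lambda>z. z \<in> ball 0 (1/2) - {0}) (at (0 :: complex))"
      by (rule eventually_at_in_open) auto
    then show "eventually (\<lambda>z. zeta_regular (1 + z) * inverse z = zeta (1 + z)) (at 0)"
    proof eventually_elim
      case (elim z)
      then have "zeta_regular (1 + z) = (1 + z - 1) * zeta (1 + z)"
        by (intro zeta_regular_eq) (auto simp: dist_norm)
      then show ?case using elim by simp
    qed
  qed simp
  finally have "(\<lambda>z. zeta (1 + z)) has_laurent_expansion fps_to_fls G * inverse fls_X" .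
  moreover have "fls_nth (fps_to_fls G * inverse fls_X) 1 = fps_nth G 2"
    by (simp add: fls_inverse_X fls_X_inv_times_conv_shift)
  moreover have "fps_nth G 2 = - of_real gamma1"
    by (simp add: G_def fps_expansion_def numeral_2_eq_2 zeta_regular_derivs(4))
  ultimately show ?thesis by auto
qed

subsection \<open>The energy of equally spaced points\<close>

lemma gaussian_divide:
  "gaussian t (u / c) = gaussian (t / c^2) u"
  by (simp add: gaussian_def power_divide)

text \<open>The points r / N + v run through all multiples of 1 / N once, and the scale 1 / N is
  absorbed into t.\<close>

lemma sum_theta_equally_spaced:
  assumes t: "t > 0" and N: "N \<ge> 1"
  shows "(\<Sum>r<N. theta (real r / real N) t) = theta 0 (t / (real N)^2)"
proof -
  define f where "f m = paired_term (gaussian (t / (real N)^2)) 0 m" for m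
  have N0: "real N > 0" using N by simp
  have fs: "f sums theta 0 (t / (real N)^2)"
    unfolding f_def theta_def using t N0 by (intro summable_sums summable_paired_gaussian) auto
  have block: "(\<Sum>r<N. paired_term (gaussian t) (real r / real N) n) = sum f {n * N..<n * N + N}" for n
  proof -
    define G where "G m = gaussian (t / (real N)^2) (real m)" for m
    have p: "paired_term (gaussian t) (real r / real N) n = G (n * N + r) + G (n * N + (N - r))" if "r < N" for r
    proof -
      have "real n + real r / real N = real (n * N + r) / real N"
        using N0 by (simp add: field_simps)
      moreover have "real n + 1 - real r / real N = real (n * N + (N - r)) / real N"
        using N0 that by (simp add: field_simps of_nat_diff)
      ultimately show ?thesis
        by (simp only: paired_term_def gaussian_divide G_def)
    qed
    have "(\<Sum>r<N. paired_term (gaussian t) (real r / real N) n)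
        = (\<Sum>r<N. G (n * N + r)) + (\<Sum>r<N. G (n * N + (N - r)))"
      by (simp add: p sum.distrib)
    \<comment> \<open>Reversing r turns N - r into r + 1, which matches the second half of the terms
      f.\<close>
    also have "(\<Sum>r<N. G (n * N + (N - r))) = (\<Sum>r<N. G (n * N + Suc r))"
      by (subst sum.nat_diff_reindex[symmetric]) (auto intro!: sum.cong simp: Suc_diff_Suc)
    also have "(\<Sum>r<N. G (n * N + r)) + (\<Sum>r<N. G (n * N + Suc r)) = (\<Sum>r<N. f (n * N + r))"
      by (simp add: f_def paired_term_def G_def sum.distrib add_ac)
    also have "\<dots> = sum f {n * N..<n * N + N}"
      by (rule sum.reindex_bij_witness[of _ "\<lambda>m. m - n * N" "\<lambda>r. n * N + r"]) auto
    finally show ?thesis .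
  qed
  have "(\<Sum>r<N. theta (real r / real N) t) = (\<Sum>n. \<Sum>r<N. paired_term (gaussian t) (real r / real N) n)"
    unfolding theta_def using t N0
    by (intro suminf_sum[symmetric] summable_paired_gaussian) (auto simp: field_simps)
  also have "\<dots> = theta 0 (t / (real N)^2)"
    unfolding block using sums_group[OF fs, of N] N by (intro sums_unique[symmetric]) auto
  finally show ?thesis .
qed

text \<open>Leaving out r = 0 costs theta 0 t. The remaining two theta functions are truncated at
  N^2 and at 1 respectively, and the powers between these thresholds are the last two terms.\<close>

lemma sum_reg_theta_equally_spaced:
  assumes t: "t > 0" and N: "N \<ge> 1"
  shows "(\<Sum>r=1..<N. reg_theta 0 (real r / real N) t)
    = reg_theta 1 0 (1 / (real N)^2 * t) - reg_theta 1 0 t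
      + (real N * sqrt pi * powr_between ((real N)^2) (- 1 / 2) t - powr_between ((real N)^2) 0 t)"
proof -
  have N0: "real N > 0" using N by simp
  have sub: "{..<N} = insert 0 {1..<N}" using N by auto
  have "(\<Sum>r<N. theta (real r / real N) t) = theta 0 t + (\<Sum>r=1..<N. theta (real r / real N) t)"
    unfolding sub by (subst sum.insert) auto
  then have th: "(\<Sum>r=1..<N. theta (real r / real N) t) = theta 0 (t / (real N)^2) - theta 0 t"
    using sum_theta_equally_spaced[OF t N] by simp
  have sc: "(t / (real N)^2) powr (- 1 / 2) = real N * t powr (- 1 / 2)"
  proof -
    have "(t / (real N)^2) powr (- 1 / 2) = t powr (- 1 / 2) / ((real N)^2) powr (- 1 / 2)"
      using t by (simp add: powr_divide)
    also have "((real N)^2) powr (- 1 / 2) = 1 / real N"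
      using N0 by (simp add: powr_minus_divide powr_half_sqrt)
    finally show ?thesis by simp
  qed
  have "(\<Sum>r=1..<N. reg_theta 0 (real r / real N) t)
     = theta 0 (t / (real N)^2) - theta 0 t - (real N - 1) * (if t < 1 then sqrt pi * t powr (- 1 / 2) else 0)"
    unfolding reg_theta_def sum_subtractf th using N by (simp add: of_nat_diff)
  moreover have "t < 1 \<Longrightarrow> t < (real N)^2"
    using N by (smt (verit) one_le_power of_nat_1 of_nat_mono)
  ultimately show ?thesis
    using t N0 sc by (auto simp: reg_theta_def powr_between_def algebra_simps)
qed

section \<open>Mellin evaluation of the kernel sum over at least two equally spaced points\<close>

context
  fixes N :: nat
  assumes N: "N \<ge> 2"
begin

definition riesz_sum :: "real \<Rightarrow> real" where
  "riesz_sum t = (\<Sum>r=1..<N. reg_theta 0 (real r / real N) t)"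

lemma riesz_sum_converges: "mellin_converges riesz_sum a"
proof -
  have "mellin_converges (\<lambda>t. \<Sum>r\<in>R. reg_theta 0 (real r / real N) t) a" if "finite R" "R \<subseteq> {1..<N}" for R
    using that
  proof (induction R rule: finite_induct)
    case empty
    then show ?case by (simp add: mellin_converges_def set_integrable_def)
  next
    case (insert r R)
    have "mellin_converges (reg_theta 0 (real r / real N)) a"
      using insert.prems by (intro mellin_converges_reg_theta) (auto simp: field_simps)
    from mellin_converges_lincomb[OF this insert.IH, of 1 1] insert show ?case by simp
  qed
  then show ?thesis unfolding riesz_sum_def[abs_def] by simp
qed

lemma sum_periodic_log_riesz_derivative:
  assumes s: "s > 0"
  shows "((\<lambda>z. mellin riesz_sum z * rGamma z) has_field_derivative
     of_real (\<Sum>r=1..<N. periodic_log_riesz s (real r / real N))) (at (of_real (s / 2)))"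
proof -
  have "(LINT t:{0<..}|lborel. riesz_sum t * log_riesz_density s t)
      = (LINT t|lborel. (\<Sum>r=1..<N. indicator {0<..} t *\<^sub>R (reg_theta 0 (real r / real N) t * log_riesz_density s t)))"
    by (simp add: set_lebesgue_integral_def riesz_sum_def sum_distrib_left sum_distrib_right mult_ac)
  also have "\<dots> = (\<Sum>r=1..<N. LINT t|lborel. indicator {0<..} t *\<^sub>R (reg_theta 0 (real r / real N) t * log_riesz_density s t))"
  proof (rule Bochner_Integration.integral_sum)
    fix r assume "r \<in> {1..<N}"
    then have "real r / real N \<in> {0<..<1}" by (auto simp: field_simps)
    from set_integrable_reg_theta[OF s this]
    show "integrable lborel (\<lambda>t. indicator {0<..} t *\<^sub>R (reg_theta 0 (real r / real N) t * log_riesz_density s t))"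
      by (simp add: set_integrable_def)
  qed
  also have "\<dots> = (\<Sum>r=1..<N. periodic_log_riesz s (real r / real N))"
    by (simp add: periodic_log_riesz_def set_lebesgue_integral_def)
  finally have eq: "(LINT t:{0<..}|lborel. riesz_sum t * log_riesz_density s t)
      = (\<Sum>r=1..<N. periodic_log_riesz s (real r / real N))" .
  show ?thesis
    using mellin_has_log_riesz_derivative(2)[OF riesz_sum_converges[of 0] riesz_sum_converges[of s] _ _ s]
    unfolding eq using s by simp
qed

text \<open>Rescaling by N^2 multiplies the transform of \<open>reg_theta 1 0\<close> by E, and
  \<open>zeta_mellin\<close> rewrites that transform through zeta. The terms with 1 / z cancel, and
  in those with 1 / (2 z - 1) the difference of E - N and E - 1 leaves - (N - 1).\<close>

lemma mellin_riesz_sum: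
  fixes z :: complex
  defines "E \<equiv> exp (z * of_real (ln ((real N)^2)))"
  assumes z: "z \<noteq> 1 / 2" "z \<noteq> 0"
  shows "mellin riesz_sum z * rGamma z
    = 2 * (E - 1) * zeta (2 * z) - 2 * of_real ((real N - 1) * sqrt pi) * rGamma z / (2 * z - 1)"
proof -
  define c where "c = (real N)^2"
  have N0: "real N > 0" using N by simp
  have "1 < real N" using N by simp
  then have c: "c > 1" by (simp add: c_def)
  define m0 where "m0 = mellin (reg_theta 1 0) z"
  note R = mellin_converges_reg_theta_0[of "Re z"]
  note P = mellin_converges_powr_between[OF c, of "- 1 / 2" "Re z"] mellin_converges_powr_between[OF c, of 0 "Re z"]
  have c1: "1 / c > 0" using c by simp
  have "mellin riesz_sum z = mellin (\<lambda>t. 1 * (1 * reg_theta 1 0 (1 / c * t) + (- 1) * reg_theta 1 0 t)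
      + 1 * (real N * sqrt pi * powr_between c (- 1 / 2) t + (- 1) * powr_between c 0 t)) z"
  proof (rule mellin_cong)
    fix t :: real assume "t > 0"
    from sum_reg_theta_equally_spaced[OF this, of N] N
    show "riesz_sum t = 1 * (1 * reg_theta 1 0 (1 / c * t) + (- 1) * reg_theta 1 0 t)
      + 1 * (real N * sqrt pi * powr_between c (- 1 / 2) t + (- 1) * powr_between c 0 t)"
      by (simp add: riesz_sum_def c_def)
  qed
  also have "\<dots> = mellin (\<lambda>t. reg_theta 1 0 (1 / c * t)) z - m0
      + (of_real (real N * sqrt pi) * mellin (powr_between c (- 1 / 2)) z - mellin (powr_between c 0) z)"
    using mellin_lincomb[OF mellin_converges_lincomb[OF mellin_scale(2)[OF c1 R] R] mellin_converges_lincomb[OF P], of 1 1 "-1" 1 "real N * sqrt pi" "-1"]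
      mellin_lincomb[OF mellin_scale(2)[OF c1 R] R, of 1 "-1"]
      mellin_lincomb[OF P, of "real N * sqrt pi" "-1"] by (simp add: m0_def)
  also have "mellin (\<lambda>t. reg_theta 1 0 (1 / c * t)) z = E * m0"
    using mellin_scale(1)[OF c1, of "reg_theta 1 0" z] c by (simp add: ln_div E_def m0_def c_def)
  also have "mellin (powr_between c (- 1 / 2)) z = (exp ((z - 1 / 2) * of_real (ln c)) - 1) / (z - 1 / 2)"
    using mellin_powr_between[OF c, of z "- 1 / 2"] z by simp
  also have "mellin (powr_between c 0) z = (E - 1) / z"
    using mellin_powr_between[OF c, of z 0] z by (simp add: E_def c_def)
  \<comment> \<open>The shift by 1/2 costs a factor exp (ln N) = N, because ln c = 2 ln N.\<close>
  also have "exp ((z - 1 / 2) * of_real (ln c)) = E / of_nat N"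
  proof -
    have "ln c = 2 * ln (real N)" using N0 ln_realpow[of "real N" 2] by (simp add: c_def)
    then have "(z - 1 / 2) * of_real (ln c) = z * of_real (ln ((real N)^2)) - of_real (ln (real N))"
      by (simp add: c_def algebra_simps)
    then show ?thesis using N0 by (simp add: E_def exp_diff exp_of_real)
  qed
  finally have m: "mellin riesz_sum z = E * m0 - m0
      + (of_real (real N * sqrt pi) * ((E / of_nat N - 1) / (z - 1 / 2)) - (E - 1) / z)" .
  have e: "of_real (real N * sqrt pi) * ((E / of_nat N - 1) / (z - 1 / 2)) = 2 * of_real (sqrt pi) * (E - of_nat N) / (2 * z - 1)"
    using z N0 by (simp add: field_simps)
  have "2 * z \<noteq> 1" using z(1) by (simp add: eq_divide_eq mult.commute)
  then have "2 * zeta (2 * z) = rGamma z * m0 + 2 * of_real (sqrt pi) * rGamma z / (2 * z - 1) - rGamma (z + 1)"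
    by (simp add: zeta_eq_zeta_mellin zeta_mellin_def m0_def)
  also have "rGamma (z + 1) = rGamma z / z"
    using rGamma_plus1[of z] z by (simp add: field_simps)
  finally have "2 * (E - 1) * zeta (2 * z) = (E - 1) * (rGamma z * m0 + 2 * of_real (sqrt pi) * rGamma z / (2 * z - 1) - rGamma z / z)"
    by (metis mult.assoc mult.commute)
  then show ?thesis
    unfolding m e by (simp add: algebra_simps diff_divide_distrib add_divide_distrib)
qed

text \<open>The identity \<open>mellin_riesz_sum\<close> is differentiated at z = s / 2. The common
  factor 4 arises from its prefactor 2, combined with ln (N^2) = 2 ln N in one term and with the
  inner derivative of zeta (2 z) in another.\<close>

lemma sum_periodic_log_riesz_eq:
  assumes s: "s > 0" "s \<noteq> 1"
  shows "(\<Sum>r=1..<N. periodic_log_riesz s (real r / real N)) = 4 *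
    (real N powr s * ln (real N) * Re (zeta (of_real s)) + Re (deriv zeta (of_real s)) * (real N powr s - 1)
     + sqrt pi * (real N - 1) * ((deriv Gamma (s / 2) * ((s - 1) / 2) + Gamma (s / 2)) / ((Gamma (s / 2))^2 * (s - 1)^2)))"
proof -
  have N0: "real N > 0" using N by simp
  define w :: complex where "w = of_real (s / 2)"
  have w2: "2 * w = of_real s" by (simp add: w_def)
  define l where "l = ln ((real N)^2)"
  have l: "l = 2 * ln (real N)" using N0 ln_realpow[of "real N" 2] by (simp add: l_def)
  have nonpos: "w \<notin> \<int>\<^sub>\<le>\<^sub>0"
    using s by (intro Re_pos_notin_nonpos_Ints) (simp add: w_def)
  have wne: "2 * w - 1 \<noteq> 0"
    using s by (simp add: w2)
  have "(zeta has_field_derivative deriv zeta (2 * w)) (at (2 * w))"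
    using wne by (intro holomorphic_derivI[OF zeta_holomorphic]) auto
  then have dz: "((\<lambda>z. zeta (2 * z)) has_field_derivative deriv zeta (2 * w) * 2) (at w)"
    by (rule DERIV_chain2) (auto intro!: derivative_eq_intros)
  have "((\<lambda>z. 2 * (exp (z * of_real l) - 1) * zeta (2 * z) - 2 * of_real ((real N - 1) * sqrt pi) * rGamma z / (2 * z - 1))
     has_field_derivative
      2 * (exp (w * of_real l) * of_real l) * zeta (2 * w) + deriv zeta (2 * w) * 2 * (2 * (exp (w * of_real l) - 1))
      - 2 * of_real ((real N - 1) * sqrt pi) * ((- rGamma w * Digamma w) * (2 * w - 1) - rGamma w * 2) / ((2 * w - 1) * (2 * w - 1)))
     (at w)"
  proof -
    have p1: "((\<lambda>z. 2 * (exp (z * of_real l) - 1)) has_field_derivative 2 * (exp (w * of_real l) * of_real l)) (at w)"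
      by (auto intro!: derivative_eq_intros)
    have p2: "((\<lambda>z. 2 * z - 1) has_field_derivative 2) (at w)"
      by (auto intro!: derivative_eq_intros)
    note p3 = DERIV_cmult[OF has_field_derivative_rGamma_no_nonpos_int[OF nonpos], of "2 * of_real ((real N - 1) * sqrt pi)"]
    show ?thesis
      by (rule DERIV_cong[OF DERIV_diff[OF DERIV_mult[OF p1 dz] DERIV_divide[OF p3 p2 wne]]])
         (simp only: right_diff_distrib mult.assoc)
  qed
  moreover have "((\<lambda>z. 2 * (exp (z * of_real l) - 1) * zeta (2 * z) - 2 * of_real ((real N - 1) * sqrt pi) * rGamma z / (2 * z - 1))
     has_field_derivative of_real (\<Sum>r=1..<N. periodic_log_riesz s (real r / real N))) (at w)"
  proof (rule has_field_derivative_transform_within_open)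
    show "((\<lambda>z. mellin riesz_sum z * rGamma z) has_field_derivative
        of_real (\<Sum>r=1..<N. periodic_log_riesz s (real r / real N))) (at w)"
      unfolding w_def by (rule sum_periodic_log_riesz_derivative[OF s(1)])
    \<comment> \<open>The points excluded in \<open>mellin_riesz_sum\<close>; s > 0 and s different
      from 1 keep w away from them.\<close>
    show "open (- {0, 1 / 2 :: complex})" by (intro open_Compl finite_imp_closed) auto
    show "w \<in> - {0, 1 / 2}" using wne s by (auto simp: w_def)
    show "mellin riesz_sum z * rGamma z = 2 * (exp (z * of_real l) - 1) * zeta (2 * z) - 2 * of_real ((real N - 1) * sqrt pi) * rGamma z / (2 * z - 1)"
      if "z \<in> - {0, 1 / 2}" for z
      using mellin_riesz_sum[of z] that by (simp add: l_def)
  qed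
  ultimately have "complex_of_real (\<Sum>r=1..<N. periodic_log_riesz s (real r / real N)) =
     2 * (exp (w * of_real l) * of_real l) * zeta (2 * w) + deriv zeta (2 * w) * 2 * (2 * (exp (w * of_real l) - 1))
      - 2 * of_real ((real N - 1) * sqrt pi) * ((- rGamma w * Digamma w) * (2 * w - 1) - rGamma w * 2) / ((2 * w - 1) * (2 * w - 1))"
    using DERIV_unique by blast
  also have "exp (w * of_real l) = of_real (real N powr s)"
    using N0 by (simp add: w_def l powr_def exp_of_real[symmetric])
  also have "rGamma w = of_real (1 / Gamma (s / 2))"
    using Gamma_complex_of_real[of "s / 2"] by (simp add: w_def rGamma_inverse_Gamma inverse_eq_divide)
  also have "Digamma w = of_real (Digamma (s / 2))"
    unfolding w_def using s by (intro Polygamma_of_real) auto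
  also have "2 * w - 1 = of_real (s - 1)" by (simp add: w2)
  finally have "complex_of_real (\<Sum>r=1..<N. periodic_log_riesz s (real r / real N)) =
     of_real (2 * (real N powr s * l)) * zeta (of_real s) + of_real (4 * (real N powr s - 1)) * deriv zeta (of_real s)
      - of_real (2 * ((real N - 1) * sqrt pi) * (- (1 / Gamma (s / 2)) * Digamma (s / 2) * (s - 1) - 1 / Gamma (s / 2) * 2) / ((s - 1) * (s - 1)))"
    unfolding w2 by (simp add: algebra_simps)
  from arg_cong[OF this, of Re]
  have S: "(\<Sum>r=1..<N. periodic_log_riesz s (real r / real N)) =
     2 * (real N powr s * l) * Re (zeta (of_real s)) + 4 * (real N powr s - 1) * Re (deriv zeta (of_real s))
      - 2 * ((real N - 1) * sqrt pi) * (- (1 / Gamma (s / 2)) * Digamma (s / 2) * (s - 1) - 1 / Gamma (s / 2) * 2) / ((s - 1) * (s - 1))"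
    by (simp only: Re_complex_of_real minus_complex.simps plus_complex.simps times_complex.simps Im_complex_of_real mult_zero_left diff_zero)
  have G: "Gamma (s / 2) > 0" using s by (simp add: Gamma_real_pos)
  have dG: "deriv Gamma (s / 2) = Gamma (s / 2) * Digamma (s / 2)"
    using s by (intro DERIV_imp_deriv has_field_derivative_Gamma) (auto elim!: nonpos_Ints_cases)
  \<comment> \<open>Algebra that replaces 1 / \<Gamma> and \<psi> by the quotient in terms of
    \<Gamma> and its derivative.\<close>
  have "- (2 * ((real N - 1) * sqrt pi) * (- (1 / g) * d * u - 1 / g * 2) / (u * u))
     = 4 * (sqrt pi * (real N - 1) * ((g * d * (u / 2) + g) / (g^2 * u^2)))" if "g \<noteq> 0" "u \<noteq> 0" for g d u :: real
    using that by (simp add: field_simps power2_eq_square)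
  from this[of "Gamma (s / 2)" "s - 1" "Digamma (s / 2)"] show ?thesis
    unfolding S l dG using G s by (simp add: algebra_simps)
qed

text \<open>The entire function K satisfies (2 z - 1) K = R near 1/2, with R free of poles. Two
  differentiations give 4 K' + (2 z - 1) K'' = R'', hence the wanted derivative K' at 1/2 is a
  quarter of R'' there.\<close>

lemma sum_periodic_log_riesz_1:
  "(\<Sum>r=1..<N. periodic_log_riesz 1 (real r / real N)) =
     2 * real N * (ln (real N))^2 + 4 * euler_mascheroni * real N * ln (real N)
     - (real N - 1) * (4 * gamma1 + 1 / 2 * ((Digamma (1 / 2))^2 - deriv Digamma (1 / 2)))"
proof -
  have N0: "real N > 0" using N by simp
  define l where "l = ln ((real N)^2)"
  have l: "l = 2 * ln (real N)" using N0 ln_realpow[of "real N" 2] by (simp add: l_def)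
  \<comment> \<open>Doubling maps this disc into the disc of radius 1/2 around 1, on which
    \<open>zeta_regular\<close> is holomorphic.\<close>
  define B where "B = ball (1 / 2 :: complex) (1 / 4)"
  have B: "open B" "1 / 2 \<in> B" by (auto simp: B_def)
  have B2: "2 * z \<in> ball 1 (1/2)" if "z \<in> B" for z
  proof -
    have "norm (1 - 2 * z) = 2 * norm (1 / 2 - z)"
      by (simp flip: norm_mult_numeral1 add: algebra_simps)
    then show ?thesis using that by (simp add: B_def dist_norm)
  qed
  have Bnp: "z \<notin> \<int>\<^sub>\<le>\<^sub>0" if "z \<in> B" for z
  proof (rule Re_pos_notin_nonpos_Ints)
    have "\<bar>Re (1 / 2 - z)\<bar> \<le> norm (1 / 2 - z)" by (rule abs_Re_le_cmod)
    then show "Re z > 0" using that by (simp add: B_def dist_norm)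
  qed
  define K where "K z = mellin riesz_sum z * rGamma z" for z
  have K: "K holomorphic_on UNIV"
    unfolding K_def by (intro holomorphic_intros mellin_entire riesz_sum_converges)
  have dK: "(K has_field_derivative deriv K z) (at z)" for z
    by (rule holomorphic_derivI[OF K]) auto
  have ddK: "(deriv K has_field_derivative deriv (deriv K) z) (at z)" for z
    by (rule holomorphic_derivI[OF holomorphic_deriv[OF K]]) auto
  define a where "a = complex_of_real ((real N - 1) * sqrt pi)"
  define V where "V = zeta_regular"
  have dV: "(V has_field_derivative deriv V z) (at z)" "(deriv V has_field_derivative deriv (deriv V) z) (at z)"
    if "z \<in> ball 1 (1/2)" for z
    unfolding V_def
    using holomorphic_derivI[OF zeta_regular_holomorphic _ that]
      holomorphic_derivI[OF holomorphic_deriv[OF zeta_regular_holomorphic] _ that] by auto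
  define R where "R z = 2 * (exp (z * of_real l) - 1) * V (2 * z) - 2 * a * rGamma z" for z
  define R1 where "R1 z = 2 * (exp (z * of_real l) * of_real l) * V (2 * z) + 2 * (exp (z * of_real l) - 1) * (deriv V (2 * z) * 2)
      + 2 * a * (rGamma z * Digamma z)" for z
  define R2 where "R2 z = 2 * (exp (z * of_real l) * of_real l * of_real l) * V (2 * z)
      + 2 * (2 * (exp (z * of_real l) * of_real l) * (deriv V (2 * z) * 2))
      + 2 * (exp (z * of_real l) - 1) * (deriv (deriv V) (2 * z) * 2 * 2)
      + 2 * a * (- rGamma z * Digamma z * Digamma z + rGamma z * Polygamma 1 z)" for z
  have dR: "(R has_field_derivative R1 z) (at z)" and dR1: "(R1 has_field_derivative R2 z) (at z)" if z: "z \<in> B" for z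
  proof -
    have V2: "((\<lambda>z. V (2 * z)) has_field_derivative deriv V (2 * z) * 2) (at z)"
      "((\<lambda>z. deriv V (2 * z)) has_field_derivative deriv (deriv V) (2 * z) * 2) (at z)"
      by (rule DERIV_chain2, rule dV, rule B2, rule z, auto intro!: derivative_eq_intros)+
    have p: "((\<lambda>z. exp (z * of_real l)) has_field_derivative exp (z * of_real l) * of_real l) (at z)"
      "((\<lambda>z. 2 * (exp (z * of_real l) - 1)) has_field_derivative 2 * (exp (z * of_real l) * of_real l)) (at z)"
      by (auto intro!: derivative_eq_intros)
    note r = has_field_derivative_rGamma_no_nonpos_int[OF Bnp[OF z], of UNIV]
    note P = has_field_derivative_Polygamma[OF Bnp[OF z], of 0 UNIV]
    show "(R has_field_derivative R1 z) (at z)"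
      unfolding R_def[abs_def] R1_def
      by (rule DERIV_cong[OF DERIV_diff[OF DERIV_mult[OF p(2) V2(1)] DERIV_cmult[OF r]]]) (simp add: algebra_simps)
    show "(R1 has_field_derivative R2 z) (at z)"
      unfolding R1_def[abs_def] R2_def
      by (rule DERIV_cong[OF DERIV_add[OF DERIV_add[OF
            DERIV_mult[OF DERIV_cmult[OF DERIV_cmult_right[OF p(1)]] V2(1)]
            DERIV_mult[OF p(2) DERIV_cmult_right[OF V2(2)]]]
            DERIV_cmult[OF DERIV_mult[OF r P]]]]) (simp add: algebra_simps)
  qed
  have rG: "rGamma (1 / 2 :: complex) = of_real (1 / sqrt pi)"
    by (simp add: rGamma_inverse_Gamma Gamma_one_half_complex inverse_eq_divide)
  have E: "exp (1 / 2 * of_real l) = complex_of_real (real N)"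
    using N0 by (simp add: l exp_of_real)
  have eq: "(2 * z - 1) * K z = R z" if z: "z \<in> B" for z
  proof (cases "z = 1 / 2")
    case True
    \<comment> \<open>Both sides vanish: exp (l / 2) - 1 = N - 1 and a / sqrt pi = N - 1. This is
      the cancellation of the two poles.\<close>
    show ?thesis
      unfolding True R_def V_def using E rG by (simp add: zeta_regular_derivs(1) a_def)
  next
    case False
    then have ne: "2 * z - 1 \<noteq> 0" by (simp add: eq_divide_eq mult.commute)
    have z0: "z \<noteq> 0" using Bnp[OF z] by auto
    have "V (2 * z) = (2 * z - 1) * zeta (2 * z)"
      unfolding V_def using ne by (intro zeta_regular_eq B2 z) auto
    moreover have "y * (p * q - r / y) = p * (y * q) - r" if "y \<noteq> 0" for y p q r :: complex
      using that by (simp add: field_simps)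
    ultimately show ?thesis
      unfolding K_def mellin_riesz_sum[OF False z0] R_def l_def[symmetric] a_def[symmetric]
      using ne by simp
  qed
  have R1: "2 * K z + (2 * z - 1) * deriv K z = R1 z" if z: "z \<in> B" for z
  proof -
    have "((\<lambda>z. (2 * z - 1) * K z) has_field_derivative 2 * K z + deriv K z * (2 * z - 1)) (at z)"
      by (rule DERIV_mult[OF _ dK]) (auto intro!: derivative_eq_intros)
    then have "(R has_field_derivative 2 * K z + deriv K z * (2 * z - 1)) (at z)"
      by (rule has_field_derivative_transform_within_open[OF _ B(1) z]) (rule eq)
    from DERIV_unique[OF this dR[OF z]] show ?thesis by (simp add: mult.commute)
  qed
  have "((\<lambda>z. 2 * K z + (2 * z - 1) * deriv K z) has_field_derivative
      2 * deriv K (1/2) + (2 * deriv K (1/2) + deriv (deriv K) (1/2) * (2 * (1/2) - 1))) (at (1/2))"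
    by (intro DERIV_add DERIV_cmult dK DERIV_mult ddK) (auto intro!: derivative_eq_intros)
  then have "(R1 has_field_derivative 2 * deriv K (1/2) + (2 * deriv K (1/2) + deriv (deriv K) (1/2) * (2 * (1/2) - 1))) (at (1/2))"
    by (rule has_field_derivative_transform_within_open[OF _ B]) (rule R1)
  from DERIV_unique[OF this dR1[OF B(2)]] have 4: "4 * deriv K (1/2) = R2 (1/2)" by simp
  have "(K has_field_derivative of_real (\<Sum>r=1..<N. periodic_log_riesz 1 (real r / real N))) (at (1/2))"
    unfolding K_def[abs_def] using sum_periodic_log_riesz_derivative[of 1] by simp
  then have KS: "deriv K (1/2) = of_real (\<Sum>r=1..<N. periodic_log_riesz 1 (real r / real N))"
    by (rule DERIV_imp_deriv)
  have Dig: "Digamma (1 / 2 :: complex) = of_real (Digamma (1 / 2))" "Polygamma 1 (1 / 2 :: complex) = of_real (Polygamma 1 (1 / 2))"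
    using Polygamma_of_real[of "1/2" 0, where 'a = complex] Polygamma_of_real[of "1/2" 1, where 'a = complex] by simp_all
  have arG: "a * rGamma (1 / 2) = of_real (real N - 1)"
    unfolding rG a_def by simp
  have aG: "2 * a * (- rGamma (1/2) * Digamma (1/2) * Digamma (1/2) + rGamma (1/2) * Polygamma 1 (1/2))
    = 2 * of_real (real N - 1) * (- Digamma (1/2) * Digamma (1/2) + Polygamma 1 (1/2))"
    unfolding arG[symmetric] by (simp add: algebra_simps)
  have "complex_of_real (4 * (\<Sum>r=1..<N. periodic_log_riesz 1 (real r / real N))) = R2 (1/2)"
    using 4 by (simp add: KS)
  \<comment> \<open>The coefficient 16 of \<open>gamma1\<close> is the product of 2 (N - 1), the
    factor 4 from differentiating V (2 z) twice, and the value - 2 \<open>gamma1\<close> of the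
    second derivative of V at 1. The last summand is the second derivative of - 2 a
    \<open>rGamma\<close>, where a \<open>rGamma (1 / 2)\<close> is N - 1.\<close>
  also have "\<dots> = of_real (2 * (real N * l * l) + 8 * (real N * l) * euler_mascheroni - 16 * (real N - 1) * gamma1
      + 2 * (real N - 1) * (- Digamma (1/2) * Digamma (1/2) + Polygamma 1 (1/2)))"
    unfolding R2_def E aG unfolding Dig V_def
    by (simp add: zeta_regular_derivs algebra_simps)
  finally have S4: "4 * (\<Sum>r=1..<N. periodic_log_riesz 1 (real r / real N))
     = 2 * (real N * l * l) + 8 * (real N * l) * euler_mascheroni - 16 * (real N - 1) * gamma1
      + 2 * (real N - 1) * (- Digamma (1/2) * Digamma (1/2) + Polygamma 1 (1/2))"
    by (simp only: of_real_eq_iff)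
  have dD: "deriv Digamma (1 / 2 :: real) = Polygamma 1 (1 / 2)"
  proof (rule DERIV_imp_deriv)
    have "(1 / 2 :: real) \<notin> \<int>\<^sub>\<le>\<^sub>0" using nonpos_Ints_nonpos[of "1 / 2 :: real"] by auto
    then show "(Digamma has_real_derivative Polygamma 1 (1 / 2)) (at (1 / 2))"
      using has_field_derivative_Polygamma[of "1/2 :: real" 0 UNIV] by simp
  qed
  show ?thesis
    unfolding dD using S4 unfolding l by (simp add: field_simps power2_eq_square)
qed

end

theorem theorem5p4:
  fixes s :: real and N :: nat
  assumes "s > 0" and "N \<ge> 1"
  shows "(s \<noteq> 1 \<longrightarrow>
            log_riesz_energy s N = ereal (4 *
              (real N powr (1 + s) * ln (real N) * Re (zeta (of_real s))
               + Re (deriv zeta (of_real s)) * real N * (real N powr s - 1)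
               + sqrt pi * real N * (real N - 1)
                 * ((deriv Gamma (s / 2) * ((s - 1) / 2) + Gamma (s / 2))
                    / ((Gamma (s / 2))^2 * (s - 1)^2)))))
         \<and> (s = 1 \<longrightarrow>
            log_riesz_energy s N = ereal (
              2 * (real N * ln (real N))^2
              + 4 * euler_mascheroni * (real N)^2 * ln (real N)
              - real N * (real N - 1)
                * (4 * gamma1 + 1 / 2 * ((Digamma (1 / 2))^2 - deriv Digamma (1 / 2)))))
         \<and> gamma1_seq \<longlonglongrightarrow> gamma1
         \<and> (\<exists>F. (\<lambda>z. zeta (1 + z)) has_laurent_expansion F \<and> fls_nth F 1 = - of_real gamma1)"
proof (intro conjI impI zeta_regular_derivs(3) zeta_laurent_expansion, goal_cases)
  note E = log_riesz_energy_eq[OF assms]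
  case 1
  show ?case
  \<comment> \<open>For N = 1 there are no pairs, and the right-hand side vanishes through ln 1 = 0
    and the factors N^s - 1 and N - 1. The Mellin evaluation is for N \<ge> 2, where the interval
    [1, N^2) is nonempty.\<close>
  proof (cases "N = 1")
    case True
    then show ?thesis using E by simp
  next
    case False
    then have N: "N \<ge> 2" using assms by simp
    have "real N powr (1 + s) = real N * real N powr s"
      using assms(2) by (simp add: powr_add)
    then show ?thesis
      unfolding E sum_periodic_log_riesz_eq[OF N assms(1) 1]
      by (simp only: distrib_left mult_ac)
  qed
next
  note E = log_riesz_energy_eq[OF assms]
  case 2
  show ?case
  proof (cases "N = 1")
    case True
    then show ?thesis using E by simp
  next
    case False
    then have N: "N \<ge> 2" using assms by simp
    have "n * (2 * n * l^2 + 4 * g * n * l - (n - 1) * X) = 2 * (n * l)^2 + 4 * g * n^2 * l - n * (n - 1) * X"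
      for n l g X :: real
      by (simp add: algebra_simps power2_eq_square)
    then show ?thesis
      using E unfolding 2 sum_periodic_log_riesz_1[OF N] by metis
  qed
qed

end
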